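(* Let $\Omega\subseteq\mathbb{R}^3$ be a bounded domain, $\mathscr{C}=\Omega\times(0,\infty)$, and $w\in L^2(\mathscr{C},\mathbb{B})$ (extended by zero outside $\Omega$). Then, for each choice of sign, the operator $w\mapsto T_{\mathscr{C},\pm}[\mp i\,w]$ is a right inverse of $D\pm i\partial_t$, that is, $$(D\pm i\partial_t)\,T_{\mathscr{C},\pm}[\mp i\,w](x,t)=w(x,t),\qquad\forall (x,t)\in\mathbb{R}^3\times(0,\infty).$$
   Context: $\mathbb{B}=\mathbb{H}+i\mathbb{H}$ denotes the biquaternions, where $\mathbb{H}$ is the real quaternions with units $1,e_1,e_2,e_3$ and the complex imaginary unit $i$ commutes with $e_1,e_2,e_3$. $L^2(\mathscr{C},\mathbb{B})$ consists of the functions all of whose components are in $L^2(\mathscr{C})$. $D=\sum_{j=1}^3e_j\partial_j$ acts by left multiplication in the spatial variables. Functions on $\mathscr{C}$ are extended by zero to $(\mathbb{R}^3\setminus\overline\Omega)\times(0,\infty)$. The Fourier transform is taken in the spatial variable only, componentwise: $\mathcal{F}(w)(k,s)=\int_{\mathbb{R}^3}\exp(-2\pi i\langle k,x\rangle)w(x,s)\,dx$, where $\langle k,x\rangle=\sum_{j=1}^3k_jx_j$; it is extended to $L^2(\mathbb{R}^3)$ as usual, with inverse $\mathcal{F}^{-1}(f)(x)=\mathcal{F}(f)(-x)$. The parabolic Teodorescu transform is $$T_{\mathscr{C},\pm}[w](x,t)=\int_0^t\int_{\mathbb{R}^3}\exp(2\pi i\langle x,k\rangle)\exp(\mp2\pi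 k(t-s))\,\mathcal{F}(w)(k,s)\,dk\,ds,$$ where $k\in\mathbb{R}^3$ in the second exponential is identified with the quaternion $\sum_{j=1}^3k_je_j$, $\exp(\mp2\pi k\tau)=\cos(2\pi|k|\tau)\mp\frac{k}{|k|}\sin(2\pi|k|\tau)$, and integrals of the form $\int_{\mathbb{R}^3}\exp(2\pi i\langle x,k\rangle)g(k)\,dk$ with $g\in L^2(\mathbb{R}^3)$ stand for $\mathcal{F}^{-1}(g)(x)$. *)

theory Defs
  imports "HOL-Analysis.Analysis"
begin

section \<open>Biquaternions\<close>

text \<open>
  A biquaternion \<open>q0 + q1 e1 + q2 e2 + q3 e3\<close> with complex coefficients is the vector of its
  coefficients, indexed by \<open>0, 1, 2, 3 :: 4\<close>. The real quaternions are the vectors with real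
  coefficients, and \<open>a + i b\<close> with real quaternions \<open>a, b\<close> has coefficients \<open>a_j + i b_j\<close>.
  Multiplication by a complex scalar is \<open>(*s)\<close>. The product of the algebra is \<open>\<odot>\<close>;
  the library's \<open>(*)\<close> on vectors is the componentwise product and is not used for
  biquaternions.
\<close>

type_synonym biquat = "complex ^ 4"

definition bq :: "complex \<Rightarrow> complex \<Rightarrow> complex \<Rightarrow> complex \<Rightarrow> biquat" where
  "bq a b c d = (\<chi> j. if j = 0 then a else if j = 1 then b else if j = 2 then c else d)"

definition bq_mult :: "biquat \<Rightarrow> biquat \<Rightarrow> biquat" (infixl \<open>\<odot>\<close> 70) where
  "p \<odot> q = bq
     (p$0 * q$0 - p$1 * q$1 - p$2 * q$2 - p$3 * q$3)
     (p$0 * q$1 + p$1 * q$0 + p$2 * q$3 - p$3 * q$2)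
     (p$0 * q$2 - p$1 * q$3 + p$2 * q$0 + p$3 * q$1)
     (p$0 * q$3 + p$1 * q$2 - p$2 * q$1 + p$3 * q$0)"

definition bq_one :: biquat where "bq_one = bq 1 0 0 0"
definition e1 :: biquat where "e1 = bq 0 1 0 0"
definition e2 :: biquat where "e2 = bq 0 0 1 0"
definition e3 :: biquat where "e3 = bq 0 0 0 1"

lemma bq_nth [simp]:
  "bq a b c d $ 0 = a" "bq a b c d $ 1 = b" "bq a b c d $ 2 = c" "bq a b c d $ 3 = d"
  by (simp_all add: bq_def)

lemma UNIV_4_from_0: "(UNIV :: 4 set) = {0, 1, 2, 3}"
proof -
  have "(4::4) = 0" by simp
  then show ?thesis using UNIV_4 by auto
qed

lemma biquat_eq_iff:
  "(p :: biquat) = q \<longleftrightarrow> p$0 = q$0 \<and> p$1 = q$1 \<and> p$2 = q$2 \<and> p$3 = q$3"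
proof -
  have "(p = q) = (\<forall>j\<in>UNIV. p$j = q$j)" by (simp add: vec_eq_iff)
  then show ?thesis unfolding UNIV_4_from_0 by simp
qed

lemma bq_mult_units:
  "e1 \<odot> e1 = - bq_one" "e2 \<odot> e2 = - bq_one" "e3 \<odot> e3 = - bq_one"
  "e1 \<odot> e2 = e3" "e2 \<odot> e3 = e1" "e3 \<odot> e1 = e2"
  "e2 \<odot> e1 = - e3" "e3 \<odot> e2 = - e1" "e1 \<odot> e3 = - e2"
  by (simp_all add: biquat_eq_iff bq_mult_def e1_def e2_def e3_def bq_one_def)

lemma bq_mult_one: "bq_one \<odot> q = q" "q \<odot> bq_one = q"
  by (simp_all add: biquat_eq_iff bq_mult_def bq_one_def)

lemma bq_mult_assoc: "(p \<odot> q) \<odot> r = p \<odot> (q \<odot> r)"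
  by (simp add: biquat_eq_iff bq_mult_def algebra_simps)

lemma bq_mult_scalar: "(c *s p) \<odot> q = c *s (p \<odot> q)" "p \<odot> (c *s q) = c *s (p \<odot> q)"
  by (simp_all add: biquat_eq_iff bq_mult_def algebra_simps)

lemma biquat_expand: "q = q$0 *s bq_one + q$1 *s e1 + q$2 *s e2 + q$3 *s e3"
  by (simp add: biquat_eq_iff e1_def e2_def e3_def bq_one_def)

definition vecq :: "real ^ 3 \<Rightarrow> biquat" where
  "vecq k = complex_of_real (k$1) *s e1 + complex_of_real (k$2) *s e2 + complex_of_real (k$3) *s e3"

text \<open>
  \<open>kexp \<sigma> k \<tau>\<close> is \<open>exp (- \<sigma> 2 \<pi> k \<tau>)\<close> for \<open>\<sigma> = 1\<close> or \<open>\<sigma> = -1\<close> and the quaternion \<open>k\<close>. At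
  \<open>k = 0\<close> the second term vanishes, by the convention \<open>x / 0 = 0\<close>.
\<close>

definition kexp :: "real \<Rightarrow> real ^ 3 \<Rightarrow> real \<Rightarrow> biquat" where
  "kexp \<sigma> k \<tau> = complex_of_real (cos (2 * pi * norm k * \<tau>)) *s bq_one
     - complex_of_real (\<sigma> * (sin (2 * pi * norm k * \<tau>) / norm k)) *s vecq k"


section \<open>Square-integrable functions and the Fourier transform\<close>

definition square_integrable :: "'a measure \<Rightarrow> ('a \<Rightarrow> complex) \<Rightarrow> bool" where
  "square_integrable M f \<longleftrightarrow>
     f \<in> borel_measurable M \<and> integrable M (\<lambda>x. (cmod (f x))\<^sup>2)"

definition square_integrable_bq :: "'a measure \<Rightarrow> ('a \<Rightarrow> biquat) \<Rightarrow> bool" where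
  "square_integrable_bq M w \<longleftrightarrow> (\<forall>j. square_integrable M (\<lambda>x. w x $ j))"

definition L2_converges :: "(nat \<Rightarrow> real ^ 3 \<Rightarrow> complex) \<Rightarrow> (real ^ 3 \<Rightarrow> complex) \<Rightarrow> bool" where
  "L2_converges g f \<longleftrightarrow>
     (\<lambda>n. \<integral>\<^sup>+ x. ennreal ((cmod (g n x - f x))\<^sup>2) \<partial>lebesgue) \<longlonglongrightarrow> 0"

definition fourier_L1 :: "(real ^ 3 \<Rightarrow> complex) \<Rightarrow> real ^ 3 \<Rightarrow> complex" where
  "fourier_L1 f k = (LINT x|lebesgue. exp (- (2 * complex_of_real pi * \<i> * complex_of_real (k \<bullet> x))) * f x)"

text \<open>
  The extension by continuity of \<open>fourier_L1\<close> from the integrable square-integrable functions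
  to all square-integrable functions. The transform is determined up to a null set;
  \<open>fourier\<close> picks a representative.
\<close>

definition is_fourier :: "(real ^ 3 \<Rightarrow> complex) \<Rightarrow> (real ^ 3 \<Rightarrow> complex) \<Rightarrow> bool" where
  "is_fourier f g \<longleftrightarrow> square_integrable lebesgue f \<and> square_integrable lebesgue g \<and>
     (\<exists>\<phi>. (\<forall>n. integrable lebesgue (\<phi> n) \<and> square_integrable lebesgue (\<phi> n)) \<and>
          L2_converges \<phi> f \<and> L2_converges (\<lambda>n. fourier_L1 (\<phi> n)) g)"

definition fourier :: "(real ^ 3 \<Rightarrow> complex) \<Rightarrow> real ^ 3 \<Rightarrow> complex" where
  "fourier f = (SOME g. is_fourier f g)"

definition fourier_bq :: "(real ^ 3 \<Rightarrow> biquat) \<Rightarrow> real ^ 3 \<Rightarrow> biquat" where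
  "fourier_bq f k = (\<chi> j. fourier (\<lambda>x. f x $ j) k)"

definition inv_fourier_bq :: "(real ^ 3 \<Rightarrow> biquat) \<Rightarrow> real ^ 3 \<Rightarrow> biquat" where
  "inv_fourier_bq g x = fourier_bq g (- x)"


section \<open>The parabolic Teodorescu transform\<close>

definition domain :: "(real ^ 3) set \<Rightarrow> bool" where
  "domain \<Omega> \<longleftrightarrow> open \<Omega> \<and> connected \<Omega> \<and> \<Omega> \<noteq> {}"

definition cyl :: "(real ^ 3) set \<Rightarrow> ((real ^ 3) \<times> real) set" where
  "cyl \<Omega> = \<Omega> \<times> {0<..}"

definition zero_ext :: "(real ^ 3) set \<Rightarrow> ((real ^ 3) \<times> real \<Rightarrow> biquat) \<Rightarrow> (real ^ 3) \<times> real \<Rightarrow> biquat" where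
  "zero_ext \<Omega> w p = (if p \<in> cyl \<Omega> then w p else 0)"

definition teodorescu_kernel ::
  "(real ^ 3) set \<Rightarrow> real \<Rightarrow> ((real ^ 3) \<times> real \<Rightarrow> biquat) \<Rightarrow> real \<Rightarrow> real \<Rightarrow> real ^ 3 \<Rightarrow> biquat" where
  "teodorescu_kernel \<Omega> \<sigma> w t s =
     inv_fourier_bq (\<lambda>k. kexp \<sigma> k (t - s) \<odot> fourier_bq (\<lambda>x. zero_ext \<Omega> w (x, s)) k)"

text \<open>
  \<open>teodorescu_kernel \<Omega> \<sigma> w t s\<close> is determined up to a null set for each \<open>s\<close> separately, so
  its integral over \<open>s\<close> at a fixed \<open>x\<close> is meaningful only after the representatives have been
  chosen jointly measurably in \<open>(x, s)\<close>; this is the function \<open>h\<close>. By Fubini the integral then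
  does not depend on \<open>h\<close>, up to a null set of \<open>x\<close>.
\<close>

definition is_teodorescu ::
  "(real ^ 3) set \<Rightarrow> real \<Rightarrow> ((real ^ 3) \<times> real \<Rightarrow> biquat) \<Rightarrow> ((real ^ 3) \<times> real \<Rightarrow> biquat) \<Rightarrow> bool" where
  "is_teodorescu \<Omega> \<sigma> w u \<longleftrightarrow>
     u \<in> borel_measurable (lebesgue_on (cyl UNIV)) \<and>
     (\<forall>t>0. \<exists>h. h \<in> borel_measurable (lebesgue_on (UNIV \<times> {0<..<t})) \<and>
        (AE s in lebesgue_on {0<..<t}. AE x in lebesgue. h (x, s) = teodorescu_kernel \<Omega> \<sigma> w t s x) \<and>
        (AE x in lebesgue. set_integrable lebesgue {0<..<t} (\<lambda>s. h (x, s)) \<and>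
            u (x, t) = (LINT s:{0<..<t}|lebesgue. h (x, s))))"

definition teodorescu ::
  "(real ^ 3) set \<Rightarrow> real \<Rightarrow> ((real ^ 3) \<times> real \<Rightarrow> biquat) \<Rightarrow> (real ^ 3) \<times> real \<Rightarrow> biquat" where
  "teodorescu \<Omega> \<sigma> w = (SOME u. is_teodorescu \<Omega> \<sigma> w u)"


section \<open>The operator \<open>D \<plusminus> i \<partial>\<^sub>t\<close> in the sense of distributions\<close>

fun cont_diff :: "nat \<Rightarrow> ('a::euclidean_space \<Rightarrow> real) \<Rightarrow> bool" where
  "cont_diff 0 f \<longleftrightarrow> continuous_on UNIV f"
| "cont_diff (Suc n) f \<longleftrightarrow> (\<forall>x. f differentiable (at x)) \<and>
     (\<forall>b\<in>Basis. cont_diff n (\<lambda>x. frechet_derivative f (at x) b))"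

definition test_function :: "'a::euclidean_space set \<Rightarrow> ('a \<Rightarrow> real) \<Rightarrow> bool" where
  "test_function U \<phi> \<longleftrightarrow> (\<forall>n. cont_diff n \<phi>) \<and>
     compact (closure {x. \<phi> x \<noteq> 0}) \<and> closure {x. \<phi> x \<noteq> 0} \<subseteq> U"

definition locally_integrable :: "'a::euclidean_space set \<Rightarrow> ('a \<Rightarrow> biquat) \<Rightarrow> bool" where
  "locally_integrable U u \<longleftrightarrow> (\<forall>K. compact K \<and> K \<subseteq> U \<longrightarrow> set_integrable lebesgue K u)"

definition regular_distr :: "'a::euclidean_space set \<Rightarrow> ('a \<Rightarrow> biquat) \<Rightarrow> ('a \<Rightarrow> real) \<Rightarrow> biquat" where
  "regular_distr U u \<phi> = (LINT x:U|lebesgue. \<phi> x *\<^sub>R u x)"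

definition distr_deriv ::
  "'a::euclidean_space \<Rightarrow> (('a \<Rightarrow> real) \<Rightarrow> biquat) \<Rightarrow> ('a \<Rightarrow> real) \<Rightarrow> biquat" where
  "distr_deriv v S \<phi> = - S (\<lambda>x. frechet_derivative \<phi> (at x) v)"

definition dirac ::
  "(((real ^ 3) \<times> real \<Rightarrow> real) \<Rightarrow> biquat) \<Rightarrow> ((real ^ 3) \<times> real \<Rightarrow> real) \<Rightarrow> biquat" where
  "dirac S \<phi> = e1 \<odot> distr_deriv (axis 1 1, 0) S \<phi> + e2 \<odot> distr_deriv (axis 2 1, 0) S \<phi>
     + e3 \<odot> distr_deriv (axis 3 1, 0) S \<phi>"

definition parabolic_dirac ::
  "real \<Rightarrow> (((real ^ 3) \<times> real \<Rightarrow> real) \<Rightarrow> biquat) \<Rightarrow> ((real ^ 3) \<times> real \<Rightarrow> real) \<Rightarrow> biquat" where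
  "parabolic_dirac \<sigma> S \<phi> = dirac S \<phi> + (complex_of_real \<sigma> * \<i>) *s distr_deriv (0, 1) S \<phi>"

text \<open>The identity \<open>(D + \<sigma> i \<partial>\<^sub>t) u = f\<close> between distributions on \<open>U\<close>.\<close>

definition parabolic_dirac_eq ::
  "((real ^ 3) \<times> real) set \<Rightarrow> real \<Rightarrow> ((real ^ 3) \<times> real \<Rightarrow> biquat) \<Rightarrow> ((real ^ 3) \<times> real \<Rightarrow> biquat) \<Rightarrow> bool" where
  "parabolic_dirac_eq U \<sigma> u f \<longleftrightarrow> locally_integrable U u \<and> locally_integrable U f \<and>
     (\<forall>\<phi>. test_function U \<phi> \<longrightarrow> parabolic_dirac \<sigma> (regular_distr U u) \<phi> = regular_distr U f \<phi>)"

end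

theory Submission
  imports Defs "HOL-Probability.Characteristic_Functions"
begin

text \<open>
  Write \<open>f = - \<sigma> i w\<close>, extended by zero, and let \<open>f^(k, s)\<close> be its Fourier transform in
  space. On the Fourier side \<open>D\<close> is left multiplication by \<open>2 \<pi> i k\<close>, and
  \<open>v(k, t) = \<integral>\<^sub>0\<^sup>t exp (- 2 \<pi> \<sigma> k (t - s)) f^(k, s) ds\<close> is Duhamel's solution of
  \<open>\<partial>\<^sub>t v + 2 \<pi> \<sigma> k v = f^\<close>. Multiplying this equation by \<open>\<sigma> i\<close> and using \<open>\<sigma>\<^sup>2 = 1\<close> gives
  \<open>(2 \<pi> i k + \<sigma> i \<partial>\<^sub>t) v = \<sigma> i f^ = w^\<close>, which is the claim before the inverse transform.
  The quaternion \<open>exp (- 2 \<pi> \<sigma> k \<tau>)\<close> has norm one, so it acts isometrically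
  (\<open>norm_kexp_mult\<close>) and every estimate reduces to the \<open>L\<^sup>2\<close> norm of \<open>f\<close>.

  The transform on \<open>L\<^sup>2\<close> rests on one identity (\<open>fourier_L1_gauss_regularised\<close>): for
  integrable \<open>f\<close> and \<open>h\<close>, the integral of \<open>f^(k) h^(- k)\<close> against a wide Gaussian in \<open>k\<close> is the
  integral of \<open>f\<close> against the average of \<open>h\<close> over a narrow Gaussian. With \<open>h\<close> the conjugate of
  \<open>f\<close>, the inequality of the means and Fatou's lemma give \<open>\<parallel>f^\<parallel> \<le> \<parallel>f\<parallel>\<close>
  (\<open>plancherel_le\<close>), and this bound makes the extension to \<open>L\<^sup>2\<close> exist. With \<open>h\<close> continuous and
  bounded, the limit is Parseval's formula (\<open>parseval_L1\<close>), which brings a pairing on the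
  Fourier side back to physical space.

  The transform is unique only up to null sets, separately for each \<open>s\<close> and \<open>t\<close>, whereas the
  Teodorescu transform must be measurable in \<open>(x, t)\<close>. The representative \<open>fourier_L2\<close> is the
  limit of the transforms of truncations of the function, with truncation radii given by an explicit
  measurable rule; it is therefore measurable jointly in the frequency and in any parameter of
  the function (\<open>fourier_L2_measurable_param\<close>). The resulting function \<open>solution\<close> is Borel
  measurable and is a parabolic Teodorescu transform (\<open>is_teodorescu_solution\<close>). Any two such
  transforms agree almost everywhere (\<open>is_teodorescu_unique\<close>), so the distributional equation
  for the transform chosen by \<open>teodorescu\<close> follows from the one for \<open>solution\<close>.

  For the equation, pair \<open>solution\<close> with the derivatives of a test function \<open>\<phi>\<close> and move the
  Fourier transform onto \<open>\<phi>\<close>. After an exchange of integrals the innermost one runs over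
  \<open>t > s\<close>, and its integrand is the derivative in \<open>t\<close> of
  \<open>- \<sigma> i \<phi>^(k, t) exp (- 2 \<pi> \<sigma> k (t - s)) f^(k, s)\<close>. Only the value at \<open>t = s\<close> survives, namely
  \<open>\<sigma> i \<phi>^(k, s) f^(k, s)\<close> (\<open>dirac_integrand_time_integral\<close>), and Parseval's formula turns the
  integral of that over \<open>(k, s)\<close> into the integral of \<open>\<phi> w\<close>.
\<close>


section \<open>Plane waves and the transform of integrable functions\<close>

definition wave :: "real ^ 3 \<Rightarrow> real ^ 3 \<Rightarrow> complex" where
  "wave k x = cis (2 * pi * (k \<bullet> x))"

lemma norm_wave [simp]: "norm (wave k x) = 1"
  by (simp add: wave_def)

lemma wave_commute: "wave k x = wave x k"
  by (simp add: wave_def inner_commute)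

lemma wave_add: "wave k (x + y) = wave k x * wave k y"
  by (simp add: wave_def cis_mult inner_add_right algebra_simps)

lemma wave_minus: "wave (- k) x = cnj (wave k x)" "wave k (- x) = cnj (wave k x)"
  by (simp_all add: wave_def cis_cnj)

lemma wave_measurable [measurable (raw)]:
  assumes [measurable]: "f \<in> borel_measurable M" "g \<in> borel_measurable M"
  shows "(\<lambda>p. wave (f p) (g p)) \<in> borel_measurable M"
proof (rule borel_measurable_continuous_Pair[OF assms])
  show "continuous_on UNIV (\<lambda>p. wave (fst p) (snd p))"
    unfolding wave_def cis_conv_exp by (intro continuous_intros)
qed

lemma continuous_on_wave [continuous_intros]:
  assumes "continuous_on S f" "continuous_on S g"
  shows "continuous_on S (\<lambda>p. wave (f p) (g p))"
  unfolding wave_def cis_conv_exp using assms by (intro continuous_intros)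

lemma fourier_L1_eq:
  assumes [measurable]: "f \<in> borel_measurable borel"
  shows "fourier_L1 f k = (LINT x|lborel. wave (- k) x * f x)"
proof -
  have "fourier_L1 f k = (LINT x|lebesgue. wave (- k) x * f x)"
    unfolding fourier_L1_def by (simp add: wave_def cis_conv_exp mult_ac)
  also have "\<dots> = (LINT x|lborel. wave (- k) x * f x)"
    by (rule integral_completion) measurable
  finally show ?thesis .
qed

lemma fourier_L1_measurable [measurable]:
  assumes [measurable]: "f \<in> borel_measurable borel"
  shows "fourier_L1 f \<in> borel_measurable borel"
  unfolding fourier_L1_eq[OF assms, abs_def] by measurable

lemma norm_fourier_L1_le:
  assumes "f \<in> borel_measurable borel"
  shows "norm (fourier_L1 f k) \<le> (LINT x|lborel. norm (f x))"
  unfolding fourier_L1_eq[OF assms]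
  by (rule order_trans[OF integral_norm_bound]) (simp add: norm_mult)

lemma integrable_wave_mult:
  assumes "integrable lborel f"
  shows "integrable lborel (\<lambda>x. wave k x * f x)"
  by (rule Bochner_Integration.integrable_bound[OF assms]) (use assms in \<open>auto simp: norm_mult\<close>)

lemma lborel_integral_affine:
  fixes f :: "'a::euclidean_space \<Rightarrow> 'b::{banach, second_countable_topology}"
  assumes [measurable]: "f \<in> borel_measurable borel" and c: "c \<noteq> 0"
  shows "(LINT x|lborel. f x) = \<bar>c\<bar> ^ DIM('a) *\<^sub>R (LINT x|lborel. f (t + c *\<^sub>R x))"
  by (subst lborel_affine[OF c, of t])
     (simp add: integral_density integral_distr)

lemma nn_integral_lborel_affine:
  fixes f :: "'a::euclidean_space \<Rightarrow> ennreal"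
  assumes [measurable]: "f \<in> borel_measurable borel" and c: "c \<noteq> 0"
  shows "(\<integral>\<^sup>+x. f x \<partial>lborel) = ennreal (\<bar>c\<bar> ^ DIM('a)) * (\<integral>\<^sup>+x. f (t + c *\<^sub>R x) \<partial>lborel)"
  by (subst lborel_affine[OF c, of t])
     (simp add: nn_integral_density nn_integral_distr nn_integral_cmult ennreal_power)

lemma integrable_lborel_affine:
  fixes f :: "'a::euclidean_space \<Rightarrow> 'b::{banach, second_countable_topology}"
  assumes f: "integrable lborel f" and c: "c \<noteq> 0"
  shows "integrable lborel (\<lambda>x. f (t + c *\<^sub>R x))"
proof -
  have [measurable]: "f \<in> borel_measurable borel" using f by auto
  have "ennreal (\<bar>c\<bar> ^ DIM('a)) * (\<integral>\<^sup>+x. norm (f (t + c *\<^sub>R x)) \<partial>lborel) < \<infinity>"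
    using f nn_integral_lborel_affine[of "\<lambda>x. ennreal (norm (f x))" c t] c
    unfolding integrable_iff_bounded by simp
  then have "(\<integral>\<^sup>+x. norm (f (t + c *\<^sub>R x)) \<partial>lborel) < \<infinity>"
    using c by (auto simp: ennreal_mult_less_top)
  then show ?thesis unfolding integrable_iff_bounded by simp
qed


section \<open>Gaussians\<close>

definition gauss :: "real ^ 3 \<Rightarrow> real" where
  "gauss x = exp (- pi * (norm x)\<^sup>2)"

lemma gauss_measurable [measurable]: "gauss \<in> borel_measurable borel"
  unfolding gauss_def by measurable

lemma gauss_pos: "gauss x > 0"
  by (simp add: gauss_def)

text \<open>
  The characteristic function of the standard normal distribution after the substitution
  \<open>x \<rightarrow> sqrt (2 \<pi>) x\<close>, which is the scaling that makes the Gaussian its own transform.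
\<close>

lemma gauss_1d:
  fixes t :: real
  shows "integrable lborel (\<lambda>x::real. cis (2 * pi * (t * x)) * of_real (exp (- pi * x\<^sup>2)))"
    and "(LINT x|lborel. cis (2 * pi * (t * x)) * of_real (exp (- pi * x\<^sup>2))) = of_real (exp (- pi * t\<^sup>2))"
proof -
  define c where "c = sqrt (2 * pi)"
  have c: "c > 0" "c\<^sup>2 = 2 * pi" by (auto simp: c_def)
  define F where "F = (\<lambda>x::real. iexp (c * t * x) * complex_of_real (std_normal_density x))"
  have F_eq: "F (0 + c * x) = (cis (2 * pi * (t * x)) * of_real (exp (- pi * x\<^sup>2))) * of_real (1 / c)" for x
  proof -
    have "c * t * (c * x) = 2 * pi * (t * x)"
      using c(2) by (simp add: power2_eq_square algebra_simps)
    moreover have "(c * x)\<^sup>2 / 2 = pi * x\<^sup>2"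
      using c(2) by (simp add: power_mult_distrib)
    ultimately show ?thesis
      unfolding F_def std_normal_density_def c_def[symmetric] cis_conv_exp
      by (simp only: add_0 minus_divide_left mult_minus_left of_real_mult) (simp add: mult_ac)
  qed
  have "integrable lborel (\<lambda>x. std_normal_density x)"
    by (simp add: integrable_normal_density)
  then have "integrable lborel F"
    unfolding F_def
    by (rule Bochner_Integration.integrable_bound) (auto simp: norm_mult)
  from lborel_integrable_real_affine[OF this, of c 0]
  have 1: "integrable lborel (\<lambda>x. F (0 + c * x))" using c by simp
  then show "integrable lborel (\<lambda>x::real. cis (2 * pi * (t * x)) * of_real (exp (- pi * x\<^sup>2)))"
    using integrable_mult_left[OF 1[unfolded F_eq], of "of_real c"] c by simp
  have "complex_of_real (exp (- ((c * t)\<^sup>2) / 2)) = char std_normal_distribution (c * t)"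
    by (simp add: char_std_normal_distribution)
  also have "\<dots> = (LINT x|lborel. F x)"
    unfolding char_def F_def
    by (subst integral_density) (auto simp: normal_density_nonneg scaleR_conv_of_real mult_ac)
  also have "\<dots> = c *\<^sub>R (LINT x|lborel. F (0 + c * x))"
    using lborel_integral_real_affine[of c F 0] c by simp
  also have "\<dots> = (LINT x|lborel. cis (2 * pi * (t * x)) * of_real (exp (- pi * x\<^sup>2)))"
    unfolding F_eq using c by (simp add: scaleR_conv_of_real)
  finally show "(LINT x|lborel. cis (2 * pi * (t * x)) * of_real (exp (- pi * x\<^sup>2))) = of_real (exp (- pi * t\<^sup>2))"
    using c by (simp add: power_mult_distrib)
qed

lemma lborel_integral_prod_Basis:
  fixes F :: "'a::euclidean_space \<Rightarrow> real \<Rightarrow> complex"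
  assumes F: "\<And>b. b \<in> Basis \<Longrightarrow> integrable lborel (F b)"
  shows "integrable lborel (\<lambda>x::'a. \<Prod>b\<in>Basis. F b (x \<bullet> b))" (is ?A)
    and "(LINT x|lborel. (\<Prod>b\<in>Basis. F b (x \<bullet> b))) = (\<Prod>b\<in>Basis. LINT x|lborel. F b x)" (is ?B)
proof -
  interpret product_sigma_finite "\<lambda>_::'a. lborel :: real measure"
    by standard
  have [measurable]: "F b \<in> borel_measurable borel" if "b \<in> Basis" for b
    using F[OF that] by auto
  have eq: "(\<Prod>b\<in>Basis. F b ((\<Sum>b\<in>Basis. f b *\<^sub>R b) \<bullet> b)) = (\<Prod>b\<in>Basis. F b (f b))" for f :: "'a \<Rightarrow> real"
    by (intro prod.cong refl) (simp add: inner_sum_left_Basis)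
  show ?A
    by (subst lborel_eq, subst integrable_distr_eq) (auto simp: eq intro!: product_integrable_prod F)
  show ?B
    by (subst lborel_eq, subst integral_distr) (auto simp: eq intro!: product_integral_prod F)
qed

lemma gauss_self_dual:
  shows "integrable lborel (\<lambda>x. wave k x * of_real (gauss x))"
    and "(LINT x|lborel. wave k x * of_real (gauss x)) = of_real (gauss k)"
proof -
  have norm2: "(norm x)\<^sup>2 = (\<Sum>b\<in>Basis. (x \<bullet> b)\<^sup>2)" for x :: "real^3"
    unfolding power2_norm_eq_inner by (subst euclidean_inner) (simp add: power2_eq_square)
  have inner: "k \<bullet> x = (\<Sum>b\<in>Basis. (k \<bullet> b) * (x \<bullet> b))" for x
    by (rule euclidean_inner)
  have cis_sum: "cis (sum f A) = (\<Prod>a\<in>A. cis (f a))" if "finite A" for f :: "(real^3) \<Rightarrow> real" and A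
    using that by induction (simp_all flip: cis_mult)
  have gauss_prod: "gauss x = (\<Prod>b\<in>Basis. exp (- pi * (x \<bullet> b)\<^sup>2))" for x
    by (simp add: gauss_def norm2 exp_sum[symmetric] sum_distrib_left)
  have eq: "wave k x * of_real (gauss x) = (\<Prod>b\<in>Basis. cis (2 * pi * ((k \<bullet> b) * (x \<bullet> b))) * of_real (exp (- pi * (x \<bullet> b)\<^sup>2)))" for x
  proof -
    have "2 * pi * (k \<bullet> x) = (\<Sum>b\<in>Basis. 2 * pi * ((k \<bullet> b) * (x \<bullet> b)))"
      by (rule trans[OF arg_cong[OF inner, of "(*) (2 * pi)"] sum_distrib_left])
    then show ?thesis
      unfolding wave_def gauss_prod of_real_prod prod.distrib by (simp only: cis_sum[OF finite_Basis])
  qed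
  show "integrable lborel (\<lambda>x. wave k x * of_real (gauss x))"
    unfolding eq by (intro lborel_integral_prod_Basis(1) gauss_1d)
  show "(LINT x|lborel. wave k x * of_real (gauss x)) = of_real (gauss k)"
    unfolding eq
    by (subst lborel_integral_prod_Basis(2), intro gauss_1d) (simp only: gauss_1d gauss_prod of_real_prod)
qed

lemma gauss_integral:
  shows "integrable lborel gauss" "(LINT x|lborel. gauss x) = 1" "(\<integral>\<^sup>+x. ennreal (gauss x) \<partial>lborel) = 1"
proof -
  have w: "wave 0 x = 1" for x by (simp add: wave_def)
  have g0: "gauss 0 = 1" by (simp add: gauss_def)
  show 1: "integrable lborel gauss"
    using gauss_self_dual(1)[of 0] by (simp add: w complex_of_real_integrable_eq)
  have "complex_of_real (LINT x|lborel. gauss x) = 1"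
    using gauss_self_dual(2)[of 0] by (simp add: w g0)
  then show 2: "(LINT x|lborel. gauss x) = 1" by (simp only: of_real_eq_1_iff)
  show "(\<integral>\<^sup>+x. ennreal (gauss x) \<partial>lborel) = 1"
    using nn_integral_eq_integral[OF 1] 2 gauss_pos by (simp add: less_imp_le)
qed

text \<open>
  The left-hand side is the transform of a wide Gaussian, the right-hand side a narrow one of
  total mass one: this is the approximate identity behind the regularisation below.
\<close>

lemma gauss_scaled:
  assumes e: "e > 0"
  shows "integrable lborel (\<lambda>k. gauss (e *\<^sub>R k))"
    and "(LINT k|lborel. wave z k * of_real (gauss (e *\<^sub>R k))) = of_real (gauss (z /\<^sub>R e) / e ^ 3)"
proof -
  show "integrable lborel (\<lambda>k. gauss (e *\<^sub>R k))"
    using integrable_lborel_affine[OF gauss_integral(1), of e 0] e by simp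
  have "of_real (gauss (z /\<^sub>R e)) = (LINT k|lborel. wave (z /\<^sub>R e) k * of_real (gauss k))"
    by (simp add: gauss_self_dual)
  also have "\<dots> = e ^ 3 *\<^sub>R (LINT k|lborel. wave (z /\<^sub>R e) (0 + e *\<^sub>R k) * of_real (gauss (0 + e *\<^sub>R k)))"
    using lborel_integral_affine[of "\<lambda>k. wave (z /\<^sub>R e) k * of_real (gauss k)" e 0] e by simp
  also have "(\<lambda>k. wave (z /\<^sub>R e) (0 + e *\<^sub>R k)) = wave z"
    using e by (simp add: wave_def fun_eq_iff mult.assoc[symmetric])
  finally show "(LINT k|lborel. wave z k * of_real (gauss (e *\<^sub>R k))) = of_real (gauss (z /\<^sub>R e) / e ^ 3)"
    using e by (simp add: field_simps scaleR_conv_of_real)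
qed


section \<open>The Plancherel bound and the Parseval formula\<close>

lemma fourier_L1_integral_mult:
  assumes f: "integrable lborel f" and g: "integrable lborel g"
  shows "(LINT k|lborel. fourier_L1 f k * g k) = (LINT x|lborel. f x * fourier_L1 g x)"
proof -
  have [measurable]: "f \<in> borel_measurable borel" "g \<in> borel_measurable borel"
    using f g by auto
  have int: "integrable (lborel \<Otimes>\<^sub>M lborel) (\<lambda>(k, x). g k * (wave (- k) x * f x))"
  proof (rule lborel_pair.Fubini_integrable)
    show "integrable lborel (\<lambda>k. LINT x|lborel. norm (case (k, x) of (k, x) \<Rightarrow> g k * (wave (- k) x * f x)))"
      using integrable_mult_left[OF integrable_norm[OF g], of "LINT x|lborel. norm (f x)"]
      by (simp add: norm_mult)
  qed (auto intro!: integrable_mult_right integrable_wave_mult f)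
  have "(LINT k|lborel. fourier_L1 f k * g k) = (LINT k|lborel. LINT x|lborel. g k * (wave (- k) x * f x))"
    by (simp add: fourier_L1_eq mult.commute)
  also have "\<dots> = (LINT x|lborel. LINT k|lborel. g k * (wave (- k) x * f x))"
    by (rule lborel_pair.Fubini_integral[OF int, symmetric])
  also have "\<dots> = (LINT x|lborel. LINT k|lborel. f x * (wave (- x) k * g k))"
    by (simp add: wave_minus wave_commute mult_ac)
  also have "\<dots> = (LINT x|lborel. f x * fourier_L1 g x)"
    by (simp add: fourier_L1_eq)
  finally show ?thesis .
qed

lemma lborel_integral_uminus:
  fixes f :: "'a::euclidean_space \<Rightarrow> 'b::{banach, second_countable_topology}"
  assumes "f \<in> borel_measurable borel"
  shows "(LINT x|lborel. f (- x)) = (LINT x|lborel. f x)"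
  using lborel_integral_affine[OF assms, of "-1" 0] by simp

lemma integrable_lborel_uminus:
  fixes f :: "'a::euclidean_space \<Rightarrow> 'b::{banach, second_countable_topology}"
  assumes "integrable lborel f"
  shows "integrable lborel (\<lambda>x. f (- x))"
  using integrable_lborel_affine[OF assms, of "-1" 0] by simp

lemma nn_integral_lborel_uminus:
  fixes f :: "'a::euclidean_space \<Rightarrow> ennreal"
  assumes "f \<in> borel_measurable borel"
  shows "(\<integral>\<^sup>+x. f (- x) \<partial>lborel) = (\<integral>\<^sup>+x. f x \<partial>lborel)"
  using nn_integral_lborel_affine[OF assms, of "-1" 0] by simp

lemma integrable_bounded_mult:
  fixes f g :: "'a \<Rightarrow> 'b::{real_normed_field, banach, second_countable_topology}"
  assumes "integrable M g" "f \<in> borel_measurable M" "\<And>x. norm (f x) \<le> B"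
  shows "integrable M (\<lambda>x. f x * g x)"
proof (rule Bochner_Integration.integrable_bound)
  show "integrable M (\<lambda>x. B *\<^sub>R g x)" using assms(1) by simp
  have "0 \<le> B" using assms(3) norm_ge_zero order_trans by blast
  then show "AE x in M. norm (f x * g x) \<le> norm (B *\<^sub>R g x)"
    using assms(3) by (auto simp: norm_mult intro!: mult_right_mono)
qed (use assms in auto)

text \<open>
  The Gaussian factor makes the integral over \<open>k\<close> absolutely convergent, so that the
  multiplication formula applies twice: first to \<open>f\<close> and the damped transform of \<open>h\<close>, then to
  \<open>h\<close> and the Gaussian itself, whose transform is known.
\<close>

lemma fourier_L1_gauss_regularised:
  assumes f: "integrable lborel f" and h: "integrable lborel h" and e: "e > 0"
  shows "(LINT k|lborel. fourier_L1 f k * (fourier_L1 h (- k) * of_real (gauss (e *\<^sub>R k))))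
    = (LINT x|lborel. f x * (LINT z|lborel. h (x + e *\<^sub>R z) * of_real (gauss z)))"
proof -
  have [measurable]: "f \<in> borel_measurable borel" "h \<in> borel_measurable borel"
    using f h by auto
  have gi: "integrable lborel (\<lambda>k. complex_of_real (gauss (e *\<^sub>R k)))"
    using gauss_scaled(1)[OF e] by simp
  have g_even: "gauss (- x) = gauss x" for x by (simp add: gauss_def)
  let ?G = "\<lambda>k. fourier_L1 h (- k) * of_real (gauss (e *\<^sub>R k))"
  have G: "integrable lborel ?G"
    by (rule integrable_bounded_mult[OF gi]) (auto intro: norm_fourier_L1_le)
  have "fourier_L1 ?G x = (LINT z|lborel. h (x + e *\<^sub>R z) * of_real (gauss z))" for x
  proof -
    let ?W = "\<lambda>k. wave x k * complex_of_real (gauss (e *\<^sub>R k))"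
    have W: "integrable lborel ?W" by (rule integrable_wave_mult[OF gi])
    have "fourier_L1 ?G x = (LINT k|lborel. wave (- x) k * ?G k)"
      by (simp add: fourier_L1_eq)
    also have "\<dots> = (LINT k|lborel. wave (- x) (- k) * ?G (- k))"
      by (rule lborel_integral_uminus[symmetric]) measurable
    also have "\<dots> = (LINT k|lborel. fourier_L1 h k * ?W k)"
      by (simp add: wave_minus g_even mult_ac)
    also have "\<dots> = (LINT y|lborel. h y * fourier_L1 ?W y)"
      by (rule fourier_L1_integral_mult[OF h W])
    also have "\<dots> = (LINT y|lborel. h y * of_real (gauss ((x - y) /\<^sub>R e) / e ^ 3))"
    proof (rule Bochner_Integration.integral_cong[OF refl])
      fix y
      have "fourier_L1 ?W y = (LINT k|lborel. wave (x - y) k * of_real (gauss (e *\<^sub>R k)))"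
        by (simp add: fourier_L1_eq wave_commute[of _ k for k] wave_add[of _ x "- y", simplified] mult_ac)
      then show "h y * fourier_L1 ?W y = h y * of_real (gauss ((x - y) /\<^sub>R e) / e ^ 3)"
        by (simp only: gauss_scaled(2)[OF e])
    qed
    also have "\<dots> = e ^ 3 *\<^sub>R (LINT z|lborel. h (x + e *\<^sub>R z) * of_real (gauss ((x - (x + e *\<^sub>R z)) /\<^sub>R e) / e ^ 3))"
      using lborel_integral_affine[of "\<lambda>y. h y * of_real (gauss ((x - y) /\<^sub>R e) / e ^ 3)" e x] e by simp
    also have "\<dots> = (LINT z|lborel. h (x + e *\<^sub>R z) * of_real (gauss z))"
      using e by (simp add: g_even scaleR_conv_of_real[where 'a = complex])
    finally show ?thesis .
  qed
  then show ?thesis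
    using fourier_L1_integral_mult[OF f G] by simp
qed

lemma ennreal_norm_integral_le:
  fixes f :: "'a \<Rightarrow> 'b::{banach, second_countable_topology}"
  shows "ennreal (norm (integral\<^sup>L M f)) \<le> (\<integral>\<^sup>+x. norm (f x) \<partial>M)"
proof (cases "integrable M f")
  case True
  then show ?thesis by (rule integral_norm_bound_ennreal)
qed (simp add: not_integrable_integral_eq)

lemma fourier_L1_cnj:
  assumes [measurable]: "f \<in> borel_measurable borel"
  shows "fourier_L1 (\<lambda>x. cnj (f x)) k = cnj (fourier_L1 f (- k))"
proof -
  have [measurable]: "cnj \<in> borel_measurable borel"
    by (intro borel_measurable_continuous_onI continuous_intros)
  have "fourier_L1 (\<lambda>x. cnj (f x)) k = (LINT x|lborel. cnj (wave (- (- k)) x * f x))"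
    by (simp add: fourier_L1_eq wave_minus del: Bochner_Integration.integral_cnj)
  also have "\<dots> = cnj (fourier_L1 f (- k))"
    unfolding fourier_L1_eq[OF assms] by (rule Bochner_Integration.integral_cnj)
  finally show ?thesis .
qed

abbreviation L2_mass :: "'a measure \<Rightarrow> ('a \<Rightarrow> 'b::real_normed_vector) \<Rightarrow> ennreal" where
  "L2_mass M f \<equiv> \<integral>\<^sup>+x. ennreal ((norm (f x))\<^sup>2) \<partial>M"

text \<open>
  Apply the regularised identity with \<open>h = cnj f\<close>. As the Gaussian is positive with mass one,
  the bound \<open>2 a b \<le> a\<^sup>2 + b\<^sup>2\<close> and translation invariance estimate the right-hand side by
  \<open>\<parallel>f\<parallel>\<^sup>2\<close>, for every width; Fatou's lemma removes the Gaussian on the left.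
\<close>

lemma plancherel_le:
  assumes f: "integrable lborel f"
  shows "L2_mass lborel (fourier_L1 f) \<le> L2_mass lborel f"
proof -
  have [measurable]: "f \<in> borel_measurable borel" using f by auto
  define N where "N = L2_mass lborel f"
  let ?Q = "\<lambda>e k. (norm (fourier_L1 f k))\<^sup>2 * gauss (e *\<^sub>R k)"
  have reg: "(\<integral>\<^sup>+k. ennreal (?Q e k) \<partial>lborel) \<le> N" if e: "e > 0" for e
  proof -
    let ?h = "\<lambda>x. cnj (f x)" and ?A = "\<lambda>x. ennreal ((norm (f x))\<^sup>2 / 2)"
    let ?I = "\<lambda>x. LINT z|lborel. ?h (x + e *\<^sub>R z) * of_real (gauss z)"
    have h: "integrable lborel ?h" using f by simp
    have sq: "fourier_L1 f k * (fourier_L1 ?h (- k) * of_real (gauss (e *\<^sub>R k))) = of_real (?Q e k)" for k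
      by (simp add: fourier_L1_cnj complex_norm_square[symmetric] mult.assoc[symmetric])
    have int: "integrable lborel (\<lambda>k. ?Q e k)"
      by (rule integrable_bounded_mult[OF gauss_scaled(1)[OF e], where B = "(LINT x|lborel. norm (f x))\<^sup>2"])
         (auto intro!: power_mono norm_fourier_L1_le)
    have nn: "0 \<le> ?Q e k" for k
      using gauss_pos by (simp add: less_imp_le)
    have "(\<integral>\<^sup>+k. ennreal (?Q e k) \<partial>lborel) = ennreal (LINT k|lborel. ?Q e k)"
      by (rule nn_integral_eq_integral[OF int]) (simp add: nn)
    also have "\<dots> = ennreal (norm (complex_of_real (LINT k|lborel. ?Q e k)))"
      by (simp add: nn)
    also have "\<dots> = ennreal (norm (LINT x|lborel. f x * ?I x))"
      using fourier_L1_gauss_regularised[OF f h e] unfolding sq by (simp only: integral_complex_of_real)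
    also have "\<dots> \<le> (\<integral>\<^sup>+x. norm (f x * ?I x) \<partial>lborel)"
      by (rule ennreal_norm_integral_le)
    also have "\<dots> \<le> (\<integral>\<^sup>+x. \<integral>\<^sup>+z. (?A x + ?A (x + e *\<^sub>R z)) * ennreal (gauss z) \<partial>lborel \<partial>lborel)"
    proof (rule nn_integral_mono)
      fix x
      have "ennreal (norm (f x * ?I x))
          = ennreal (norm (LINT z|lborel. f x * (?h (x + e *\<^sub>R z) * of_real (gauss z))))" by simp
      also have "\<dots> \<le> (\<integral>\<^sup>+z. norm (f x * (?h (x + e *\<^sub>R z) * of_real (gauss z))) \<partial>lborel)"
        by (rule ennreal_norm_integral_le)
      also have "\<dots> \<le> (\<integral>\<^sup>+z. (?A x + ?A (x + e *\<^sub>R z)) * ennreal (gauss z) \<partial>lborel)"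
      proof (rule nn_integral_mono)
        fix z
        have am: "a * b \<le> a\<^sup>2 / 2 + b\<^sup>2 / 2" for a b :: real
          using sum_squares_bound[of a b] by simp
        have "ennreal (norm (f x) * norm (f (x + e *\<^sub>R z)) * gauss z) \<le> ennreal (((norm (f x))\<^sup>2 / 2 + (norm (f (x + e *\<^sub>R z)))\<^sup>2 / 2) * gauss z)"
          by (intro ennreal_leI mult_right_mono am less_imp_le gauss_pos)
        also have "\<dots> = (?A x + ?A (x + e *\<^sub>R z)) * ennreal (gauss z)"
          by (simp add: ennreal_mult gauss_pos less_imp_le)
        finally show "ennreal (norm (f x * (?h (x + e *\<^sub>R z) * of_real (gauss z)))) \<le> \<dots>"
          by (simp add: norm_mult gauss_pos less_imp_le mult.assoc)
      qed
      finally show "ennreal (norm (f x * ?I x)) \<le> \<dots>" .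
    qed
    also have "\<dots> = (\<integral>\<^sup>+x. \<integral>\<^sup>+z. ?A x * ennreal (gauss z) \<partial>lborel \<partial>lborel)
        + (\<integral>\<^sup>+x. \<integral>\<^sup>+z. ?A (x + e *\<^sub>R z) * ennreal (gauss z) \<partial>lborel \<partial>lborel)"
      by (simp add: distrib_right nn_integral_add)
    also have "(\<integral>\<^sup>+x. \<integral>\<^sup>+z. ?A x * ennreal (gauss z) \<partial>lborel \<partial>lborel) = N / 2"
      unfolding N_def
      by (simp add: nn_integral_cmult gauss_integral divide_ennreal[symmetric] nn_integral_divide)
    also have "(\<integral>\<^sup>+x. \<integral>\<^sup>+z. ?A (x + e *\<^sub>R z) * ennreal (gauss z) \<partial>lborel \<partial>lborel)
        = (\<integral>\<^sup>+z. \<integral>\<^sup>+x. ?A (x + e *\<^sub>R z) * ennreal (gauss z) \<partial>lborel \<partial>lborel)"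
      by (rule lborel_pair.Fubini'[symmetric]) measurable
    also have "\<dots> = (\<integral>\<^sup>+z. N / 2 * ennreal (gauss z) \<partial>lborel)"
    proof (rule nn_integral_cong)
      fix z
      have "L2_mass lborel (\<lambda>x. f (x + e *\<^sub>R z)) = N"
        unfolding N_def
        by (subst (2) nn_integral_lborel_affine[where c = 1 and t = "e *\<^sub>R z"]) (auto simp: add.commute)
      then show "(\<integral>\<^sup>+x. ?A (x + e *\<^sub>R z) * ennreal (gauss z) \<partial>lborel) = N / 2 * ennreal (gauss z)"
        by (simp add: nn_integral_multc divide_ennreal[symmetric] nn_integral_divide)
    qed
    also have "\<dots> = N / 2"
      by (simp add: nn_integral_cmult gauss_integral)
    also have "N / 2 + N / 2 = N"
    proof (cases N)
      case (real r)
      then have "N / 2 = ennreal (r / 2)" using divide_ennreal[of r 2] by simp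
      then show ?thesis using real by (simp flip: ennreal_plus)
    qed (simp add: ennreal_top_divide)
    finally show ?thesis .
  qed
  have lim: "(\<lambda>n. ennreal (?Q (1 / Suc n) k)) \<longlonglongrightarrow> ennreal ((norm (fourier_L1 f k))\<^sup>2)" for k
  proof -
    have "(\<lambda>n. gauss ((1 / real (Suc n)) *\<^sub>R k)) \<longlonglongrightarrow> exp (- pi * (norm (0 *\<^sub>R k))\<^sup>2)"
      unfolding gauss_def by (intro tendsto_intros LIMSEQ_Suc[OF lim_1_over_n])
    then have "(\<lambda>n. ?Q (1 / real (Suc n)) k) \<longlonglongrightarrow> (norm (fourier_L1 f k))\<^sup>2 * 1"
      by (intro tendsto_mult tendsto_const) simp
    then show ?thesis by (intro tendsto_ennrealI) simp
  qed
  have "L2_mass lborel (fourier_L1 f)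
      = (\<integral>\<^sup>+k. liminf (\<lambda>n. ennreal (?Q (1 / Suc n) k)) \<partial>lborel)"
    by (intro nn_integral_cong) (use lim_imp_Liminf[OF _ lim] in simp)
  also have "\<dots> \<le> liminf (\<lambda>n. \<integral>\<^sup>+k. ennreal (?Q (1 / Suc n) k) \<partial>lborel)"
    by (rule nn_integral_liminf) measurable
  also have "\<dots> \<le> liminf (\<lambda>n::nat. N)"
    by (intro Liminf_mono always_eventually allI reg) simp
  also have "\<dots> = N" by (simp add: Liminf_const)
  finally show ?thesis unfolding N_def .
qed

lemma square_integrable_nn:
  "square_integrable M f \<longleftrightarrow> f \<in> borel_measurable M \<and> L2_mass M f < \<infinity>"
  unfolding square_integrable_def integrable_iff_bounded by (auto cong: conj_cong)

lemma square_integrable_completion: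
  assumes "f \<in> borel_measurable M"
  shows "square_integrable (completion M) f \<longleftrightarrow> square_integrable M f"
  unfolding square_integrable_nn using assms by (simp add: nn_integral_completion measurable_completion)

lemma norm_diff_power2_le:
  fixes a b :: "'a::real_normed_vector"
  shows "(norm (a - b))\<^sup>2 \<le> 2 * (norm a)\<^sup>2 + 2 * (norm b)\<^sup>2"
proof -
  have "(norm (a - b))\<^sup>2 \<le> (norm a + norm b)\<^sup>2"
    by (intro power_mono norm_triangle_ineq4) simp
  also have "\<dots> \<le> 2 * (norm a)\<^sup>2 + 2 * (norm b)\<^sup>2"
    using sum_squares_bound[of "norm a" "norm b"] by (simp add: power2_sum)
  finally show ?thesis .
qed

lemma mult_le_sum_squares:
  fixes a b :: real
  assumes "0 \<le> a" "0 \<le> b"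
  shows "a * b \<le> a\<^sup>2 + b\<^sup>2"
  using sum_squares_bound[of a b] mult_nonneg_nonneg[OF assms] by linarith

lemma square_integrable_mult:
  assumes f: "square_integrable M f" and g: "square_integrable M g"
  shows "integrable M (\<lambda>x. f x * g x)"
proof (rule Bochner_Integration.integrable_bound)
  show "integrable M (\<lambda>x. (cmod (f x))\<^sup>2 + (cmod (g x))\<^sup>2)"
    using f g by (auto simp: square_integrable_def)
  show "AE x in M. norm (f x * g x) \<le> norm ((cmod (f x))\<^sup>2 + (cmod (g x))\<^sup>2)"
    by (auto simp: norm_mult intro!: mult_le_sum_squares)
  show "(\<lambda>x. f x * g x) \<in> borel_measurable M"
    using f g by (auto simp: square_integrable_def)
qed

lemma square_integrable_fourier_L1:
  assumes f: "integrable lborel f" and sq: "square_integrable lborel f"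
  shows "square_integrable lborel (fourier_L1 f)"
  using plancherel_le[OF f] f sq unfolding square_integrable_nn by auto

lemma Lim_null_comparison_ennreal:
  fixes f g :: "nat \<Rightarrow> ennreal"
  assumes "g \<longlonglongrightarrow> 0" "\<And>n. f n \<le> g n"
  shows "f \<longlonglongrightarrow> 0"
  by (rule tendsto_sandwich[OF _ _ tendsto_const assms(1)]) (simp_all add: assms(2))

lemma square_integrable_reflected_fourier_L1:
  assumes h: "integrable lborel h" "square_integrable lborel h"
  shows "square_integrable lborel (\<lambda>k. fourier_L1 h (- k))"
  using square_integrable_fourier_L1[OF h] integrable_lborel_uminus[of "\<lambda>k. (cmod (fourier_L1 h k))\<^sup>2"]
  unfolding square_integrable_def by auto

text \<open>
  The Cauchy-Schwarz inequality for \<open>\<phi> n - f\<close> and \<open>\<psi>\<close>.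
\<close>

lemma L2_pairing_tendsto:
  assumes lim: "(\<lambda>n. \<integral>\<^sup>+x. ennreal ((cmod (\<phi> n x - f x))\<^sup>2) \<partial>M) \<longlonglongrightarrow> 0"
    and \<phi>: "\<And>n. square_integrable M (\<phi> n)" and f: "square_integrable M f" and \<psi>: "square_integrable M \<psi>"
  shows "(\<lambda>n. LINT x|M. \<phi> n x * \<psi> x) \<longlonglongrightarrow> (LINT x|M. f x * \<psi> x)"
proof -
  have [measurable]: "\<And>n. \<phi> n \<in> borel_measurable M" "f \<in> borel_measurable M" "\<psi> \<in> borel_measurable M"
    using \<phi> f \<psi> by (auto simp: square_integrable_def)
  define C where "C = L2_mass M \<psi>"
  have C: "C < \<infinity>" using \<psi> unfolding C_def square_integrable_nn by simp
  define I where "I n = (LINT x|M. \<phi> n x * \<psi> x) - (LINT x|M. f x * \<psi> x)" for n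
  have bound: "ennreal ((cmod (I n))\<^sup>2) \<le> L2_mass M (\<lambda>x. \<phi> n x - f x) * C" for n
  proof -
    have "I n = (LINT x|M. \<phi> n x * \<psi> x - f x * \<psi> x)"
      unfolding I_def by (rule Bochner_Integration.integral_diff[symmetric]) (intro square_integrable_mult \<phi> f \<psi>)+
    then have "ennreal (cmod (I n)) \<le> (\<integral>\<^sup>+x. ennreal (cmod (\<phi> n x * \<psi> x - f x * \<psi> x)) \<partial>M)"
      by (simp only: ennreal_norm_integral_le)
    also have "\<dots> = (\<integral>\<^sup>+x. ennreal (cmod (\<phi> n x - f x)) * ennreal (cmod (\<psi> x)) \<partial>M)"
      by (simp add: left_diff_distrib[symmetric] norm_mult ennreal_mult)
    finally have "(ennreal (cmod (I n)))\<^sup>2 \<le> (\<integral>\<^sup>+x. ennreal (cmod (\<phi> n x - f x)) * ennreal (cmod (\<psi> x)) \<partial>M)\<^sup>2"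
      by (rule power_mono) simp
    also have "\<dots> \<le> (\<integral>\<^sup>+x. (ennreal (cmod (\<phi> n x - f x)))\<^sup>2 \<partial>M) * (\<integral>\<^sup>+x. (ennreal (cmod (\<psi> x)))\<^sup>2 \<partial>M)"
      by (rule Cauchy_Schwarz_nn_integral) measurable
    finally show ?thesis unfolding C_def by (simp add: ennreal_power)
  qed
  have "(\<lambda>n. L2_mass M (\<lambda>x. \<phi> n x - f x) * C) \<longlonglongrightarrow> 0"
    using ennreal_tendsto_cmult[OF _ lim, of C] C by (simp add: mult.commute)
  then have "(\<lambda>n. ennreal ((cmod (I n))\<^sup>2)) \<longlonglongrightarrow> 0"
    by (rule Lim_null_comparison_ennreal) (rule bound)
  then have "(\<lambda>n. (cmod (I n))\<^sup>2) \<longlonglongrightarrow> 0"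
    by (intro tendsto_ennrealD[where x = 0]) simp_all
  then have "(\<lambda>n. sqrt ((cmod (I n))\<^sup>2)) \<longlonglongrightarrow> sqrt 0"
    by (rule tendsto_real_sqrt)
  then have "I \<longlonglongrightarrow> 0"
    by (simp add: tendsto_norm_zero_iff)
  then show ?thesis unfolding I_def by (simp add: LIM_zero_iff)
qed

text \<open>
  The limit of the regularised identity. On the left the product of the transforms is integrable,
  as both are square-integrable, and dominates; on the right the averages of \<open>h\<close> converge to
  \<open>h\<close> by continuity and are bounded by \<open>B\<close>.
\<close>

lemma parseval_L1:
  assumes f: "integrable lborel f" "square_integrable lborel f"
    and h: "integrable lborel h" "square_integrable lborel h"
    and cont: "continuous_on UNIV h" and B: "\<And>x. norm (h x) \<le> B"
  shows "(LINT k|lborel. fourier_L1 f k * fourier_L1 h (- k)) = (LINT x|lborel. f x * h x)"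
proof (rule LIMSEQ_unique)
  define e where "e n = 1 / real (Suc n)" for n
  have e: "e n > 0" for n by (simp add: e_def)
  have elim: "e \<longlonglongrightarrow> 0" unfolding e_def by (rule LIMSEQ_Suc[OF lim_1_over_n])
  have [measurable]: "f \<in> borel_measurable borel" "h \<in> borel_measurable borel"
    using f h by auto
  have g1: "gauss x \<le> 1" for x by (simp add: gauss_def)
  have g0: "0 \<le> gauss x" for x by (simp add: gauss_def)
  let ?P = "\<lambda>k. fourier_L1 f k * fourier_L1 h (- k)"
  let ?K = "\<lambda>n k. fourier_L1 f k * (fourier_L1 h (- k) * of_real (gauss (e n *\<^sub>R k)))"
  let ?I = "\<lambda>n x. LINT z|lborel. h (x + e n *\<^sub>R z) * of_real (gauss z)"
  let ?L = "\<lambda>n. LINT k|lborel. ?K n k"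
  show "?L \<longlonglongrightarrow> (LINT k|lborel. ?P k)"
  proof (rule integral_dominated_convergence[where w = "\<lambda>k. norm (?P k)"])
    show "integrable lborel (\<lambda>k. norm (?P k))"
      by (intro integrable_norm square_integrable_mult square_integrable_fourier_L1
          square_integrable_reflected_fourier_L1 f h)
    show "AE k in lborel. (\<lambda>n. ?K n k) \<longlonglongrightarrow> ?P k"
    proof (rule AE_I2)
      fix k
      have "(\<lambda>n. gauss (e n *\<^sub>R k)) \<longlonglongrightarrow> exp (- pi * (norm (0 *\<^sub>R k))\<^sup>2)"
        unfolding gauss_def by (intro tendsto_intros elim)
      then have "(\<lambda>n. gauss (e n *\<^sub>R k)) \<longlonglongrightarrow> 1" by simp
      from tendsto_mult[OF tendsto_const tendsto_mult[OF tendsto_const tendsto_of_real[OF this]], of "fourier_L1 f k" "fourier_L1 h (- k)"]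
      show "(\<lambda>n. ?K n k) \<longlonglongrightarrow> ?P k"
        by simp
    qed
    show "AE k in lborel. norm (?K n k) \<le> norm (?P k)" for n
      using g0 g1 by (auto simp: norm_mult intro!: mult_left_mono mult_left_le)
  qed measurable
  have L: "?L n = (LINT x|lborel. f x * ?I n x)" for n
    by (rule fourier_L1_gauss_regularised[OF f(1) h(1) e])
  have gi: "integrable lborel (\<lambda>z. B * gauss z)"
    using gauss_integral(1) by simp
  have B0: "0 \<le> B" using B norm_ge_zero order_trans by blast
  have bd: "norm (h y * complex_of_real (gauss z)) \<le> B * gauss z" for y z
    using B[of y] g0[of z] by (auto simp: norm_mult intro!: mult_right_mono)
  show "?L \<longlonglongrightarrow> (LINT x|lborel. f x * h x)"
    unfolding L
  proof (rule integral_dominated_convergence[where w = "\<lambda>x. norm (f x) * B"])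
    show "integrable lborel (\<lambda>x. norm (f x) * B)" using f by simp
    show "AE x in lborel. (\<lambda>n. f x * ?I n x) \<longlonglongrightarrow> f x * h x"
    proof (rule AE_I2)
      fix x
      have "(\<lambda>n. LINT z|lborel. h (x + e n *\<^sub>R z) * of_real (gauss z)) \<longlonglongrightarrow> (LINT z|lborel. h x * complex_of_real (gauss z))"
      proof (rule integral_dominated_convergence[OF _ _ gi])
        show "AE z in lborel. (\<lambda>n. h (x + e n *\<^sub>R z) * of_real (gauss z)) \<longlonglongrightarrow> h x * of_real (gauss z)"
        proof (rule AE_I2)
          fix z
          have "(\<lambda>n. x + e n *\<^sub>R z) \<longlonglongrightarrow> x + 0 *\<^sub>R z" by (intro tendsto_intros elim)
          then have "(\<lambda>n. h (x + e n *\<^sub>R z)) \<longlonglongrightarrow> h x"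
            using cont by (intro isCont_tendsto_compose[of x h]) (auto simp: continuous_on_eq_continuous_at)
          then show "(\<lambda>n. h (x + e n *\<^sub>R z) * of_real (gauss z)) \<longlonglongrightarrow> h x * of_real (gauss z)"
            by (intro tendsto_intros)
        qed
      qed (auto intro: bd)
      also have "(LINT z|lborel. h x * complex_of_real (gauss z)) = h x"
        by (simp add: gauss_integral(2))
      finally show "(\<lambda>n. f x * ?I n x) \<longlonglongrightarrow> f x * h x"
        by (intro tendsto_intros)
    qed
    show "AE x in lborel. norm (f x * ?I n x) \<le> norm (f x) * B" for n
    proof (rule AE_I2)
      fix x
      have "norm (?I n x) \<le> (LINT z|lborel. B * gauss z)"
        by (rule Bochner_Integration.integral_norm_bound_integral[OF _ gi bd])
           (rule Bochner_Integration.integrable_bound[OF gi], auto intro: order_trans[OF bd abs_ge_self])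
      also have "\<dots> = B" by (simp add: gauss_integral(2))
      finally show "norm (f x * ?I n x) \<le> norm (f x) * B"
        by (auto simp: norm_mult intro: mult_left_mono)
    qed
  qed measurable
qed


section \<open>Transforms of square-integrable functions\<close>

lemma lebesgue_borel_version:
  fixes f :: "'a::euclidean_space \<Rightarrow> complex"
  assumes [measurable]: "f \<in> borel_measurable lebesgue"
  obtains g where "g \<in> borel_measurable borel" "AE x in lborel. f x = g x"
proof -
  obtain a where [measurable]: "a \<in> borel_measurable lborel" and a: "AE x in lborel. Re (f x) = a x"
    using completion_ex_borel_measurable_real[of "\<lambda>x. Re (f x)" lborel] by (auto simp: borel_measurable_complex_iff)
  obtain b where [measurable]: "b \<in> borel_measurable lborel" and b: "AE x in lborel. Im (f x) = b x"
    using completion_ex_borel_measurable_real[of "\<lambda>x. Im (f x)" lborel] by (auto simp: borel_measurable_complex_iff)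
  show thesis
  proof
    show "(\<lambda>x. Complex (a x) (b x)) \<in> borel_measurable borel"
      unfolding borel_measurable_complex_iff by simp
    show "AE x in lborel. f x = Complex (a x) (b x)"
      using a b by eventually_elim (simp add: complex_eq_iff)
  qed
qed

lemma square_integrable_borel_version:
  fixes f :: "real ^ 3 \<Rightarrow> complex"
  assumes f: "square_integrable lebesgue f"
  obtains g where "square_integrable lborel g" "AE x in lborel. f x = g x"
proof -
  have [measurable]: "f \<in> borel_measurable lebesgue" using f by (simp add: square_integrable_def)
  obtain g where g: "g \<in> borel_measurable borel" "AE x in lborel. f x = g x"
    using lebesgue_borel_version[OF \<open>f \<in> borel_measurable lebesgue\<close>] .
  have "L2_mass lborel f = L2_mass lborel g"
    by (rule nn_integral_cong_AE) (use g(2) in \<open>eventually_elim, simp\<close>)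
  moreover have "L2_mass lborel f < \<infinity>"
    using f by (simp add: square_integrable_nn nn_integral_completion)
  ultimately have "square_integrable lborel g"
    using g(1) by (simp add: square_integrable_nn)
  with g(2) show thesis using that by blast
qed

lemma fourier_L1_cong_AE:
  assumes [measurable]: "f \<in> borel_measurable lebesgue" "g \<in> borel_measurable borel"
    and eq: "AE x in lborel. f x = g x"
  shows "fourier_L1 f = fourier_L1 g"
proof
  fix k :: "real^3"
  have [measurable]: "g \<in> borel_measurable lebesgue"
    by (rule measurable_completion) simp
  have "(\<lambda>x. exp (- (2 * complex_of_real pi * \<i> * complex_of_real (k \<bullet> x)))) \<in> borel_measurable borel"
    by (intro borel_measurable_continuous_onI continuous_intros)
  then have [measurable]: "(\<lambda>x. exp (- (2 * complex_of_real pi * \<i> * complex_of_real (k \<bullet> x)))) \<in> borel_measurable lebesgue"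
    by (intro measurable_completion) simp
  show "fourier_L1 f k = fourier_L1 g k"
    unfolding fourier_L1_def
  proof (rule integral_cong_AE)
    show "AE x in lebesgue. exp (- (2 * complex_of_real pi * \<i> * complex_of_real (k \<bullet> x))) * f x
        = exp (- (2 * complex_of_real pi * \<i> * complex_of_real (k \<bullet> x))) * g x"
      using AE_completion[OF eq] by eventually_elim simp
  qed measurable
qed

lemma L1_L2_borel_version:
  assumes f: "integrable lebesgue f" "square_integrable lebesgue f"
  obtains g where "integrable lborel g" "square_integrable lborel g" "AE x in lborel. f x = g x"
    "fourier_L1 f = fourier_L1 g"
proof -
  obtain g where g: "square_integrable lborel g" "AE x in lborel. f x = g x"
    using square_integrable_borel_version[OF f(2)] .
  have [measurable]: "f \<in> borel_measurable lebesgue" "g \<in> borel_measurable borel"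
    using f g by (auto simp: square_integrable_def)
  have "g \<in> borel_measurable lebesgue"
    by (rule measurable_completion) simp
  then have "integrable lebesgue g"
    using AE_completion[OF g(2)] by (intro integrable_cong_AE_imp[OF f(1)]) (auto elim: eventually_mono)
  then have "integrable lborel g"
    by (subst (asm) integrable_completion) auto
  with g show thesis using that fourier_L1_cong_AE[of f g] by simp
qed

text \<open>
  Both sides are continuous along a sequence that converges to \<open>f\<close> while its transforms converge
  to \<open>g\<close>, so an identity between pairings extends from the functions that are also integrable
  to all square-integrable ones.
\<close>

lemma is_fourier_pairing:
  assumes fg: "is_fourier f g"
    and a: "square_integrable lborel a" and b: "square_integrable lborel b"
    and L1: "\<And>p. integrable lborel p \<Longrightarrow> square_integrable lborel p \<Longrightarrow>
      (LINT k|lborel. fourier_L1 p k * a k) = (LINT x|lborel. p x * b x)"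
  shows "(LINT k|lebesgue. g k * a k) = (LINT x|lebesgue. f x * b x)"
proof -
  have f: "square_integrable lebesgue f" and g: "square_integrable lebesgue g"
    using fg by (auto simp: is_fourier_def)
  obtain \<phi> where \<phi>: "\<And>n. integrable lebesgue (\<phi> n)" "\<And>n. square_integrable lebesgue (\<phi> n)"
    and lim: "L2_converges \<phi> f" "L2_converges (\<lambda>n. fourier_L1 (\<phi> n)) g"
    using fg by (auto simp: is_fourier_def)
  have [measurable]: "a \<in> borel_measurable borel" "b \<in> borel_measurable borel"
    using a b by (auto simp: square_integrable_def)
  have a': "square_integrable lebesgue a" and b': "square_integrable lebesgue b"
    using a b by (subst square_integrable_completion; simp)+
  have *: "square_integrable lebesgue (fourier_L1 (\<phi> n)) \<and>
    (LINT k|lebesgue. fourier_L1 (\<phi> n) k * a k) = (LINT x|lebesgue. \<phi> n x * b x)" for n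
  proof -
    obtain p where p: "integrable lborel p" "square_integrable lborel p" "AE x in lborel. \<phi> n x = p x"
      "fourier_L1 (\<phi> n) = fourier_L1 p"
      using L1_L2_borel_version[OF \<phi>] .
    have [measurable]: "p \<in> borel_measurable borel"
      using p by auto
    have "(LINT k|lebesgue. fourier_L1 (\<phi> n) k * a k) = (LINT k|lborel. fourier_L1 p k * a k)"
      unfolding p(4) by (rule integral_completion) measurable
    also have "\<dots> = (LINT x|lborel. p x * b x)"
      by (rule L1[OF p(1,2)])
    also have "\<dots> = (LINT x|lebesgue. p x * b x)"
      by (rule integral_completion[symmetric]) measurable
    also have "\<dots> = (LINT x|lebesgue. \<phi> n x * b x)"
    proof (rule integral_cong_AE)
      show "(\<lambda>x. p x * b x) \<in> borel_measurable lebesgue"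
        by (rule measurable_completion) measurable
      show "(\<lambda>x. \<phi> n x * b x) \<in> borel_measurable lebesgue"
        using \<phi>(2)[of n] b' by (auto simp: square_integrable_def)
      show "AE x in lebesgue. p x * b x = \<phi> n x * b x"
        using AE_completion[OF p(3)] by eventually_elim auto
    qed
    finally have "(LINT k|lebesgue. fourier_L1 (\<phi> n) k * a k) = (LINT x|lebesgue. \<phi> n x * b x)" .
    moreover have "square_integrable lebesgue (fourier_L1 p)"
      using square_integrable_fourier_L1[OF p(1,2)] by (subst square_integrable_completion) auto
    ultimately show ?thesis using p(4) by simp
  qed
  have "(\<lambda>n. LINT k|lebesgue. fourier_L1 (\<phi> n) k * a k) \<longlonglongrightarrow> (LINT k|lebesgue. g k * a k)"
    using lim(2)[unfolded L2_converges_def] * g a' by (intro L2_pairing_tendsto) auto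
  moreover have "(\<lambda>n. LINT x|lebesgue. \<phi> n x * b x) \<longlonglongrightarrow> (LINT x|lebesgue. f x * b x)"
    using lim(1)[unfolded L2_converges_def] \<phi> f b' by (intro L2_pairing_tendsto) auto
  ultimately show ?thesis
    using * by (simp add: LIMSEQ_unique)
qed

lemma is_fourier_integral_mult:
  assumes fg: "is_fourier f g" and \<psi>: "integrable lborel \<psi>" "square_integrable lborel \<psi>"
  shows "(LINT k|lebesgue. g k * \<psi> k) = (LINT x|lebesgue. f x * fourier_L1 \<psi> x)"
  by (rule is_fourier_pairing[OF fg \<psi>(2) square_integrable_fourier_L1[OF \<psi>]])
     (rule fourier_L1_integral_mult[OF _ \<psi>(1)])

lemma is_fourier_parseval:
  assumes fg: "is_fourier f g" and h: "integrable lborel h" "square_integrable lborel h"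
    and cont: "continuous_on UNIV h" and B: "\<And>x. norm (h x) \<le> B"
  shows "(LINT k|lebesgue. g k * fourier_L1 h (- k)) = (LINT x|lebesgue. f x * h x)"
  by (rule is_fourier_pairing[OF fg square_integrable_reflected_fourier_L1[OF h] h(2)])
     (rule parseval_L1[OF _ _ h cont B])

lemma square_integrable_restrict_cball:
  assumes f: "square_integrable lborel f"
  shows "integrable lborel (\<lambda>x::real^3. f x * indicator (cball 0 r) x)"
    and "square_integrable lborel (\<lambda>x. f x * indicator (cball 0 r) x)"
proof -
  have [measurable]: "f \<in> borel_measurable borel" using f by (simp add: square_integrable_def)
  have ind: "square_integrable lborel (indicator (cball 0 r) :: real^3 \<Rightarrow> complex)"
  proof -
    have "(cmod (indicator (cball 0 r) x))\<^sup>2 = (indicator (cball 0 r) x :: real)" for x :: "real^3"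
      by (simp split: split_indicator)
    moreover have "integrable lborel (indicator (cball 0 r) :: real^3 \<Rightarrow> real)"
      by (intro integrable_real_indicator emeasure_compact_finite) auto
    ultimately show ?thesis
      unfolding square_integrable_def by (auto intro!: borel_measurable_indicator)
  qed
  show "integrable lborel (\<lambda>x::real^3. f x * indicator (cball 0 r) x)"
    by (rule square_integrable_mult[OF f ind])
  have "integrable lborel (\<lambda>x. (cmod (f x * indicator (cball 0 r) x))\<^sup>2)"
  proof (rule Bochner_Integration.integrable_bound)
    show "integrable lborel (\<lambda>x. (cmod (f x))\<^sup>2)"
      using f by (simp add: square_integrable_def)
    show "(\<lambda>x. (cmod (f x * indicator (cball 0 r) x))\<^sup>2) \<in> borel_measurable lborel"
      using ind by (auto simp: square_integrable_def)
  qed (auto split: split_indicator)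
  then show "square_integrable lborel (\<lambda>x. f x * indicator (cball 0 r) x)"
    using ind by (auto simp: square_integrable_def)
qed

text \<open>
  Test the multiplication formula with the conjugate of \<open>g - g'\<close> truncated to balls.
\<close>

lemma is_fourier_unique:
  assumes fg: "is_fourier f g" and fg': "is_fourier f' g'" and eq: "AE x in lebesgue. f x = f' x"
  shows "AE k in lebesgue. g k = g' k"
proof -
  have f: "square_integrable lebesgue f" "square_integrable lebesgue f'"
    and g: "square_integrable lebesgue g" "square_integrable lebesgue g'"
    using fg fg' by (auto simp: is_fourier_def)
  obtain a where a: "square_integrable lborel a" "AE x in lborel. g x = a x"
    using square_integrable_borel_version[OF g(1)] .
  obtain b where b: "square_integrable lborel b" "AE x in lborel. g' x = b x"
    using square_integrable_borel_version[OF g(2)] .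
  have [measurable]: "a \<in> borel_measurable borel" "b \<in> borel_measurable borel"
    using a b by (auto simp: square_integrable_def)
  define d where "d x = cnj (a x - b x)" for x
  have [measurable]: "cnj \<in> borel_measurable borel"
    by (intro borel_measurable_continuous_onI continuous_intros)
  have [measurable]: "d \<in> borel_measurable borel" unfolding d_def by measurable
  have d: "square_integrable lborel d"
  proof -
    have "integrable lborel (\<lambda>x. (cmod (d x))\<^sup>2)"
    proof (rule Bochner_Integration.integrable_bound)
      show "integrable lborel (\<lambda>x. 2 * (cmod (a x))\<^sup>2 + 2 * (cmod (b x))\<^sup>2)"
        using a b by (auto simp: square_integrable_def)
      have "(cmod (d x))\<^sup>2 \<le> 2 * (cmod (a x))\<^sup>2 + 2 * (cmod (b x))\<^sup>2" for x
        unfolding d_def complex_mod_cnj by (rule norm_diff_power2_le)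
      then show "AE x in lborel. norm ((cmod (d x))\<^sup>2) \<le> norm (2 * (cmod (a x))\<^sup>2 + 2 * (cmod (b x))\<^sup>2)"
        by (intro AE_I2) (auto intro: order_trans)
    qed measurable
    then show ?thesis by (simp add: square_integrable_def)
  qed
  have zero: "AE x in lborel. x \<in> cball 0 (real n) \<longrightarrow> a x = b x" for n
  proof -
    let ?\<psi> = "\<lambda>x. d x * indicator (cball 0 (real n)) x"
    note \<psi> = square_integrable_restrict_cball[OF d, of "real n"]
    have F: "square_integrable lebesgue (fourier_L1 ?\<psi>)"
      using square_integrable_fourier_L1[OF \<psi>] by (subst square_integrable_completion) (auto simp: square_integrable_def)
    have "(LINT x|lebesgue. f x * fourier_L1 ?\<psi> x) = (LINT x|lebesgue. f' x * fourier_L1 ?\<psi> x)"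
      by (rule integral_cong_AE) (use f F eq in \<open>auto simp: square_integrable_def\<close>)
    then have "(LINT k|lebesgue. g k * ?\<psi> k) = (LINT k|lebesgue. g' k * ?\<psi> k)"
      using is_fourier_integral_mult[OF fg \<psi>] is_fourier_integral_mult[OF fg' \<psi>] by simp
    moreover have "(LINT k|lebesgue. h k * ?\<psi> k) = (LINT k|lborel. c k * ?\<psi> k)"
      if "square_integrable lebesgue h" "square_integrable lborel c" "AE x in lborel. h x = c x" for h c
    proof -
      have m: "(\<lambda>k. c k * ?\<psi> k) \<in> borel_measurable lborel" "?\<psi> \<in> borel_measurable lborel"
        using \<psi>(2) that(2) by (auto simp: square_integrable_def)
      have "(LINT k|lebesgue. h k * ?\<psi> k) = (LINT k|lebesgue. c k * ?\<psi> k)"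
        by (rule integral_cong_AE)
           (use that(1) m[THEN measurable_completion] AE_completion[OF that(3)] in
             \<open>auto simp: square_integrable_def intro!: borel_measurable_times\<close>)
      then show ?thesis by (simp add: integral_completion[OF m(1)])
    qed
    note this[OF g(1) a] this[OF g(2) b]
    ultimately have "0 = (LINT k|lborel. a k * ?\<psi> k) - (LINT k|lborel. b k * ?\<psi> k)" by simp
    also have "\<dots> = (LINT k|lborel. a k * ?\<psi> k - b k * ?\<psi> k)"
      by (rule Bochner_Integration.integral_diff[symmetric]) (intro square_integrable_mult a b \<psi>)+
    also have "\<dots> = (LINT k|lborel. complex_of_real ((cmod (?\<psi> k))\<^sup>2))"
    proof (intro Bochner_Integration.integral_cong refl)
      fix k
      have "(a k - b k) * d k = complex_of_real ((cmod (d k))\<^sup>2)"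
        unfolding d_def complex_mod_cnj by (rule complex_norm_square[symmetric])
      then show "a k * ?\<psi> k - b k * ?\<psi> k = complex_of_real ((cmod (?\<psi> k))\<^sup>2)"
        by (auto simp: left_diff_distrib split: split_indicator)
    qed
    finally have "complex_of_real (LINT k|lborel. (cmod (?\<psi> k))\<^sup>2) = 0"
      by (simp only: integral_complex_of_real)
    then have "(LINT k|lborel. (cmod (?\<psi> k))\<^sup>2) = 0" by (simp only: of_real_eq_0_iff)
    then have "AE k in lborel. (cmod (?\<psi> k))\<^sup>2 = 0"
      using \<psi>(2) by (subst (asm) integral_nonneg_eq_0_iff_AE) (auto simp: square_integrable_def)
    then show ?thesis
      by eventually_elim (auto simp: d_def split: split_indicator_asm)
  qed
  have "AE x in lborel. \<forall>n. x \<in> cball 0 (real n) \<longrightarrow> a x = b x"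
    using zero by (simp only: AE_all_countable) blast
  then have "AE x in lborel. g x = g' x"
    using a(2) b(2)
  proof eventually_elim
    case (elim x)
    obtain n where "norm x \<le> real n" using real_arch_simple by blast
    with elim show ?case by auto
  qed
  then show ?thesis by (rule AE_completion)
qed


section \<open>A jointly measurable representative of the transform\<close>

definition cut :: "(real ^ 3 \<Rightarrow> complex) \<Rightarrow> nat \<Rightarrow> real ^ 3 \<Rightarrow> complex" where
  "cut f r x = (if norm x \<le> real r then f x else 0)"

text \<open>
  The least radius beyond which \<open>f\<close> has \<open>L\<^sup>2\<close> mass at most \<open>8^(-j)\<close>. Since it is a least
  natural number, it depends measurably on any parameter of \<open>f\<close>; the geometric rate makes the
  transforms of the truncations converge almost everywhere and not only in \<open>L\<^sup>2\<close>.
\<close>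

definition tail_radius :: "(real ^ 3 \<Rightarrow> complex) \<Rightarrow> nat \<Rightarrow> nat" where
  "tail_radius f j = (LEAST r. L2_mass lborel (\<lambda>x. f x - cut f r x) \<le> ennreal ((1 / 8) ^ j))"

definition fourier_cut :: "(real ^ 3 \<Rightarrow> complex) \<Rightarrow> nat \<Rightarrow> real ^ 3 \<Rightarrow> complex" where
  "fourier_cut f j k = (LINT x|lborel. wave (- k) x * cut f (tail_radius f j) x)"

text \<open>
  A pointwise limit, with the default value of \<open>lim\<close> where the sequence diverges. Hence it is
  defined and measurable for every \<open>f\<close>, while it is a Fourier transform only for
  square-integrable \<open>f\<close>.
\<close>

definition fourier_L2 :: "(real ^ 3 \<Rightarrow> complex) \<Rightarrow> real ^ 3 \<Rightarrow> complex" where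
  "fourier_L2 f k = lim (\<lambda>j. fourier_cut f j k)"

text \<open>
  The reason for the pointwise construction: the representatives for all parameters \<open>s\<close> at once
  form a measurable function, which choosing a representative for each \<open>s\<close> would not achieve.
\<close>

lemma fourier_L2_measurable_param:
  assumes [measurable]: "case_prod f \<in> borel_measurable (N \<Otimes>\<^sub>M lborel)" "\<kappa> \<in> borel_measurable N"
  shows "(\<lambda>s. fourier_L2 (f s) (\<kappa> s)) \<in> borel_measurable N"
proof -
  have [measurable]: "(\<lambda>s. tail_radius (f s) j) \<in> measurable N (count_space UNIV)" for j
    unfolding tail_radius_def cut_def by measurable
  show ?thesis
    unfolding fourier_L2_def fourier_cut_def cut_def by measurable
qed

lemma cut_eq_indicator: "cut f r = (\<lambda>x. f x * indicator (cball 0 (real r)) x)"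
  by (auto simp: cut_def fun_eq_iff split: split_indicator)

lemma square_integrable_cut:
  assumes "square_integrable lborel f"
  shows "integrable lborel (cut f r)" "square_integrable lborel (cut f r)"
  using square_integrable_restrict_cball[OF assms, of "real r"] by (simp_all add: cut_eq_indicator)

lemma cut_measurable [measurable]:
  assumes [measurable]: "f \<in> borel_measurable borel"
  shows "cut f r \<in> borel_measurable borel"
  unfolding cut_def[abs_def] by measurable

lemma tail_radius_le:
  assumes f: "square_integrable lborel f"
  shows "L2_mass lborel (\<lambda>x. f x - cut f (tail_radius f j) x) \<le> ennreal ((1 / 8) ^ j)"
proof -
  have [measurable]: "f \<in> borel_measurable borel" using f by (simp add: square_integrable_def)
  have "(\<lambda>r. \<integral>\<^sup>+x. ennreal ((cmod (f x - cut f r x))\<^sup>2) \<partial>lborel) \<longlonglongrightarrow> (\<integral>\<^sup>+(x::real^3). 0 \<partial>lborel)"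
  proof (rule nn_integral_dominated_convergence[where w = "\<lambda>x. ennreal ((cmod (f x))\<^sup>2)"])
    show "L2_mass lborel f < \<infinity>"
      using f by (simp add: square_integrable_nn)
    show "AE x in lborel. ennreal ((cmod (f x - cut f r x))\<^sup>2) \<le> ennreal ((cmod (f x))\<^sup>2)" for r
      by (auto simp: cut_def)
    show "AE x in lborel. (\<lambda>r. ennreal ((cmod (f x - cut f r x))\<^sup>2)) \<longlonglongrightarrow> 0"
    proof (rule AE_I2)
      fix x :: "real^3"
      obtain n where n: "norm x \<le> real n" using real_arch_simple by blast
      have "eventually (\<lambda>r. ennreal ((cmod (f x - cut f r x))\<^sup>2) = 0) sequentially"
        using eventually_ge_at_top[of n] by eventually_elim (use n in \<open>auto simp: cut_def\<close>)
      then show "(\<lambda>r. ennreal ((cmod (f x - cut f r x))\<^sup>2)) \<longlonglongrightarrow> 0"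
        by (rule tendsto_eventually)
    qed
  qed measurable
  then have "eventually (\<lambda>r. L2_mass lborel (\<lambda>x. f x - cut f r x) < ennreal ((1 / 8) ^ j)) sequentially"
    by (intro order_tendstoD(2)) (auto simp: ennreal_zero_less_one)
  then obtain r where "L2_mass lborel (\<lambda>x. f x - cut f r x) \<le> ennreal ((1 / 8) ^ j)"
    by (auto simp: eventually_sequentially intro: less_imp_le)
  then show ?thesis
    unfolding tail_radius_def by (rule LeastI)
qed

lemma fourier_cut_eq:
  assumes "square_integrable lborel f"
  shows "fourier_cut f j = fourier_L1 (cut f (tail_radius f j))"
  using assms by (auto simp: fun_eq_iff fourier_cut_def fourier_L1_eq square_integrable_def)

lemma geometric_increments_convergent:
  fixes F :: "nat \<Rightarrow> 'a::banach"
  assumes step: "\<And>j. norm (F (Suc j) - F j) \<le> c * (1 / 2) ^ j"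
  shows "F \<longlonglongrightarrow> lim F" and "norm (lim F - F j) \<le> 2 * c * (1 / 2) ^ j"
proof -
  have partial: "norm (F (j + m) - F j) \<le> 2 * c * (1 / 2) ^ j - 2 * c * (1 / 2) ^ (j + m)" for j m
  proof (induction m)
    case (Suc m)
    have "norm (F (j + Suc m) - F j) \<le> norm (F (Suc (j + m)) - F (j + m)) + norm (F (j + m) - F j)"
      using norm_triangle_ineq[of "F (Suc (j + m)) - F (j + m)" "F (j + m) - F j"] by simp
    also have "\<dots> \<le> c * (1 / 2) ^ (j + m) + (2 * c * (1 / 2) ^ j - 2 * c * (1 / 2) ^ (j + m))"
      by (rule add_mono[OF step Suc.IH])
    also have "\<dots> = 2 * c * (1 / 2) ^ j - 2 * c * (1 / 2) ^ (j + Suc m)"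
      by simp
    finally show ?case .
  qed simp
  have "0 \<le> c" using order_trans[OF norm_ge_zero step[of 0]] by simp
  have "summable (\<lambda>j. F (Suc j) - F j)"
  proof (rule summable_comparison_test')
    show "summable (\<lambda>j. c * (1 / 2) ^ j)" by (intro summable_mult summable_geometric) simp
  qed (rule step)
  then have "(\<lambda>n. \<Sum>j<n. F (Suc j) - F j) \<longlonglongrightarrow> (\<Sum>j. F (Suc j) - F j)"
    by (rule summable_LIMSEQ)
  then have "(\<lambda>n. F n - F 0) \<longlonglongrightarrow> (\<Sum>j. F (Suc j) - F j)"
    by (simp only: sum_lessThan_telescope)
  from tendsto_add[OF this tendsto_const[of "F 0"]] have "convergent F"
    by (auto simp: convergent_def)
  then show lim: "F \<longlonglongrightarrow> lim F" by (simp add: convergent_LIMSEQ_iff)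
  have "(\<lambda>m. norm (F (j + m) - F j)) \<longlonglongrightarrow> norm (lim F - F j)"
    using LIMSEQ_ignore_initial_segment[OF lim, of j] by (intro tendsto_intros) (simp add: add.commute)
  then show "norm (lim F - F j) \<le> 2 * c * (1 / 2) ^ j"
  proof (rule LIMSEQ_le_const2)
    have "norm (F (j + m) - F j) \<le> 2 * c * (1 / 2) ^ j" for m
    proof -
      have "0 \<le> 2 * c * (1 / 2) ^ (j + m)" using \<open>0 \<le> c\<close> by simp
      with partial[of j m] show ?thesis by linarith
    qed
    then show "\<exists>N. \<forall>n\<ge>N. norm (F (j + n) - F j) \<le> 2 * c * (1 / 2) ^ j" by blast
  qed
qed

text \<open>
  By the Plancherel bound the increments of the transforms decay like \<open>8^(-j)\<close> in squared
  \<open>L\<^sup>2\<close> norm, so \<open>S = \<Sum>\<^sub>j 4^j |F\<^sub>j\<^sub>+\<^sub>1 - F\<^sub>j|\<^sup>2\<close> is integrable. Wherever \<open>S\<close> is finite the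
  sequence converges, with error at most a multiple of \<open>2^(-j) sqrt S\<close>; squaring and
  integrating gives the convergence in \<open>L\<^sup>2\<close>.
\<close>

lemma fourier_L2_converges:
  assumes f: "square_integrable lborel f"
  shows "AE k in lborel. (\<lambda>j. fourier_cut f j k) \<longlonglongrightarrow> fourier_L2 f k"
    and "L2_converges (fourier_cut f) (fourier_L2 f)"
proof -
  let ?F = "fourier_cut f"
  let ?\<Delta> = "\<lambda>j k. ?F (Suc j) k - ?F j k"
  let ?E = "\<lambda>j k. ennreal ((cmod (?F j k - fourier_L2 f k))\<^sup>2)"
  have [measurable]: "f \<in> borel_measurable borel" using f by (simp add: square_integrable_def)
  have Fm [measurable]: "?F j \<in> borel_measurable borel" for j
    unfolding fourier_cut_eq[OF f] by measurable
  have Lm [measurable]: "fourier_L2 f \<in> borel_measurable borel"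
    by (rule fourier_L2_measurable_param[of "\<lambda>_. f" borel "\<lambda>k. k"]) measurable
  have step: "L2_mass lborel (?\<Delta> j) \<le> ennreal (4 * (1 / 8) ^ j)" for j
  proof -
    let ?g = "\<lambda>i. cut f (tail_radius f i)"
    let ?d = "\<lambda>x. ?g (Suc j) x - ?g j x"
    have two: "2 * ennreal a + 2 * ennreal b = ennreal (2 * a + 2 * b)" if "0 \<le> a" "0 \<le> b" for a b
      using that by (simp add: ennreal_mult)
    have d: "integrable lborel ?d"
      by (intro Bochner_Integration.integrable_diff square_integrable_cut f)
    have "?\<Delta> j k = fourier_L1 ?d k" for k
      unfolding fourier_cut_eq[OF f]
      by (simp add: fourier_L1_eq right_diff_distrib Bochner_Integration.integral_diff integrable_wave_mult square_integrable_cut f)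
    then have "L2_mass lborel (?\<Delta> j) \<le> L2_mass lborel ?d"
      using plancherel_le[OF d] by simp
    also have "\<dots> \<le> (\<integral>\<^sup>+x. 2 * ennreal ((cmod (f x - ?g j x))\<^sup>2) + 2 * ennreal ((cmod (f x - ?g (Suc j) x))\<^sup>2) \<partial>lborel)"
    proof (rule nn_integral_mono)
      fix x
      let ?a = "cmod (f x - ?g j x)" and ?b = "cmod (f x - ?g (Suc j) x)"
      have "(cmod (?d x))\<^sup>2 \<le> 2 * ?a\<^sup>2 + 2 * ?b\<^sup>2"
        using norm_diff_power2_le[of "f x - ?g j x" "f x - ?g (Suc j) x"] by simp
      then have "ennreal ((cmod (?d x))\<^sup>2) \<le> ennreal (2 * ?a\<^sup>2 + 2 * ?b\<^sup>2)" by (rule ennreal_leI)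
      also have "\<dots> = 2 * ennreal (?a\<^sup>2) + 2 * ennreal (?b\<^sup>2)"
        by (rule two[symmetric]) auto
      finally show "ennreal ((cmod (?d x))\<^sup>2) \<le> \<dots>" .
    qed
    also have "\<dots> = 2 * L2_mass lborel (\<lambda>x. f x - ?g j x) + 2 * L2_mass lborel (\<lambda>x. f x - ?g (Suc j) x)"
      by (simp add: nn_integral_add nn_integral_cmult)
    also have "\<dots> \<le> 2 * ennreal ((1 / 8) ^ j) + 2 * ennreal ((1 / 8) ^ Suc j)"
      by (intro add_mono mult_left_mono tail_radius_le[OF f]) auto
    also have "\<dots> = ennreal (2 * (1 / 8) ^ j + 2 * (1 / 8) ^ Suc j)"
      by (rule two) auto
    also have "\<dots> \<le> ennreal (4 * (1 / 8) ^ j)"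
      by (rule ennreal_leI) simp
    finally show ?thesis .
  qed
  \<comment> \<open>The weight \<open>4^j\<close> still leaves the summable bound \<open>4 * 2^(-j)\<close> for the integrals.\<close>
  define S where "S k = (\<Sum>j. ennreal (4 ^ j) * ennreal ((cmod (?\<Delta> j k))\<^sup>2))" for k
  have [measurable]: "S \<in> borel_measurable borel" unfolding S_def by measurable
  have "(\<integral>\<^sup>+k. S k \<partial>lborel) = (\<Sum>j. ennreal (4 ^ j) * L2_mass lborel (?\<Delta> j))"
    unfolding S_def by (simp add: nn_integral_suminf nn_integral_cmult)
  also have "\<dots> \<le> (\<Sum>j. ennreal (4 * (1 / 2) ^ j))"
  proof (intro suminf_le summableI)
    fix j
    have "ennreal (4 ^ j) * L2_mass lborel (?\<Delta> j) \<le> ennreal (4 ^ j) * ennreal (4 * (1 / 8) ^ j)"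
      by (intro mult_left_mono step) simp
    also have "\<dots> = ennreal (4 ^ j * (4 * (1 / 8) ^ j))"
      by (rule ennreal_mult[symmetric]) auto
    also have "4 ^ j * (4 * (1 / 8) ^ j) = 4 * (1 / 2 :: real) ^ j"
      by (simp add: power_mult_distrib[symmetric])
    finally show "ennreal (4 ^ j) * L2_mass lborel (?\<Delta> j) \<le> ennreal (4 * (1 / 2) ^ j)" .
  qed
  also have "\<dots> = ennreal (\<Sum>j. 4 * (1 / 2) ^ j)"
    by (intro suminf_ennreal2 summable_mult summable_geometric) auto
  finally have Sfin: "(\<integral>\<^sup>+k. S k \<partial>lborel) < \<infinity>"
    by (rule le_less_trans) simp
  then have AE_S: "AE k in lborel. S k \<noteq> \<infinity>"
    by (intro nn_integral_PInf_AE) auto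
  have main: "(\<lambda>j. ?F j k) \<longlonglongrightarrow> fourier_L2 f k \<and>
     (\<forall>j. ?E j k \<le> ennreal (4 * (1 / 4) ^ j) * S k)" if "S k \<noteq> \<infinity>" for k
  proof -
    define s where "s = enn2real (S k)"
    have s: "S k = ennreal s" "0 \<le> s" using that by (auto simp: s_def less_top)
    have inc: "cmod (?\<Delta> j k) \<le> sqrt s * (1 / 2) ^ j" for j
    proof -
      have "ennreal (4 ^ j) * ennreal ((cmod (?\<Delta> j k))\<^sup>2) \<le> S k"
        unfolding S_def
        using sum_le_suminf[of "\<lambda>j. ennreal (4 ^ j) * ennreal ((cmod (?\<Delta> j k))\<^sup>2)" "{j}"] by simp
      then have "ennreal (4 ^ j * (cmod (?\<Delta> j k))\<^sup>2) \<le> ennreal s"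
        by (simp add: s ennreal_mult)
      then have le_s: "4 ^ j * (cmod (?\<Delta> j k))\<^sup>2 \<le> s"
        using s(2) by simp
      have "(2 ^ j * cmod (?\<Delta> j k))\<^sup>2 \<le> s"
      proof -
        have "(4 :: real) ^ j = (2 ^ j)\<^sup>2"
          by (simp add: power2_eq_square flip: power_mult_distrib)
        with le_s show ?thesis by (simp add: power_mult_distrib)
      qed
      then have "2 ^ j * cmod (?\<Delta> j k) \<le> sqrt s"
        by (rule real_le_rsqrt)
      then show ?thesis by (simp add: field_simps)
    qed
    have conv: "(\<lambda>j. ?F j k) \<longlonglongrightarrow> fourier_L2 f k"
      and tail: "\<And>j. cmod (fourier_L2 f k - ?F j k) \<le> 2 * sqrt s * (1 / 2) ^ j"
      unfolding fourier_L2_def using geometric_increments_convergent[of "\<lambda>j. ?F j k", OF inc] by auto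
    have "?E j k \<le> ennreal (4 * (1 / 4) ^ j) * S k" for j
    proof -
      have "(cmod (?F j k - fourier_L2 f k))\<^sup>2 \<le> (2 * sqrt s * (1 / 2) ^ j)\<^sup>2"
        using tail[of j] by (intro power_mono) (simp_all add: norm_minus_commute)
      also have "\<dots> = 4 * (1 / 4) ^ j * s"
      proof -
        have "((1 / 2 :: real) ^ j)\<^sup>2 = (1 / 4) ^ j"
          by (simp add: power2_eq_square flip: power_mult_distrib)
        with s(2) show ?thesis by (simp add: power_mult_distrib)
      qed
      finally have "?E j k \<le> ennreal (4 * (1 / 4) ^ j * s)"
        by (rule ennreal_leI)
      also have "\<dots> = ennreal (4 * (1 / 4) ^ j) * S k"
        unfolding s(1) by (rule ennreal_mult) (auto simp: s(2))
      finally show ?thesis .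
    qed
    with conv show ?thesis by blast
  qed
  show "AE k in lborel. (\<lambda>j. ?F j k) \<longlonglongrightarrow> fourier_L2 f k"
    using AE_S by eventually_elim (use main in blast)
  have bound: "L2_mass lborel (\<lambda>k. ?F j k - fourier_L2 f k) \<le> ennreal (4 * (1 / 4) ^ j) * (\<integral>\<^sup>+k. S k \<partial>lborel)" for j
  proof -
    have "L2_mass lborel (\<lambda>k. ?F j k - fourier_L2 f k) \<le> (\<integral>\<^sup>+k. ennreal (4 * (1 / 4) ^ j) * S k \<partial>lborel)"
      by (rule nn_integral_mono_AE) (use AE_S in \<open>eventually_elim, use main in blast\<close>)
    then show ?thesis by (simp add: nn_integral_cmult)
  qed
  have "(\<lambda>j. 4 * (1 / 4 :: real) ^ j) \<longlonglongrightarrow> 4 * 0"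
    by (intro tendsto_intros LIMSEQ_realpow_zero) auto
  then have "(\<lambda>j. ennreal (4 * (1 / 4) ^ j)) \<longlonglongrightarrow> ennreal 0"
    by (intro tendsto_ennrealI) simp
  then have "(\<lambda>j. ennreal (4 * (1 / 4) ^ j)) \<longlonglongrightarrow> 0" by simp
  from ennreal_tendsto_cmult[OF _ this, of "\<integral>\<^sup>+k. S k \<partial>lborel"] Sfin
  have "(\<lambda>j. ennreal (4 * (1 / 4) ^ j) * (\<integral>\<^sup>+k. S k \<partial>lborel)) \<longlonglongrightarrow> 0"
    by (simp add: mult.commute)
  from Lim_null_comparison_ennreal[OF this bound]
  show "L2_converges ?F (fourier_L2 f)"
    unfolding L2_converges_def by (simp add: nn_integral_completion)
qed

lemma fourier_L2_measurable [measurable]: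
  assumes [measurable]: "f \<in> borel_measurable borel"
  shows "fourier_L2 f \<in> borel_measurable borel"
  by (rule fourier_L2_measurable_param[of "\<lambda>_. f" borel "\<lambda>k. k"]) measurable

lemma fourier_L2_norm_le:
  assumes f: "square_integrable lborel f"
  shows "L2_mass lborel (fourier_L2 f) \<le> L2_mass lborel f"
proof -
  have [measurable]: "f \<in> borel_measurable borel" using f by (simp add: square_integrable_def)
  have [measurable]: "fourier_cut f j \<in> borel_measurable borel" for j
    unfolding fourier_cut_eq[OF f] by measurable
  have "L2_mass lborel (fourier_L2 f)
      = (\<integral>\<^sup>+k. liminf (\<lambda>j. ennreal ((cmod (fourier_cut f j k))\<^sup>2)) \<partial>lborel)"
  proof (rule nn_integral_cong_AE)
    show "AE k in lborel. ennreal ((cmod (fourier_L2 f k))\<^sup>2) = liminf (\<lambda>j. ennreal ((cmod (fourier_cut f j k))\<^sup>2))"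
      using fourier_L2_converges(1)[OF f]
    proof eventually_elim
      case (elim k)
      then have "(\<lambda>j. ennreal ((cmod (fourier_cut f j k))\<^sup>2)) \<longlonglongrightarrow> ennreal ((cmod (fourier_L2 f k))\<^sup>2)"
        by (intro tendsto_intros)
      then show ?case by (intro lim_imp_Liminf[symmetric]) auto
    qed
  qed
  also have "\<dots> \<le> liminf (\<lambda>j. \<integral>\<^sup>+k. ennreal ((cmod (fourier_cut f j k))\<^sup>2) \<partial>lborel)"
    by (rule nn_integral_liminf) measurable
  also have "\<dots> \<le> liminf (\<lambda>j::nat. \<integral>\<^sup>+x. ennreal ((cmod (f x))\<^sup>2) \<partial>lborel)"
  proof (intro Liminf_mono always_eventually allI)
    fix j
    have "L2_mass lborel (fourier_cut f j) \<le> L2_mass lborel (cut f (tail_radius f j))"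
      unfolding fourier_cut_eq[OF f] by (intro plancherel_le square_integrable_cut f)
    also have "\<dots> \<le> L2_mass lborel f"
      by (intro nn_integral_mono) (auto simp: cut_def)
    finally show "L2_mass lborel (fourier_cut f j) \<le> \<dots>" .
  qed
  also have "\<dots> = L2_mass lborel f" by (simp add: Liminf_const)
  finally show ?thesis .
qed

lemma square_integrable_fourier_L2:
  assumes f: "square_integrable lborel f"
  shows "square_integrable lborel (fourier_L2 f)"
  using fourier_L2_norm_le[OF f] f unfolding square_integrable_nn by auto

lemma is_fourier_fourier_L2:
  assumes f: "square_integrable lborel f"
  shows "is_fourier f (fourier_L2 f)"
  unfolding is_fourier_def
proof (intro conjI exI[of _ "\<lambda>j. cut f (tail_radius f j)"] allI)
  have [measurable]: "f \<in> borel_measurable borel" using f by (simp add: square_integrable_def)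
  have m: "g \<in> borel_measurable borel \<Longrightarrow> square_integrable lebesgue g \<longleftrightarrow> square_integrable lborel g" for g :: "real^3 \<Rightarrow> complex"
    by (rule square_integrable_completion) simp
  show "square_integrable lebesgue f" using f by (simp add: m)
  show "square_integrable lebesgue (fourier_L2 f)"
    using square_integrable_fourier_L2[OF f] by (simp add: m)
  show "integrable lebesgue (cut f (tail_radius f j))" for j
    using square_integrable_cut(1)[OF f] by (subst integrable_completion) auto
  show "square_integrable lebesgue (cut f (tail_radius f j))" for j
    using square_integrable_cut(2)[OF f] by (simp add: m)
  show "L2_converges (\<lambda>j. fourier_L1 (cut f (tail_radius f j))) (fourier_L2 f)"
    using fourier_L2_converges(2)[OF f] by (simp add: fourier_cut_eq[OF f, symmetric])
  show "L2_converges (\<lambda>j. cut f (tail_radius f j)) f"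
    unfolding L2_converges_def
  proof (rule Lim_null_comparison_ennreal)
    have "(\<lambda>j. (1 / 8 :: real) ^ j) \<longlonglongrightarrow> 0" by (intro LIMSEQ_realpow_zero) auto
    then have "(\<lambda>j. ennreal ((1 / 8) ^ j)) \<longlonglongrightarrow> ennreal 0" by (intro tendsto_ennrealI)
    then show "(\<lambda>j. ennreal ((1 / 8) ^ j)) \<longlonglongrightarrow> 0" by simp
    show "L2_mass lebesgue (\<lambda>x. cut f (tail_radius f j) x - f x) \<le> ennreal ((1 / 8) ^ j)" for j
      using tail_radius_le[OF f, of j] by (simp add: nn_integral_completion norm_minus_commute)
  qed
qed


section \<open>Biquaternion-valued functions\<close>

lemma forall_4: "(\<forall>j::4. P j) \<longleftrightarrow> P 0 \<and> P 1 \<and> P 2 \<and> P 3"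
proof -
  have "(\<forall>j::4. P j) \<longleftrightarrow> (\<forall>j\<in>UNIV. P j)" by simp
  then show ?thesis unfolding UNIV_4_from_0 by simp
qed

lemma sum_4: "(\<Sum>j\<in>(UNIV::4 set). f j) = f 0 + f 1 + f 2 + f 3"
proof -
  have "(0::4) \<noteq> 1" "(0::4) \<noteq> 2" "(0::4) \<noteq> 3" "(1::4) \<noteq> 2" "(1::4) \<noteq> 3" "(2::4) \<noteq> 3" by simp_all
  then show ?thesis unfolding UNIV_4_from_0 by (simp add: add.assoc)
qed

lemma biquat_norm_power2: "(norm (q::biquat))\<^sup>2 = (\<Sum>j\<in>UNIV. (cmod (q $ j))\<^sup>2)"
  by (simp add: norm_vec_def L2_set_def sum_nonneg)

lemma bounded_bilinear_bq_mult: "bounded_bilinear (\<odot>)"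
proof -
  have "bilinear (\<odot>)"
    unfolding bilinear_def
    by (auto intro!: linearI simp: biquat_eq_iff bq_mult_def algebra_simps)
  then show ?thesis by (simp add: bilinear_conv_bounded_bilinear)
qed

lemma bounded_bilinear_vector_scalar: "bounded_bilinear ((*s) :: complex \<Rightarrow> biquat \<Rightarrow> biquat)"
proof -
  have "bilinear ((*s) :: complex \<Rightarrow> biquat \<Rightarrow> biquat)"
    unfolding bilinear_def
    by (auto intro!: linearI simp: vec_eq_iff algebra_simps)
  then show ?thesis by (simp add: bilinear_conv_bounded_bilinear)
qed

lemmas bq_mult_linear_right = bounded_bilinear.bounded_linear_right[OF bounded_bilinear_bq_mult]
lemmas vector_scalar_linear_right = bounded_bilinear.bounded_linear_right[OF bounded_bilinear_vector_scalar]

lemma vec_nth_measurable [measurable (raw)]: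
  fixes f :: "'a \<Rightarrow> 'b::real_normed_vector ^ 'n"
  assumes "f \<in> borel_measurable M"
  shows "(\<lambda>x. f x $ j) \<in> borel_measurable M"
proof -
  have "continuous_on UNIV (\<lambda>q::'b ^ 'n. q $ j)" by (intro continuous_intros)
  from borel_measurable_continuous_on[OF this assms] show ?thesis .
qed

lemma biquat_measurable_iff:
  fixes f :: "'a \<Rightarrow> biquat"
  shows "f \<in> borel_measurable M \<longleftrightarrow> (\<forall>j. (\<lambda>x. f x $ j) \<in> borel_measurable M)"
proof
  show "\<forall>j. (\<lambda>x. f x $ j) \<in> borel_measurable M" if "f \<in> borel_measurable M"
    using that by simp
next
  assume f: "\<forall>j. (\<lambda>x. f x $ j) \<in> borel_measurable M"
  have "linear (axis j :: complex \<Rightarrow> biquat)" for j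
    by (rule linearI) (simp_all add: vec_eq_iff axis_def)
  then have "continuous_on UNIV (axis j :: complex \<Rightarrow> biquat)" for j
    by (rule linear_continuous_on[OF linear_conv_bounded_linear[THEN iffD1]])
  from borel_measurable_continuous_on[OF this f[rule_format]]
  have "(\<lambda>x. \<Sum>j\<in>UNIV. axis j (f x $ j)) \<in> borel_measurable M"
    by (intro borel_measurable_sum)
  moreover have "(\<Sum>j\<in>UNIV. axis j (q $ j)) = q" for q :: biquat
    by (simp add: vec_eq_iff axis_def sum.delta')
  ultimately show "f \<in> borel_measurable M" by simp
qed

lemma biquat_lambda_measurable [measurable (raw)]:
  assumes "\<And>j. (\<lambda>x. f x j) \<in> borel_measurable M"
  shows "(\<lambda>x. (\<chi> j. f x j) :: biquat) \<in> borel_measurable M"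
  using assms by (subst biquat_measurable_iff) simp

lemma vector_scalar_measurable [measurable (raw)]:
  assumes [measurable]: "c \<in> borel_measurable M" "f \<in> borel_measurable M"
  shows "(\<lambda>x. c x *s (f x :: biquat)) \<in> borel_measurable M"
  by (subst biquat_measurable_iff) simp

lemma bq_mult_measurable [measurable (raw)]:
  assumes [measurable]: "f \<in> borel_measurable M" "g \<in> borel_measurable M"
  shows "(\<lambda>x. f x \<odot> g x) \<in> borel_measurable M"
  by (subst biquat_measurable_iff, subst forall_4) (simp add: bq_mult_def)

lemma vecq_measurable [measurable (raw)]:
  assumes [measurable]: "f \<in> borel_measurable M"
  shows "(\<lambda>x. vecq (f x)) \<in> borel_measurable M"
  unfolding vecq_def by measurable

lemma kexp_measurable [measurable (raw)]:
  assumes [measurable]: "f \<in> borel_measurable M" "g \<in> borel_measurable M"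
  shows "(\<lambda>x. kexp \<sigma> (f x) (g x)) \<in> borel_measurable M"
  unfolding kexp_def by measurable

text \<open>
  A unit real quaternion acts isometrically on the biquaternions, although their norm is not
  multiplicative.
\<close>

lemma norm_real_quaternion_mult:
  fixes a b c d :: real
  assumes "a\<^sup>2 + b\<^sup>2 + c\<^sup>2 + d\<^sup>2 = 1"
  shows "norm (bq (of_real a) (of_real b) (of_real c) (of_real d) \<odot> q) = norm q"
proof -
  have "(norm (bq (of_real a) (of_real b) (of_real c) (of_real d) \<odot> q))\<^sup>2
      = (a\<^sup>2 + b\<^sup>2 + c\<^sup>2 + d\<^sup>2) * (norm q)\<^sup>2"
    unfolding biquat_norm_power2 sum_4
    by (simp add: bq_mult_def cmod_power2) (simp add: power2_eq_square algebra_simps)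
  then show ?thesis using assms by simp
qed

lemma kexp_eq_bq:
  "kexp \<sigma> k \<tau> = bq (of_real (cos (2 * pi * norm k * \<tau>)))
    (of_real (- (\<sigma> * (sin (2 * pi * norm k * \<tau>) / norm k) * k $ 1)))
    (of_real (- (\<sigma> * (sin (2 * pi * norm k * \<tau>) / norm k) * k $ 2)))
    (of_real (- (\<sigma> * (sin (2 * pi * norm k * \<tau>) / norm k) * k $ 3)))"
  by (simp add: biquat_eq_iff kexp_def vecq_def bq_one_def e1_def e2_def e3_def)

lemma norm_kexp_mult:
  assumes "\<sigma> \<in> {1, -1 :: real}"
  shows "norm (kexp \<sigma> k \<tau> \<odot> q) = norm q"
  unfolding kexp_eq_bq
proof (rule norm_real_quaternion_mult)
  have norm2: "(norm k)\<^sup>2 = (k $ 1)\<^sup>2 + (k $ 2)\<^sup>2 + (k $ 3)\<^sup>2"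
    by (simp add: norm_vec_def L2_set_def sum_3)
  have \<sigma>: "\<sigma>\<^sup>2 = 1" using assms by auto
  show "(cos (2 * pi * norm k * \<tau>))\<^sup>2 + (- (\<sigma> * (sin (2 * pi * norm k * \<tau>) / norm k) * k $ 1))\<^sup>2 +
      (- (\<sigma> * (sin (2 * pi * norm k * \<tau>) / norm k) * k $ 2))\<^sup>2 + (- (\<sigma> * (sin (2 * pi * norm k * \<tau>) / norm k) * k $ 3))\<^sup>2 = 1"
    (is "?L = 1")
  proof (cases "k = 0")
    case False
    define S where "S = sin (2 * pi * norm k * \<tau>) / norm k"
    have "?L = (cos (2 * pi * norm k * \<tau>))\<^sup>2 + S\<^sup>2 * (norm k)\<^sup>2"
      unfolding norm2 S_def[symmetric] by (simp add: power_mult_distrib \<sigma> algebra_simps)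
    also have "\<dots> = 1" using False by (simp add: S_def power_divide)
    finally show ?thesis .
  qed simp
qed

lemma kexp_0: "kexp \<sigma> k 0 \<odot> q = q"
  by (simp add: kexp_def bq_mult_one bq_mult_scalar biquat_eq_iff)


section \<open>Null sets and slices\<close>

lemma AE_lborel_uminus:
  fixes P :: "'a::euclidean_space \<Rightarrow> bool"
  assumes "AE x in lborel. P x"
  shows "AE x in lborel. P (- x)"
proof -
  obtain N where N: "\<And>x. x \<in> space lborel - N \<Longrightarrow> P x" "N \<in> null_sets lborel"
    using AE_E3[OF assms] by metis
  have [measurable]: "N \<in> sets borel" using N(2) by auto
  have "(\<integral>\<^sup>+x. indicator N (- x) \<partial>lborel) = (\<integral>\<^sup>+x. indicator N x \<partial>(lborel::'a measure))"
    by (rule nn_integral_lborel_uminus) measurable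
  also have "\<dots> = 0" using N(2) by auto
  finally have "AE x in lborel. indicator N (- x) = (0::ennreal)"
    by (subst (asm) nn_integral_0_iff_AE) measurable
  then show ?thesis
    by eventually_elim (use N(1) in \<open>auto split: split_indicator_asm\<close>)
qed

lemma AE_lborel_slices:
  fixes P :: "(real^3) \<times> real \<Rightarrow> bool"
  assumes "AE p in lborel. P p"
  shows "AE x in lborel. AE s in lborel. P (x, s)" and "AE s in lborel. AE x in lborel. P (x, s)"
proof -
  obtain N where N: "\<And>p. p \<in> space lborel - N \<Longrightarrow> P p" "N \<in> null_sets lborel"
    using AE_E3[OF assms] by metis
  have Nm: "N \<in> sets (lborel \<Otimes>\<^sub>M lborel)" using N(2) unfolding lborel_prod by auto
  have "AE p in (lborel \<Otimes>\<^sub>M lborel). p \<notin> N"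
    using AE_not_in[OF N(2)] unfolding lborel_prod .
  from lborel_pair.AE_pair[OF this]
  have 1: "AE x in lborel. AE s in lborel. (x, s) \<notin> N" .
  show "AE x in lborel. AE s in lborel. P (x, s)"
    using 1 by eventually_elim (auto elim!: eventually_mono intro: N(1))
  have "{p \<in> space (lborel \<Otimes>\<^sub>M lborel). (fst p, snd p) \<notin> N} = space (lborel \<Otimes>\<^sub>M lborel) - N"
    by auto
  also have "\<dots> \<in> sets (lborel \<Otimes>\<^sub>M lborel)" using Nm by (intro sets.Diff sets.top)
  finally have "AE s in lborel. AE x in lborel. (x, s) \<notin> N"
    using 1 by (subst lborel_pair.AE_commute[symmetric]) auto
  then show "AE s in lborel. AE x in lborel. P (x, s)"
    by eventually_elim (auto elim!: eventually_mono intro: N(1))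
qed

lemma lebesgue_set_borel_version:
  assumes "S \<in> sets lebesgue"
  obtains B where "B \<in> sets borel" "AE p in lborel. p \<in> S \<longleftrightarrow> p \<in> B"
proof -
  have "(indicator S :: _ \<Rightarrow> real) \<in> borel_measurable lebesgue"
    using assms by (rule borel_measurable_indicator)
  then obtain g where g: "g \<in> borel_measurable lborel" "AE p in lborel. indicator S p = (g p :: real)"
    using completion_ex_borel_measurable_real by blast
  show thesis
  proof
    have "g -` {1} \<inter> space lborel \<in> sets lborel"
      by (rule measurable_sets[OF g(1)]) simp
    then show "g -` {1} \<in> sets borel" by simp
    show "AE p in lborel. p \<in> S \<longleftrightarrow> p \<in> g -` {1}"
      using g(2) by eventually_elim (auto split: split_indicator_asm)
  qed
qed

text \<open>
  A Lebesgue measurable set differs from a Borel set by a null set, and Tonelli's theorem for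
  the Borel set gives the converse of \<open>AE_lborel_slices\<close>.
\<close>

lemma AE_lebesgue_from_slices:
  fixes S :: "((real^3) \<times> real) set"
  assumes S: "S \<in> sets lebesgue" and ae: "AE s in lborel. AE x in lborel. (x, s) \<in> S"
  shows "AE p in lborel. p \<in> S"
proof -
  obtain B where B: "B \<in> sets borel" "AE p in lborel. p \<in> S \<longleftrightarrow> p \<in> B"
    using lebesgue_set_borel_version[OF S] .
  have Bm: "B \<in> sets (lborel \<Otimes>\<^sub>M lborel)" using B(1) unfolding lborel_prod by simp
  have "AE s in lborel. AE x in lborel. (x, s) \<in> B"
    using ae AE_lborel_slices(2)[OF B(2)]
  proof eventually_elim
    case (elim s)
    then show ?case by eventually_elim simp
  qed
  moreover have eq: "{p \<in> space (lborel \<Otimes>\<^sub>M lborel). (fst p, snd p) \<in> B} = B"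
    by (auto simp: space_pair_measure)
  ultimately have "AE x in lborel. AE s in lborel. (x, s) \<in> B"
    using Bm by (subst lborel_pair.AE_commute) auto
  then have "AE p in lborel \<Otimes>\<^sub>M lborel. p \<in> B"
    using Bm eq by (intro lborel_pair.AE_pair_measure) auto
  then have "AE p in lborel. p \<in> B" unfolding lborel_prod .
  with B(2) show ?thesis by eventually_elim simp
qed

lemma lebesgue_measurable_cong_AE:
  fixes f g :: "'a::euclidean_space \<Rightarrow> 'b::topological_space"
  assumes g: "g \<in> borel_measurable lebesgue" and eq: "AE x in lborel. f x = g x"
  shows "f \<in> borel_measurable lebesgue"
proof (rule measurableI)
  fix A :: "'b set" assume "A \<in> sets borel"
  then have "g -` A \<inter> space lebesgue \<in> sets lebesgue" by (rule measurable_sets[OF g])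
  then show "f -` A \<inter> space lebesgue \<in> sets lebesgue"
  proof (rule completion.in_sets_AE[rotated])
    show "AE x in lebesgue. x \<in> g -` A \<inter> space lebesgue \<longleftrightarrow> x \<in> f -` A \<inter> space lebesgue"
      using AE_completion[OF eq] by eventually_elim auto
  qed simp
qed simp

lemma is_fourier_cong_AE:
  assumes fg: "is_fourier f g" and f: "AE x in lborel. f' x = f x" and g: "AE x in lborel. g' x = g x"
  shows "is_fourier f' g'"
proof -
  have sq: "square_integrable lebesgue a'" if "square_integrable lebesgue a" "AE x in lborel. a' x = a x" for a a' :: "real^3 \<Rightarrow> complex"
  proof -
    have "L2_mass lebesgue a' = L2_mass lebesgue a"
      by (rule nn_integral_cong_AE) (use AE_completion[OF that(2)] in \<open>eventually_elim, simp\<close>)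
    then show ?thesis
      using that lebesgue_measurable_cong_AE[OF _ that(2)] by (simp add: square_integrable_nn)
  qed
  have L2: "L2_converges \<phi> a' \<longleftrightarrow> L2_converges \<phi> a" if "AE x in lborel. a' x = a x" for \<phi> and a a' :: "real^3 \<Rightarrow> complex"
  proof -
    have "L2_mass lebesgue (\<lambda>x. \<phi> n x - a' x) = L2_mass lebesgue (\<lambda>x. \<phi> n x - a x)" for n
      by (rule nn_integral_cong_AE) (use AE_completion[OF that] in \<open>eventually_elim, simp\<close>)
    then show ?thesis by (simp add: L2_converges_def)
  qed
  show ?thesis
    using fg sq[OF _ f] sq[OF _ g] L2[OF f] L2[OF g] unfolding is_fourier_def by blast
qed

lemma is_fourier_fourier:
  assumes "is_fourier f g"
  shows "is_fourier f (fourier f)"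
  unfolding fourier_def using assms by (rule someI[of "is_fourier f"])


section \<open>The transform of biquaternion-valued functions\<close>

lemma norm_vector_scalar: "norm (c *s (q :: biquat)) = cmod c * norm q"
proof -
  have "(norm (c *s q))\<^sup>2 = (cmod c * norm q)\<^sup>2"
    by (simp add: biquat_norm_power2 norm_mult power_mult_distrib sum_distrib_left)
  then show ?thesis by (subst (asm) power2_eq_iff_nonneg) auto
qed

lemma nn_integral_biquat_norm_power2:
  fixes q :: "'a \<Rightarrow> biquat"
  assumes [measurable]: "q \<in> borel_measurable M"
  shows "L2_mass M q = (\<Sum>j\<in>UNIV. \<integral>\<^sup>+x. ennreal ((cmod (q x $ j))\<^sup>2) \<partial>M)"
  unfolding biquat_norm_power2
  by (subst nn_integral_sum[symmetric]) (auto simp: sum_ennreal)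

definition L2_biquat :: "'a measure \<Rightarrow> ('a \<Rightarrow> biquat) \<Rightarrow> bool" where
  "L2_biquat M q \<longleftrightarrow> q \<in> borel_measurable M \<and> L2_mass M q < \<infinity>"

lemma L2_biquat_component:
  assumes "L2_biquat M q"
  shows "square_integrable M (\<lambda>x. q x $ j)"
proof -
  have [measurable]: "q \<in> borel_measurable M" and fin: "L2_mass M q < \<infinity>"
    using assms by (auto simp: L2_biquat_def)
  have "L2_mass M (\<lambda>x. q x $ j) \<le> L2_mass M q"
    by (intro nn_integral_mono ennreal_leI power_mono Finite_Cartesian_Product.norm_nth_le norm_ge_zero)
  then show ?thesis
    using fin by (simp add: square_integrable_nn)
qed

lemma L2_biquat_scaled_integrable:
  assumes c: "square_integrable M c" and q: "L2_biquat M q"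
  shows "integrable M (\<lambda>x. c x *s q x)"
proof (rule integrableI_bounded)
  have [measurable]: "c \<in> borel_measurable M" "q \<in> borel_measurable M"
    using c q by (auto simp: square_integrable_def L2_biquat_def)
  show "(\<lambda>x. c x *s q x) \<in> borel_measurable M" by measurable
  have "(\<integral>\<^sup>+x. ennreal (norm (c x *s q x)) \<partial>M) \<le> (\<integral>\<^sup>+x. ennreal ((cmod (c x))\<^sup>2 + (norm (q x))\<^sup>2) \<partial>M)"
    unfolding norm_vector_scalar by (intro nn_integral_mono ennreal_leI mult_le_sum_squares) auto
  also have "\<dots> = L2_mass M c + L2_mass M q"
    by (simp add: nn_integral_add)
  also have "\<dots> < \<infinity>"
    using c q by (simp add: square_integrable_nn L2_biquat_def)
  finally show "(\<integral>\<^sup>+x. ennreal (norm (c x *s q x)) \<partial>M) < \<infinity>" .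
qed

definition fourier_L2_bq :: "(real ^ 3 \<Rightarrow> biquat) \<Rightarrow> real ^ 3 \<Rightarrow> biquat" where
  "fourier_L2_bq q k = (\<chi> j. fourier_L2 (\<lambda>x. q x $ j) k)"

lemma fourier_L2_bq_measurable_param:
  assumes [measurable]: "case_prod q \<in> borel_measurable (N \<Otimes>\<^sub>M lborel)" "\<kappa> \<in> borel_measurable N"
  shows "(\<lambda>p. fourier_L2_bq (q p) (\<kappa> p)) \<in> borel_measurable N"
  unfolding fourier_L2_bq_def
  by (intro biquat_lambda_measurable fourier_L2_measurable_param) measurable

lemma fourier_L2_bq_measurable [measurable]:
  assumes [measurable]: "q \<in> borel_measurable borel"
  shows "fourier_L2_bq q \<in> borel_measurable borel"
  by (rule fourier_L2_bq_measurable_param[of "\<lambda>_. q" borel "\<lambda>k. k"]) measurable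

lemma fourier_L2_bq_norm_le:
  assumes q: "L2_biquat lborel q"
  shows "L2_mass lborel (fourier_L2_bq q) \<le> L2_mass lborel q"
proof -
  have [measurable]: "q \<in> borel_measurable borel" using q by (simp add: L2_biquat_def)
  have "L2_mass lborel (fourier_L2_bq q) = (\<Sum>j\<in>UNIV. \<integral>\<^sup>+k. ennreal ((cmod (fourier_L2_bq q k $ j))\<^sup>2) \<partial>lborel)"
    by (rule nn_integral_biquat_norm_power2) measurable
  also have "\<dots> \<le> (\<Sum>j\<in>UNIV. \<integral>\<^sup>+x. ennreal ((cmod (q x $ j))\<^sup>2) \<partial>lborel)"
    unfolding fourier_L2_bq_def vec_lambda_beta
    by (intro sum_mono fourier_L2_norm_le L2_biquat_component q)
  also have "\<dots> = L2_mass lborel q"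
    by (rule nn_integral_biquat_norm_power2[symmetric]) measurable
  finally show ?thesis .
qed

lemma L2_biquat_fourier:
  assumes "L2_biquat lborel q"
  shows "L2_biquat lborel (fourier_L2_bq q)"
  using fourier_L2_bq_norm_le[OF assms] assms unfolding L2_biquat_def by auto

lemma biquat_integral_eqI:
  fixes f g :: "'a \<Rightarrow> biquat"
  assumes "integrable M f" "integrable N g" "\<And>j. (LINT x|M. f x $ j) = (LINT x|N. g x $ j)"
  shows "(LINT x|M. f x) = (LINT x|N. g x)"
  using assms by (simp add: vec_eq_iff integral_bounded_linear[OF bounded_linear_vec_nth, symmetric])

lemma fourier_L2_bq_integral_mult:
  assumes q: "L2_biquat lborel q" and \<psi>: "integrable lborel \<psi>" "square_integrable lborel \<psi>"
  shows "(LINT k|lborel. \<psi> k *s fourier_L2_bq q k) = (LINT x|lborel. fourier_L1 \<psi> x *s q x)"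
proof (rule biquat_integral_eqI)
  have [measurable]: "q \<in> borel_measurable borel" "\<psi> \<in> borel_measurable borel"
    using q \<psi> by (auto simp: L2_biquat_def)
  show "integrable lborel (\<lambda>k. \<psi> k *s fourier_L2_bq q k)"
    by (rule L2_biquat_scaled_integrable[OF \<psi>(2) L2_biquat_fourier[OF q]])
  show "integrable lborel (\<lambda>x. fourier_L1 \<psi> x *s q x)"
    by (rule L2_biquat_scaled_integrable[OF square_integrable_fourier_L1[OF \<psi>] q])
  fix j
  have "(LINT k|lborel. (\<psi> k *s fourier_L2_bq q k) $ j) = (LINT k|lborel. fourier_L2 (\<lambda>x. q x $ j) k * \<psi> k)"
    by (simp add: fourier_L2_bq_def mult.commute)
  also have "\<dots> = (LINT k|lebesgue. fourier_L2 (\<lambda>x. q x $ j) k * \<psi> k)"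
    by (rule integral_completion[symmetric]) measurable
  also have "\<dots> = (LINT x|lebesgue. q x $ j * fourier_L1 \<psi> x)"
    by (rule is_fourier_integral_mult[OF is_fourier_fourier_L2[OF L2_biquat_component[OF q]] \<psi>])
  also have "\<dots> = (LINT x|lborel. q x $ j * fourier_L1 \<psi> x)"
    by (rule integral_completion) measurable
  finally show "(LINT k|lborel. (\<psi> k *s fourier_L2_bq q k) $ j) = (LINT x|lborel. (fourier_L1 \<psi> x *s q x) $ j)"
    by (simp add: mult.commute)
qed

lemma fourier_L2_bq_parseval:
  assumes q: "L2_biquat lborel q" and h: "integrable lborel h" "square_integrable lborel h"
    and cont: "continuous_on UNIV h" and B: "\<And>x. norm (h x) \<le> B"
  shows "(LINT k|lborel. fourier_L1 h (- k) *s fourier_L2_bq q k) = (LINT x|lborel. h x *s q x)"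
proof (rule biquat_integral_eqI)
  have [measurable]: "q \<in> borel_measurable borel" "h \<in> borel_measurable borel"
    using q h by (auto simp: L2_biquat_def)
  show "integrable lborel (\<lambda>k. fourier_L1 h (- k) *s fourier_L2_bq q k)"
    by (rule L2_biquat_scaled_integrable[OF square_integrable_reflected_fourier_L1[OF h] L2_biquat_fourier[OF q]])
  show "integrable lborel (\<lambda>x. h x *s q x)"
    by (rule L2_biquat_scaled_integrable[OF h(2) q])
  fix j
  have "(LINT k|lborel. (fourier_L1 h (- k) *s fourier_L2_bq q k) $ j) = (LINT k|lborel. fourier_L2 (\<lambda>x. q x $ j) k * fourier_L1 h (- k))"
    by (simp add: fourier_L2_bq_def mult.commute)
  also have "\<dots> = (LINT k|lebesgue. fourier_L2 (\<lambda>x. q x $ j) k * fourier_L1 h (- k))"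
    by (rule integral_completion[symmetric]) measurable
  also have "\<dots> = (LINT x|lebesgue. q x $ j * h x)"
    by (rule is_fourier_parseval[OF is_fourier_fourier_L2[OF L2_biquat_component[OF q]] h cont B])
  also have "\<dots> = (LINT x|lborel. q x $ j * h x)"
    by (rule integral_completion) measurable
  finally show "(LINT k|lborel. (fourier_L1 h (- k) *s fourier_L2_bq q k) $ j) = (LINT x|lborel. (h x *s q x) $ j)"
    by (simp add: mult.commute)
qed

lemma fourier_L1_reflect:
  assumes [measurable]: "h \<in> borel_measurable borel"
  shows "fourier_L1 (\<lambda>x. h (- x)) k = fourier_L1 h (- k)"
proof -
  have "fourier_L1 (\<lambda>x. h (- x)) k = (LINT x|lborel. wave (- (- k)) (- x) * h (- x))"
    by (simp add: fourier_L1_eq wave_minus)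
  also have "\<dots> = (LINT x|lborel. wave (- (- k)) x * h x)"
    by (rule lborel_integral_uminus) measurable
  finally show ?thesis by (simp add: fourier_L1_eq)
qed

text \<open>
  The reflection that turns the transform into its inverse is moved onto \<open>\<psi>\<close>.
\<close>

lemma inv_fourier_L2_bq_integral_mult:
  assumes q: "L2_biquat lborel q" and \<psi>: "integrable lborel \<psi>" "square_integrable lborel \<psi>"
  shows "(LINT x|lborel. \<psi> x *s fourier_L2_bq q (- x)) = (LINT k|lborel. fourier_L1 \<psi> (- k) *s q k)"
proof -
  have [measurable]: "q \<in> borel_measurable borel" "\<psi> \<in> borel_measurable borel"
    using q \<psi> by (auto simp: L2_biquat_def)
  have \<psi>': "integrable lborel (\<lambda>x. \<psi> (- x))" "square_integrable lborel (\<lambda>x. \<psi> (- x))"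
    using integrable_lborel_uminus[OF \<psi>(1)] integrable_lborel_uminus[of "\<lambda>k. (cmod (\<psi> k))\<^sup>2"] \<psi>(2)
    by (auto simp: square_integrable_def)
  have "(LINT x|lborel. \<psi> x *s fourier_L2_bq q (- x)) = (LINT x|lborel. \<psi> (- x) *s fourier_L2_bq q x)"
    using lborel_integral_uminus[of "\<lambda>x. \<psi> x *s fourier_L2_bq q (- x)"] by simp
  also have "\<dots> = (LINT k|lborel. fourier_L1 \<psi> (- k) *s q k)"
    unfolding fourier_L2_bq_integral_mult[OF q \<psi>'] by (simp add: fourier_L1_reflect)
  finally show ?thesis .
qed

lemma indicator_scaleR_interval:
  fixes v :: "'a::real_vector"
  shows "indicator {a<..<b} s *\<^sub>R v = (if a < s \<and> s < b then v else 0)"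
  by (simp split: split_indicator)


section \<open>The Duhamel integral\<close>

text \<open>
  \<open>f0\<close> stands for a Borel version of \<open>- \<sigma> i w\<close>, extended by zero; the source is thus
  genuinely measurable and everything derived from it is Borel measurable.
\<close>

locale l2_source =
  fixes \<sigma> :: real and f0 :: "(real ^ 3) \<times> real \<Rightarrow> biquat"
  assumes sign: "\<sigma> \<in> {1, -1}" and f0_L2: "L2_biquat lborel f0"
begin

lemma f0_measurable [measurable]: "f0 \<in> borel_measurable (borel \<Otimes>\<^sub>M borel)"
  using f0_L2 by (simp add: L2_biquat_def borel_prod)

definition source_hat :: "real ^ 3 \<Rightarrow> real \<Rightarrow> biquat" where
  "source_hat k s = fourier_L2_bq (\<lambda>x. f0 (x, s)) k"

definition propagated :: "real ^ 3 \<Rightarrow> real \<Rightarrow> real \<Rightarrow> biquat" where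
  "propagated k s t = kexp \<sigma> k (t - s) \<odot> source_hat k s"

definition response :: "real \<Rightarrow> real \<Rightarrow> real ^ 3 \<Rightarrow> biquat" where
  "response t s x = fourier_L2_bq (\<lambda>k. propagated k s t) (- x)"

definition solution :: "(real ^ 3) \<times> real \<Rightarrow> biquat" where
  "solution p = (LINT s|lborel. indicator {0<..<snd p} s *\<^sub>R response (snd p) s (fst p))"

definition energy :: "real \<Rightarrow> ennreal" where
  "energy s = L2_mass lborel (\<lambda>x. f0 (x, s))"

abbreviation total_energy :: ennreal where
  "total_energy \<equiv> \<integral>\<^sup>+s. energy s \<partial>lborel"

lemma source_hat_measurable [measurable (raw)]:
  assumes [measurable]: "\<kappa> \<in> borel_measurable N" "\<tau> \<in> borel_measurable N"
  shows "(\<lambda>p. source_hat (\<kappa> p) (\<tau> p)) \<in> borel_measurable N"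
  unfolding source_hat_def by (rule fourier_L2_bq_measurable_param) measurable

lemma propagated_measurable [measurable (raw)]:
  assumes [measurable]: "\<kappa> \<in> borel_measurable N" "\<tau> \<in> borel_measurable N" "\<theta> \<in> borel_measurable N"
  shows "(\<lambda>p. propagated (\<kappa> p) (\<tau> p) (\<theta> p)) \<in> borel_measurable N"
  unfolding propagated_def by measurable

lemma response_measurable [measurable (raw)]:
  assumes [measurable]: "\<theta> \<in> borel_measurable N" "\<tau> \<in> borel_measurable N" "\<xi> \<in> borel_measurable N"
  shows "(\<lambda>p. response (\<theta> p) (\<tau> p) (\<xi> p)) \<in> borel_measurable N"
  unfolding response_def by (rule fourier_L2_bq_measurable_param) measurable

lemma solution_measurable [measurable]: "solution \<in> borel_measurable borel"
proof -
  have "solution \<in> borel_measurable (borel \<Otimes>\<^sub>M borel)"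
    unfolding solution_def[abs_def] indicator_scaleR_interval by measurable
  then show ?thesis by (simp add: borel_prod)
qed

lemma energy_measurable [measurable]: "energy \<in> borel_measurable borel"
  unfolding energy_def[abs_def] by measurable

lemma energy_finite: "total_energy < \<infinity>"
proof -
  have "total_energy = (\<integral>\<^sup>+p. ennreal ((norm (f0 p))\<^sup>2) \<partial>(lborel \<Otimes>\<^sub>M lborel))"
    unfolding energy_def by (rule lborel_pair.nn_integral_snd) measurable
  then show ?thesis using f0_L2 by (simp add: L2_biquat_def lborel_prod)
qed

lemma AE_energy_finite: "AE s in lborel. energy s < \<infinity>"
proof -
  have "AE s in lborel. energy s \<noteq> \<infinity>"
    using energy_finite by (intro nn_integral_PInf_AE) auto
  then show ?thesis by eventually_elim (simp add: less_top)
qed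

lemma L2_slice:
  assumes "energy s < \<infinity>"
  shows "L2_biquat lborel (\<lambda>x. f0 (x, s))"
  using assms unfolding L2_biquat_def energy_def by auto

lemma L2_source_hat:
  assumes "energy s < \<infinity>"
  shows "L2_biquat lborel (\<lambda>k. source_hat k s)"
    and "L2_mass lborel (\<lambda>k. source_hat k s) \<le> energy s"
  using L2_biquat_fourier[OF L2_slice[OF assms]] fourier_L2_bq_norm_le[OF L2_slice[OF assms]]
  by (simp_all add: source_hat_def energy_def)

lemma norm_propagated: "norm (propagated k s t) = norm (source_hat k s)"
  unfolding propagated_def by (rule norm_kexp_mult[OF sign])

lemma L2_propagated:
  assumes "energy s < \<infinity>"
  shows "L2_biquat lborel (\<lambda>k. propagated k s t)"
  using L2_source_hat(1)[OF assms] unfolding L2_biquat_def norm_propagated by simp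

lemma L2_response:
  assumes "energy s < \<infinity>"
  shows "L2_mass lborel (response t s) \<le> energy s"
proof -
  have "L2_mass lborel (response t s)
      = L2_mass lborel (fourier_L2_bq (\<lambda>k. propagated k s t))"
    unfolding response_def
    by (rule nn_integral_lborel_uminus[of "\<lambda>x. ennreal ((norm (fourier_L2_bq (\<lambda>k. propagated k s t) x))\<^sup>2)"]) measurable
  also have "\<dots> \<le> energy s"
    using order_trans[OF fourier_L2_bq_norm_le[OF L2_propagated[OF assms]]] L2_source_hat(2)[OF assms]
    by (simp add: norm_propagated)
  finally show ?thesis .
qed

lemma response_integral_mult:
  assumes "energy s < \<infinity>" and \<psi>: "integrable lborel \<psi>" "square_integrable lborel \<psi>"
  shows "(LINT x|lborel. \<psi> x *s response t s x) = (LINT k|lborel. fourier_L1 \<psi> (- k) *s propagated k s t)"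
  unfolding response_def by (rule inv_fourier_L2_bq_integral_mult[OF L2_propagated[OF assms(1)] \<psi>])

text \<open>
  All exponentials are isometric, so the squared \<open>L\<^sup>2\<close> norm in \<open>x\<close> of the response at time
  \<open>t\<close> to the source at time \<open>s\<close> is at most \<open>energy s\<close>.
\<close>

lemma nn_integral_response:
  "(\<integral>\<^sup>+x. \<integral>\<^sup>+s. ennreal (norm (indicator {0<..<t} s *\<^sub>R response t s x))^2 \<partial>lborel \<partial>lborel) \<le> total_energy"
proof -
  let ?g = "\<lambda>x s. ennreal (norm (indicator {0<..<t} s *\<^sub>R response t s x))^2"
  have "(\<integral>\<^sup>+x. \<integral>\<^sup>+s. ?g x s \<partial>lborel \<partial>lborel)
      = (\<integral>\<^sup>+s. \<integral>\<^sup>+x. ?g x s \<partial>lborel \<partial>lborel)"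
    by (rule lborel_pair.Fubini') measurable
  also have "\<dots> \<le> total_energy"
  proof (rule nn_integral_mono_AE)
    show "AE s in lborel. (\<integral>\<^sup>+x. ?g x s \<partial>lborel) \<le> energy s"
      using AE_energy_finite
    proof eventually_elim
      case (elim s)
      have "(\<integral>\<^sup>+x. ?g x s \<partial>lborel) \<le> L2_mass lborel (response t s)"
        by (intro nn_integral_mono) (auto simp: ennreal_power split: split_indicator)
      also have "\<dots> \<le> energy s" by (rule L2_response[OF elim])
      finally show ?case .
    qed
  qed
  finally show ?thesis .
qed

text \<open>
  On the bounded interval \<open>{0<..<t}\<close> square integrability in \<open>s\<close> implies integrability.
\<close>

lemma AE_response_integrable:
  "AE x in lborel. integrable lborel (\<lambda>s. indicator {0<..<t} s *\<^sub>R response t s x)"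
proof -
  let ?g = "\<lambda>x s. norm (indicator {0<..<t} s *\<^sub>R response t s x)"
  have "AE x in lborel. (\<integral>\<^sup>+s. ennreal (?g x s)^2 \<partial>lborel) \<noteq> \<infinity>"
    using nn_integral_response[of t] energy_finite
    by (intro nn_integral_PInf_AE) (auto dest: le_less_trans)
  then show ?thesis
  proof eventually_elim
    case (elim x)
    have "(\<integral>\<^sup>+s. ennreal (?g x s) \<partial>lborel)
        \<le> (\<integral>\<^sup>+s. indicator {0<..<t} s + ennreal (?g x s)^2 \<partial>lborel)"
    proof (rule nn_integral_mono)
      fix s
      have "ennreal (norm (response t s x)) \<le> ennreal (1 + (norm (response t s x))\<^sup>2)"
        using mult_le_sum_squares[of 1 "norm (response t s x)"] by (intro ennreal_leI) simp
      then show "ennreal (?g x s)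
          \<le> indicator {0<..<t} s + ennreal (?g x s)^2"
        by (auto simp: ennreal_power split: split_indicator)
    qed
    also have "\<dots> = emeasure lborel {0<..<t} + (\<integral>\<^sup>+s. ennreal (?g x s)^2 \<partial>lborel)"
      by (subst nn_integral_add) auto
    also have "\<dots> < \<infinity>"
      using elim by (cases "0 \<le> t") (auto simp: less_top)
    finally show ?case
      by (intro integrableI_bounded) auto
  qed
qed

end


section \<open>Existence and uniqueness of the Teodorescu transform\<close>

lemma fourier_bq_AE_eq:
  assumes q: "L2_biquat lborel q" and eq: "AE x in lborel. p x = q x"
  shows "AE k in lborel. fourier_bq p k = fourier_L2_bq q k"
proof -
  have "AE k in lborel. fourier (\<lambda>x. p x $ j) k = fourier_L2 (\<lambda>x. q x $ j) k" for j
  proof -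
    have F: "is_fourier (\<lambda>x. q x $ j) (fourier_L2 (\<lambda>x. q x $ j))"
      by (rule is_fourier_fourier_L2[OF L2_biquat_component[OF q]])
    have eqj: "AE x in lborel. p x $ j = q x $ j"
      using eq by eventually_elim simp
    have "is_fourier (\<lambda>x. p x $ j) (fourier_L2 (\<lambda>x. q x $ j))"
      by (rule is_fourier_cong_AE[OF F eqj]) simp
    from is_fourier_unique[OF is_fourier_fourier[OF this] F AE_completion[OF eqj]]
    show ?thesis by (simp add: AE_completion_iff)
  qed
  then have "AE k in lborel. \<forall>j. fourier (\<lambda>x. p x $ j) k = fourier_L2 (\<lambda>x. q x $ j) k"
    by (rule eventually_all_finite)
  then show ?thesis
    by eventually_elim (simp add: fourier_bq_def fourier_L2_bq_def)
qed

lemma lebesgue_equaliser_sets: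
  fixes g h :: "'a::euclidean_space \<Rightarrow> 'b::{real_normed_vector, second_countable_topology}"
  assumes A: "A \<in> sets lebesgue"
    and [measurable]: "g \<in> borel_measurable (lebesgue_on A)" "h \<in> borel_measurable (lebesgue_on A)"
  shows "{p. p \<in> A \<longrightarrow> g p = h p} \<in> sets lebesgue"
proof -
  have [measurable]: "(\<lambda>p. norm (g p - h p)) \<in> borel_measurable (lebesgue_on A)" by measurable
  have "{p \<in> space (lebesgue_on A). norm (g p - h p) = 0} \<in> sets (lebesgue_on A)"
    by measurable
  then have "{p \<in> A. g p = h p} \<in> sets lebesgue"
    using A by (simp add: sets_restrict_space_iff)
  moreover have "- A \<in> sets lebesgue" using A by (rule sets.compl_sets[of _ lebesgue, simplified, folded Compl_eq_Diff_UNIV])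
  ultimately have "- A \<union> {p \<in> A. g p = h p} \<in> sets lebesgue" by (rule sets.Un[rotated])
  also have "- A \<union> {p \<in> A. g p = h p} = {p. p \<in> A \<longrightarrow> g p = h p}" by auto
  finally show ?thesis .
qed

text \<open>
  At each time \<open>t\<close>, the jointly measurable representatives used for \<open>u\<close> and \<open>v\<close> agree for
  almost every \<open>s\<close> and then almost every \<open>x\<close>, hence, by joint measurability, in the other
  order of the quantifiers as well, so that their integrals over \<open>s\<close> agree. The same exchange in
  \<open>(x, t)\<close> then applies to \<open>u\<close> and \<open>v\<close> themselves.
\<close>

lemma is_teodorescu_unique:
  assumes u: "is_teodorescu \<Omega> \<sigma> f u" and v: "is_teodorescu \<Omega> \<sigma> f v"
  shows "AE p in lborel. p \<in> cyl UNIV \<longrightarrow> u p = v p"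
proof -
  have time_slice: "AE x in lborel. u (x, t) = v (x, t)" if t: "t > 0" for t
  proof -
    let ?I = "{0<..<t}"
    obtain h where h: "h \<in> borel_measurable (lebesgue_on (UNIV \<times> ?I))"
      "AE s in lebesgue_on ?I. AE x in lebesgue. h (x, s) = teodorescu_kernel \<Omega> \<sigma> f t s x"
      "AE x in lebesgue. set_integrable lebesgue ?I (\<lambda>s. h (x, s)) \<and> u (x, t) = (LINT s:?I|lebesgue. h (x, s))"
      using u t unfolding is_teodorescu_def by blast
    obtain h' where h': "h' \<in> borel_measurable (lebesgue_on (UNIV \<times> ?I))"
      "AE s in lebesgue_on ?I. AE x in lebesgue. h' (x, s) = teodorescu_kernel \<Omega> \<sigma> f t s x"
      "AE x in lebesgue. set_integrable lebesgue ?I (\<lambda>s. h' (x, s)) \<and> v (x, t) = (LINT s:?I|lebesgue. h' (x, s))"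
      using v t unfolding is_teodorescu_def by blast
    define S where "S = {p. p \<in> (UNIV :: (real^3) set) \<times> ?I \<longrightarrow> h p = h' p}"
    have "open ((UNIV :: (real^3) set) \<times> ?I)" by (intro open_Times) auto
    then have S: "S \<in> sets lebesgue"
      unfolding S_def by (intro lebesgue_equaliser_sets h h') auto
    have "AE s in lebesgue_on ?I. AE x in lebesgue. h (x, s) = h' (x, s)"
      using h(2) h'(2)
    proof eventually_elim
      case (elim s)
      then show ?case by eventually_elim simp
    qed
    then have "AE s in lborel. s \<in> ?I \<longrightarrow> (AE x in lborel. h (x, s) = h' (x, s))"
      by (subst (asm) AE_restrict_space_iff) (auto simp: AE_completion_iff)
    then have "AE s in lborel. AE x in lborel. (x, s) \<in> S"
      by eventually_elim (auto simp: S_def)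
    then have "AE p in lborel. p \<in> S" by (rule AE_lebesgue_from_slices[OF S])
    then have "AE x in lborel. AE s in lborel. (x, s) \<in> S" by (rule AE_lborel_slices(1))
    moreover have "AE x in lborel. set_integrable lebesgue ?I (\<lambda>s. h (x, s)) \<and> u (x, t) = (LINT s:?I|lebesgue. h (x, s))"
      using h(3) by (simp add: AE_completion_iff)
    moreover have "AE x in lborel. set_integrable lebesgue ?I (\<lambda>s. h' (x, s)) \<and> v (x, t) = (LINT s:?I|lebesgue. h' (x, s))"
      using h'(3) by (simp add: AE_completion_iff)
    ultimately show ?thesis
    proof eventually_elim
      case (elim x)
      have "(LINT s:?I|lebesgue. h (x, s)) = (LINT s:?I|lebesgue. h' (x, s))"
        unfolding set_lebesgue_integral_def
      proof (rule integral_cong_AE)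
        show "AE s in lebesgue. indicat_real ?I s *\<^sub>R h (x, s) = indicat_real ?I s *\<^sub>R h' (x, s)"
          using AE_completion[OF elim(1)] by eventually_elim (auto simp: S_def split: split_indicator)
      qed (use elim(2,3) in \<open>auto simp: set_integrable_def\<close>)
      with elim(2,3) show ?case by simp
    qed
  qed
  have "open (cyl UNIV)" unfolding cyl_def by (intro open_Times) auto
  then have "{p. p \<in> cyl UNIV \<longrightarrow> u p = v p} \<in> sets lebesgue"
    using u v by (intro lebesgue_equaliser_sets) (auto simp: is_teodorescu_def)
  moreover have "AE s in lborel. AE x in lborel. (x, s) \<in> {p. p \<in> cyl UNIV \<longrightarrow> u p = v p}"
  proof (rule AE_I2)
    fix s :: real
    show "AE x in lborel. (x, s) \<in> {p. p \<in> cyl UNIV \<longrightarrow> u p = v p}"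
    proof (cases "s > 0")
      case True
      from time_slice[OF this] show ?thesis by eventually_elim simp
    qed (simp add: cyl_def)
  qed
  ultimately show ?thesis
    using AE_lebesgue_from_slices[of "{p. p \<in> cyl UNIV \<longrightarrow> u p = v p}"] by simp
qed

context l2_source
begin

text \<open>
  The kernel transforms twice and each time picks an arbitrary representative. The first change
  of representative alters the argument of the second transform only on a null set.
\<close>

lemma response_eq_kernel:
  assumes eq: "AE p in lborel. zero_ext \<Omega> f p = f0 p"
  shows "AE s in lborel. AE x in lborel. response t s x = teodorescu_kernel \<Omega> \<sigma> f t s x"
  using AE_energy_finite AE_lborel_slices(2)[OF eq]
proof eventually_elim
  case (elim s)
  have "AE k in lborel. fourier_bq (\<lambda>x. zero_ext \<Omega> f (x, s)) k = source_hat k s"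
    unfolding source_hat_def by (rule fourier_bq_AE_eq[OF L2_slice[OF elim(1)] elim(2)])
  then have "AE k in lborel. kexp \<sigma> k (t - s) \<odot> fourier_bq (\<lambda>x. zero_ext \<Omega> f (x, s)) k = propagated k s t"
    by eventually_elim (simp add: propagated_def)
  from AE_lborel_uminus[OF fourier_bq_AE_eq[OF L2_propagated[OF elim(1)] this]]
  show ?case
    by eventually_elim (simp add: response_def teodorescu_kernel_def inv_fourier_bq_def)
qed

lemma solution_eq_set_integral:
  "solution (x, t) = (LINT s:{0<..<t}|lebesgue. response t s x)"
  unfolding solution_def set_lebesgue_integral_def
  by (subst integral_completion) auto

lemma is_teodorescu_solution:
  assumes eq: "AE p in lborel. zero_ext \<Omega> f p = f0 p"
  shows "is_teodorescu \<Omega> \<sigma> f solution"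
  unfolding is_teodorescu_def
proof (intro conjI allI impI)
  show "solution \<in> borel_measurable (lebesgue_on (cyl UNIV))"
    by (intro measurable_restrict_space1 measurable_completion) simp
  fix t :: real assume "t > 0"
  define h where "h = (\<lambda>p. response t (snd p) (fst p))"
  have "h \<in> borel_measurable (borel \<Otimes>\<^sub>M borel)" unfolding h_def by measurable
  then have "h \<in> borel_measurable (lebesgue_on (UNIV \<times> {0<..<t}))"
    by (intro measurable_restrict_space1 measurable_completion) (simp add: borel_prod)
  moreover have "AE s in lebesgue_on {0<..<t}. AE x in lebesgue. h (x, s) = teodorescu_kernel \<Omega> \<sigma> f t s x"
  proof (subst AE_restrict_space_iff)
    show "AE s in lebesgue. s \<in> {0<..<t} \<longrightarrow> (AE x in lebesgue. h (x, s) = teodorescu_kernel \<Omega> \<sigma> f t s x)"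
      using AE_completion[OF response_eq_kernel[OF eq, of t]]
      by eventually_elim (simp add: h_def AE_completion_iff)
  qed simp
  moreover have "AE x in lebesgue. set_integrable lebesgue {0<..<t} (\<lambda>s. h (x, s)) \<and>
      solution (x, t) = (LINT s:{0<..<t}|lebesgue. h (x, s))"
    using AE_completion[OF AE_response_integrable[of t]]
  proof eventually_elim
    case (elim x)
    then have "set_integrable lebesgue {0<..<t} (\<lambda>s. response t s x)"
      unfolding set_integrable_def by (subst integrable_completion) auto
    then show ?case by (simp add: h_def solution_eq_set_integral)
  qed
  ultimately show "\<exists>h. h \<in> borel_measurable (lebesgue_on (UNIV \<times> {0<..<t})) \<and>
      (AE s in lebesgue_on {0<..<t}. AE x in lebesgue. h (x, s) = teodorescu_kernel \<Omega> \<sigma> f t s x) \<and>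
      (AE x in lebesgue. set_integrable lebesgue {0<..<t} (\<lambda>s. h (x, s)) \<and>
          solution (x, t) = (LINT s:{0<..<t}|lebesgue. h (x, s)))"
    by blast
qed

end


section \<open>Pairing with compactly supported functions\<close>

text \<open>
  The class to which a test function on the upper half-space and its first derivatives belong;
  \<open>R\<close> and \<open>T\<close> are explicit so that one box serves all of them.
\<close>

definition box_supported :: "real \<Rightarrow> real \<Rightarrow> ((real ^ 3) \<times> real \<Rightarrow> real) \<Rightarrow> bool" where
  "box_supported R T \<psi> \<longleftrightarrow> continuous_on UNIV \<psi> \<and>
     (\<forall>x t. \<psi> (x, t) \<noteq> 0 \<longrightarrow> norm x \<le> R \<and> 0 < t \<and> t < T)"

text \<open>
  The sign makes this the inverse transform in space: it is what remains of the inverse transform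
  in the Teodorescu kernel once that is moved onto \<open>\<psi>\<close>.
\<close>

definition space_hat :: "((real ^ 3) \<times> real \<Rightarrow> real) \<Rightarrow> real ^ 3 \<Rightarrow> real \<Rightarrow> complex" where
  "space_hat \<psi> k t = fourier_L1 (\<lambda>x. complex_of_real (\<psi> (x, t))) (- k)"

abbreviation dir_deriv :: "('a::real_normed_vector \<Rightarrow> real) \<Rightarrow> 'a \<Rightarrow> 'a \<Rightarrow> real" where
  "dir_deriv \<phi> b \<equiv> \<lambda>p. frechet_derivative \<phi> (at p) b"

definition box_smooth :: "real \<Rightarrow> real \<Rightarrow> ((real ^ 3) \<times> real \<Rightarrow> real) \<Rightarrow> bool" where
  "box_smooth R T \<phi> \<longleftrightarrow> box_supported R T \<phi> \<and> (\<forall>b\<in>Basis. box_supported R T (dir_deriv \<phi> b)) \<and>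
     (\<forall>p. (\<phi> has_derivative frechet_derivative \<phi> (at p)) (at p))"

lemma box_smoothD:
  assumes "box_smooth R T \<phi>"
  shows "box_supported R T \<phi>"
    and "box_supported R T (dir_deriv \<phi> (axis j 1, 0))" "box_supported R T (dir_deriv \<phi> (0, 1))"
    and "(\<phi> has_derivative frechet_derivative \<phi> (at p)) (at p)"
proof -
  have "((axis j 1 :: real^3), 0 :: real) \<in> Basis" "((0 :: real^3), 1 :: real) \<in> Basis"
    by (simp_all add: Basis_prod_def axis_in_Basis_iff)
  with assms show "box_supported R T (dir_deriv \<phi> (axis j 1, 0))" "box_supported R T (dir_deriv \<phi> (0, 1))"
    by (auto simp: box_smooth_def)
qed (use assms in \<open>simp_all only: box_smooth_def\<close>)

lemma nn_integral_bounded_time: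
  fixes F :: "real \<Rightarrow> ennreal"
  assumes C: "C < \<infinity>" "\<And>t. 0 < t \<Longrightarrow> t < T \<Longrightarrow> F t \<le> C" and zero: "\<And>t. t \<le> 0 \<or> T \<le> t \<Longrightarrow> F t = 0"
  shows "(\<integral>\<^sup>+t. F t \<partial>lborel) < \<infinity>"
proof -
  have "F t \<le> C * indicator {0<..<T} t" for t
    using C(2)[of t] zero[of t] by (cases "t \<in> {0<..<T}") auto
  then have "(\<integral>\<^sup>+t. F t \<partial>lborel) \<le> (\<integral>\<^sup>+t. C * indicator {0<..<T} t \<partial>lborel)"
    by (rule nn_integral_mono)
  also have "\<dots> = C * emeasure lborel {0<..<T}"
    by (rule nn_integral_cmult_indicator) simp
  also have "\<dots> < \<infinity>"
  proof -
    have "emeasure lborel {0<..<T} < top" by (cases "0 \<le> T") auto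
    then show ?thesis using C(1) by (simp add: ennreal_mult_less_top)
  qed
  finally show ?thesis .
qed

lemma box_supported_bounded:
  assumes "box_supported R T \<psi>"
  obtains B where "0 \<le> B" "\<And>p. \<bar>\<psi> p\<bar> \<le> B"
proof -
  have cont: "continuous_on (cball 0 R \<times> {0..T}) \<psi>"
    using assms by (auto simp: box_supported_def intro: continuous_on_subset)
  have "compact ((cball 0 R :: (real^3) set) \<times> {0..T})" by (intro compact_Times) auto
  then have "bounded (\<psi> ` (cball 0 R \<times> {0..T}))"
    by (intro compact_imp_bounded compact_continuous_image[OF cont])
  then obtain B where B: "\<And>p. p \<in> cball 0 R \<times> {0..T} \<Longrightarrow> \<bar>\<psi> p\<bar> \<le> B"
    by (auto simp: bounded_iff)
  have "\<bar>\<psi> (x, t)\<bar> \<le> max B 0" for x t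
  proof (cases "\<psi> (x, t) = 0")
    case False
    then have "norm x \<le> R \<and> 0 < t \<and> t < T" using assms unfolding box_supported_def by blast
    then show ?thesis using B[of "(x, t)"] by simp
  qed simp
  then show thesis using that[of "max B 0"] by auto
qed

lemma box_supported_measurable:
  assumes "box_supported R T \<psi>"
  shows "\<psi> \<in> borel_measurable (borel \<Otimes>\<^sub>M borel)"
  using assms by (auto simp: box_supported_def borel_prod intro: borel_measurable_continuous_onI)

lemma box_supported_square_integrable:
  assumes \<psi>: "box_supported R T \<psi>"
  shows "square_integrable lborel (\<lambda>p. complex_of_real (\<psi> p))"
proof -
  let ?B = "(cball 0 R :: (real^3) set) \<times> {0..T}"
  have "continuous_on UNIV \<psi>" using \<psi> by (simp add: box_supported_def)
  then have "continuous_on ?B \<psi>" by (rule continuous_on_subset) simp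
  then have cont: "continuous_on ?B (\<lambda>p. (\<psi> p)\<^sup>2)" by (intro continuous_intros)
  have eq: "indicator ?B p *\<^sub>R (\<psi> p)\<^sup>2 = (\<psi> p)\<^sup>2" for p
  proof (cases p)
    case (Pair x t)
    have "p \<in> ?B" if "\<psi> p \<noteq> 0" using \<psi> that by (simp add: box_supported_def Pair less_imp_le)
    then show ?thesis by (cases "\<psi> p = 0") simp_all
  qed
  have "integrable lborel (\<lambda>p. (\<psi> p)\<^sup>2)"
    using borel_integrable_compact[OF compact_Times[OF compact_cball compact_Icc] cont] by (simp only: eq)
  then show ?thesis
    using box_supported_measurable[OF \<psi>] by (simp add: square_integrable_def borel_prod)
qed

lemma box_supported_slice:
  assumes \<psi>: "box_supported R T \<psi>"
  shows "integrable lborel (\<lambda>x. complex_of_real (\<psi> (x, t)))"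
    and "square_integrable lborel (\<lambda>x. complex_of_real (\<psi> (x, t)))"
    and "continuous_on UNIV (\<lambda>x. complex_of_real (\<psi> (x, t)))"
proof -
  note [measurable] = box_supported_measurable[OF \<psi>]
  have cont: "continuous_on UNIV (\<lambda>x. \<psi> (x, t))"
    using \<psi> unfolding box_supported_def
    by (intro continuous_on_compose2[of UNIV \<psi> UNIV "\<lambda>x. (x, t)"] continuous_intros) auto
  have int: "integrable lborel h" if h: "continuous_on UNIV h" "\<And>x. \<psi> (x, t) = 0 \<Longrightarrow> h x = 0" for h :: "real^3 \<Rightarrow> real"
  proof -
    have eq: "indicator (cball 0 R) x *\<^sub>R h x = h x" for x
      using \<psi> h(2)[of x] by (cases "\<psi> (x, t) = 0") (auto simp: box_supported_def)
    have "continuous_on (cball 0 R) h" using h(1) by (rule continuous_on_subset) simp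
    from borel_integrable_compact[OF compact_cball this] show ?thesis by (simp only: eq)
  qed
  show "integrable lborel (\<lambda>x. complex_of_real (\<psi> (x, t)))"
    using int[OF cont] by simp
  have "integrable lborel (\<lambda>x. (\<psi> (x, t))\<^sup>2)"
    using cont by (intro int continuous_intros) auto
  then show "square_integrable lborel (\<lambda>x. complex_of_real (\<psi> (x, t)))"
    by (simp add: square_integrable_def)
  show "continuous_on UNIV (\<lambda>x. complex_of_real (\<psi> (x, t)))"
    using cont by (rule continuous_on_of_real)
qed

lemma space_hat_eq:
  assumes "box_supported R T \<psi>"
  shows "space_hat \<psi> k t = (LINT x|lborel. wave k x * complex_of_real (\<psi> (x, t)))"
  unfolding space_hat_def using box_supported_slice(1)[OF assms] by (subst fourier_L1_eq) auto

lemma space_hat_measurable: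
  assumes \<psi>: "box_supported R T \<psi>" and [measurable]: "\<kappa> \<in> borel_measurable N" "\<tau> \<in> borel_measurable N"
  shows "(\<lambda>p. space_hat \<psi> (\<kappa> p) (\<tau> p)) \<in> borel_measurable N"
proof -
  note [measurable] = box_supported_measurable[OF \<psi>]
  show ?thesis unfolding space_hat_eq[OF \<psi>] by measurable
qed

lemma space_hat_eq_0:
  assumes \<psi>: "box_supported R T \<psi>" and t: "t \<le> 0 \<or> T \<le> t"
  shows "space_hat \<psi> k t = 0"
proof -
  have "\<psi> (x, t) = 0" for x using \<psi> t unfolding box_supported_def by force
  then show ?thesis by (simp add: space_hat_eq[OF \<psi>])
qed

lemma space_hat_norm_le:
  assumes \<psi>: "box_supported R T \<psi>"
  obtains M where "M < \<infinity>" "\<And>t. L2_mass lborel (\<lambda>k. space_hat \<psi> k t) \<le> M"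
    "\<And>t. (\<integral>\<^sup>+x. ennreal ((\<psi> (x, t))\<^sup>2) \<partial>lborel) \<le> M"
proof -
  obtain B where B: "0 \<le> B" "\<And>p. \<bar>\<psi> p\<bar> \<le> B" using box_supported_bounded[OF \<psi>] by blast
  note [measurable] = box_supported_measurable[OF \<psi>]
  define M where "M = ennreal (B\<^sup>2) * emeasure lborel (cball 0 R :: (real^3) set)"
  have 1: "(\<integral>\<^sup>+x. ennreal ((\<psi> (x, t))\<^sup>2) \<partial>lborel) \<le> M" for t
  proof -
    have "(\<integral>\<^sup>+x. ennreal ((\<psi> (x, t))\<^sup>2) \<partial>lborel) \<le> (\<integral>\<^sup>+x. ennreal (B\<^sup>2) * indicator (cball (0::real^3) R) x \<partial>lborel)"
    proof (rule nn_integral_mono)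
      fix x
      have "(\<psi> (x, t))\<^sup>2 \<le> B\<^sup>2" using B by (metis abs_le_square_iff abs_of_nonneg)
      moreover have "\<psi> (x, t) \<noteq> 0 \<Longrightarrow> norm x \<le> R" using \<psi> by (auto simp: box_supported_def)
      ultimately show "ennreal ((\<psi> (x, t))\<^sup>2) \<le> ennreal (B\<^sup>2) * indicator (cball 0 R) x"
        by (auto split: split_indicator intro: ennreal_leI)
    qed
    also have "\<dots> = M" unfolding M_def by (rule nn_integral_cmult_indicator) simp
    finally show ?thesis .
  qed
  moreover have "L2_mass lborel (\<lambda>k. space_hat \<psi> k t) \<le> M" for t
  proof -
    let ?g = "\<lambda>x. complex_of_real (\<psi> (x, t))"
    have "L2_mass lborel (\<lambda>k. space_hat \<psi> k t) = L2_mass lborel (\<lambda>k. fourier_L1 ?g k)"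
      unfolding space_hat_def by (rule nn_integral_lborel_uminus) measurable
    also have "\<dots> \<le> L2_mass lborel ?g"
      by (rule plancherel_le[OF box_supported_slice(1)[OF \<psi>]])
    also have "\<dots> \<le> M" using 1 by simp
    finally show ?thesis .
  qed
  moreover have "M < \<infinity>"
  proof -
    have "emeasure lborel (cball (0::real^3) R) < \<infinity>" by (intro emeasure_compact_finite) simp
    then show ?thesis by (simp add: M_def ennreal_mult_less_top)
  qed
  ultimately show thesis using that by blast
qed

context l2_source
begin

lemma nn_integral_source_hat:
  "L2_mass lborel (\<lambda>p. source_hat (fst p) (snd p)) \<le> total_energy"
proof -
  have "(\<integral>\<^sup>+p. ennreal ((norm (source_hat (fst p) (snd p)))\<^sup>2) \<partial>(lborel \<Otimes>\<^sub>M lborel))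
      = (\<integral>\<^sup>+s. \<integral>\<^sup>+k. ennreal ((norm (source_hat k s))\<^sup>2) \<partial>lborel \<partial>lborel)"
    by (subst lborel_pair.nn_integral_snd[symmetric]) auto
  also have "\<dots> \<le> total_energy"
    by (rule nn_integral_mono_AE) (use AE_energy_finite L2_source_hat(2) in \<open>auto elim!: eventually_mono\<close>)
  finally show ?thesis by (simp only: lborel_prod)
qed

lemma nn_integral_response_weighted:
  assumes [measurable]: "c \<in> borel_measurable borel"
    and C: "(\<integral>\<^sup>+x. ennreal ((c x)\<^sup>2) \<partial>lborel) \<le> C"
  shows "(\<integral>\<^sup>+x. \<integral>\<^sup>+s. ennreal (norm (c x *\<^sub>R indicator {0<..<t} s *\<^sub>R response t s x)) \<partial>lborel \<partial>lborel)
    \<le> C * ennreal t + total_energy"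
proof -
  let ?g = "\<lambda>x s. norm (c x *\<^sub>R indicator {0<..<t} s *\<^sub>R response t s x)"
  let ?h = "\<lambda>x s. ennreal (norm (indicator {0<..<t} s *\<^sub>R response t s x))^2"
  have "(\<integral>\<^sup>+x. \<integral>\<^sup>+s. ennreal (?g x s) \<partial>lborel \<partial>lborel)
      \<le> (\<integral>\<^sup>+x. \<integral>\<^sup>+s. ennreal ((c x)\<^sup>2) * indicator {0<..<t} s + ?h x s \<partial>lborel \<partial>lborel)"
  proof (intro nn_integral_mono)
    fix x s
    have "ennreal (\<bar>c x\<bar> * norm (response t s x)) \<le> ennreal ((c x)\<^sup>2 + (norm (response t s x))\<^sup>2)"
      using mult_le_sum_squares[of "\<bar>c x\<bar>" "norm (response t s x)"] by (intro ennreal_leI) simp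
    then show "ennreal (?g x s)
        \<le> ennreal ((c x)\<^sup>2) * indicator {0<..<t} s + ?h x s"
      by (auto simp: ennreal_power split: split_indicator)
  qed
  also have "\<dots> = (\<integral>\<^sup>+x. \<integral>\<^sup>+s. ennreal ((c x)\<^sup>2) * indicator {0<..<t} s \<partial>lborel \<partial>lborel)
      + (\<integral>\<^sup>+x. \<integral>\<^sup>+s. ?h x s \<partial>lborel \<partial>lborel)"
    by (subst nn_integral_add[symmetric]) (auto intro!: nn_integral_cong nn_integral_add)
  also have "(\<integral>\<^sup>+x. \<integral>\<^sup>+s. ennreal ((c x)\<^sup>2) * indicator {0<..<t} s \<partial>lborel \<partial>lborel)
      = (\<integral>\<^sup>+x. ennreal ((c x)\<^sup>2) \<partial>lborel) * emeasure lborel {0<..<t}"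
    by (simp add: nn_integral_cmult_indicator nn_integral_multc)
  also have "(\<integral>\<^sup>+x. ennreal ((c x)\<^sup>2) \<partial>lborel) * emeasure lborel {0<..<t}
      + (\<integral>\<^sup>+x. \<integral>\<^sup>+s. ?h x s \<partial>lborel \<partial>lborel)
      \<le> C * ennreal t + total_energy"
  proof (intro add_mono mult_mono C nn_integral_response)
    show "emeasure lborel {0<..<t} \<le> ennreal t" by (cases "0 \<le> t") auto
  qed auto
  finally show ?thesis .
qed

lemma nn_integral_solution_box:
  "(\<integral>\<^sup>+p. ennreal (norm (indicator (cball 0 R \<times> {0<..<T}) p *\<^sub>R solution p)) \<partial>lborel) < \<infinity>"
proof -
  let ?g = "\<lambda>p. norm (indicator (cball 0 R \<times> {0<..<T}) p *\<^sub>R solution p)"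
  define C where "C = emeasure lborel (cball 0 R :: (real^3) set)"
  have C: "C < \<infinity>" unfolding C_def by (intro emeasure_compact_finite) simp
  let ?c = "indicator (cball 0 R) :: real^3 \<Rightarrow> real"
  let ?r = "\<lambda>x t s. norm (?c x *\<^sub>R indicator {0<..<t} s *\<^sub>R response t s x)"
  have [measurable]: "cball (0::real^3) R \<in> sets borel" by simp
  have c2: "(\<integral>\<^sup>+x. ennreal ((?c x)\<^sup>2) \<partial>lborel) \<le> C"
  proof -
    have "ennreal ((?c x)\<^sup>2) = indicator (cball 0 R) x" for x by (simp split: split_indicator)
    then show ?thesis by (simp add: C_def)
  qed
  have [measurable]: "solution \<in> borel_measurable (borel \<Otimes>\<^sub>M borel)"
    using solution_measurable by (simp add: borel_prod)
  have "(\<integral>\<^sup>+p. ennreal (?g p) \<partial>(lborel \<Otimes>\<^sub>M lborel))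
      = (\<integral>\<^sup>+t. \<integral>\<^sup>+x. ennreal (?g (x, t)) \<partial>lborel \<partial>lborel)"
    by (rule lborel_pair.nn_integral_snd[symmetric]) measurable
  also have "\<dots> < \<infinity>"
  proof (rule nn_integral_bounded_time)
    show "C * ennreal T + total_energy < \<infinity>" using C energy_finite by (simp add: ennreal_mult_less_top)
    fix t assume t: "0 < t" "t < T"
    have "(\<integral>\<^sup>+x. ennreal (?g (x, t)) \<partial>lborel) \<le> (\<integral>\<^sup>+x. \<integral>\<^sup>+s. ennreal (?r x t s) \<partial>lborel \<partial>lborel)"
    proof (rule nn_integral_mono)
      fix x
      have "ennreal (norm (solution (x, t))) \<le> (\<integral>\<^sup>+s. ennreal (norm (indicat_real {0<..<t} s *\<^sub>R response t s x)) \<partial>lborel)"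
        unfolding solution_def fst_conv snd_conv by (rule ennreal_norm_integral_le)
      then show "ennreal (?g (x, t)) \<le> (\<integral>\<^sup>+s. ennreal (?r x t s) \<partial>lborel)"
        by (auto split: split_indicator)
    qed
    also have "\<dots> \<le> C * ennreal t + total_energy"
      by (rule nn_integral_response_weighted[OF _ c2]) measurable
    also have "\<dots> \<le> C * ennreal T + total_energy"
      using t by (intro add_mono mult_left_mono ennreal_leI) auto
    finally show "(\<integral>\<^sup>+x. ennreal (?g (x, t)) \<partial>lborel) \<le> C * ennreal T + total_energy" .
  qed auto
  finally show ?thesis by (simp only: lborel_prod)
qed

text \<open>
  The pairing of \<open>\<psi>\<close> with the Duhamel integral, written on the Fourier side before any
  integration. The frequency and the source time \<open>s\<close> are grouped because \<open>t\<close> is to be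
  integrated first.
\<close>

definition duhamel_integrand :: "((real ^ 3) \<times> real \<Rightarrow> real) \<Rightarrow> ((real ^ 3) \<times> real) \<times> real \<Rightarrow> biquat" where
  "duhamel_integrand \<psi> = (\<lambda>((k, s), t). if 0 < s \<and> s < t then space_hat \<psi> k t *s propagated k s t else 0)"

lemma duhamel_integrand_measurable:
  assumes "box_supported R T \<psi>"
  shows "duhamel_integrand \<psi> \<in> borel_measurable (lborel \<Otimes>\<^sub>M lborel)"
proof -
  have [measurable]: "(\<lambda>p. space_hat \<psi> (fst (fst p)) (snd p)) \<in> borel_measurable ((borel \<Otimes>\<^sub>M borel) \<Otimes>\<^sub>M borel)"
    by (rule space_hat_measurable[OF assms]) measurable
  have "duhamel_integrand \<psi> \<in> borel_measurable ((borel \<Otimes>\<^sub>M borel) \<Otimes>\<^sub>M borel)"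
    unfolding duhamel_integrand_def case_prod_beta by measurable
  then show ?thesis by (simp add: borel_prod lborel_prod)
qed

lemma duhamel_integrand_integrable:
  assumes \<psi>: "box_supported R T \<psi>"
  shows "integrable (lborel \<Otimes>\<^sub>M lborel) (duhamel_integrand \<psi>)"
proof (rule integrableI_bounded)
  note [measurable] = duhamel_integrand_measurable[OF \<psi>]
  show "duhamel_integrand \<psi> \<in> borel_measurable (lborel \<Otimes>\<^sub>M lborel)" by measurable
  obtain M where M: "M < \<infinity>" "\<And>t. L2_mass lborel (\<lambda>k. space_hat \<psi> k t) \<le> M"
    using space_hat_norm_le[OF \<psi>] by metis
  have [measurable]: "(\<lambda>p. space_hat \<psi> (fst p) t) \<in> borel_measurable (borel \<Otimes>\<^sub>M borel)"
    "(\<lambda>k. space_hat \<psi> k t) \<in> borel_measurable borel" for t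
    by (rule space_hat_measurable[OF \<psi>], measurable)+
  have "(\<integral>\<^sup>+q. ennreal (norm (duhamel_integrand \<psi> q)) \<partial>(lborel \<Otimes>\<^sub>M lborel))
      = (\<integral>\<^sup>+t. \<integral>\<^sup>+p. ennreal (norm (duhamel_integrand \<psi> (p, t))) \<partial>lborel \<partial>lborel)"
    by (rule lborel_pair.nn_integral_snd[symmetric]) measurable
  also have "\<dots> < \<infinity>"
  proof (rule nn_integral_bounded_time)
    show "M * ennreal T + total_energy < \<infinity>" using M(1) energy_finite by (simp add: ennreal_mult_less_top)
    fix t assume t: "0 < t" "t < T"
    have "(\<integral>\<^sup>+p. ennreal (norm (duhamel_integrand \<psi> (p, t))) \<partial>lborel)
        \<le> (\<integral>\<^sup>+p. ennreal ((cmod (space_hat \<psi> (fst p) t))\<^sup>2) * indicator {0<..<t} (snd p) + ennreal ((norm (source_hat (fst p) (snd p)))\<^sup>2) \<partial>lborel)"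
    proof (intro nn_integral_mono)
      fix p :: "(real^3) \<times> real"
      let ?a = "cmod (space_hat \<psi> (fst p) t)" and ?b = "norm (source_hat (fst p) (snd p))"
      have "ennreal (?a * ?b) \<le> ennreal (?a\<^sup>2 + ?b\<^sup>2)"
        by (intro ennreal_leI mult_le_sum_squares) auto
      then show "ennreal (norm (duhamel_integrand \<psi> (p, t))) \<le> ennreal (?a\<^sup>2) * indicator {0<..<t} (snd p) + ennreal (?b\<^sup>2)"
        by (cases p) (auto simp: duhamel_integrand_def norm_vector_scalar norm_propagated split: split_indicator)
    qed
    also have "\<dots> = (\<integral>\<^sup>+p. ennreal ((cmod (space_hat \<psi> (fst p) t))\<^sup>2) * indicator {0<..<t} (snd p) \<partial>lborel)
        + L2_mass lborel (\<lambda>p. source_hat (fst p) (snd p))"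
      unfolding lborel_prod[symmetric] by (rule nn_integral_add) measurable
    also have "(\<integral>\<^sup>+p. ennreal ((cmod (space_hat \<psi> (fst p) t))\<^sup>2) * indicator {0<..<t} (snd p) \<partial>lborel)
        = (\<integral>\<^sup>+k. \<integral>\<^sup>+s. ennreal ((cmod (space_hat \<psi> k t))\<^sup>2) * indicator {0<..<t} s \<partial>lborel \<partial>lborel)"
      unfolding lborel_prod[symmetric] by (subst lborel.nn_integral_fst[symmetric]) auto
    also have "\<dots> = L2_mass lborel (\<lambda>k. space_hat \<psi> k t) * ennreal t"
      using t by (simp add: nn_integral_cmult_indicator nn_integral_multc)
    also have "\<dots> + L2_mass lborel (\<lambda>p. source_hat (fst p) (snd p)) \<le> M * ennreal T + total_energy"
      using t
      by (intro add_mono mult_mono M nn_integral_source_hat ennreal_leI) auto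
    finally show "(\<integral>\<^sup>+p. ennreal (norm (duhamel_integrand \<psi> (p, t))) \<partial>lborel) \<le> M * ennreal T + total_energy" .
  next
    fix t assume "t \<le> 0 \<or> T \<le> t"
    then have "space_hat \<psi> k t = 0" for k by (rule space_hat_eq_0[OF \<psi>])
    then have "duhamel_integrand \<psi> (p, t) = 0" for p
      by (cases p) (simp add: duhamel_integrand_def vec_eq_iff)
    then show "(\<integral>\<^sup>+p. ennreal (norm (duhamel_integrand \<psi> (p, t))) \<partial>lborel) = 0" by simp
  qed
  finally show "(\<integral>\<^sup>+q. ennreal (norm (duhamel_integrand \<psi> q)) \<partial>(lborel \<Otimes>\<^sub>M lborel)) < \<infinity>" .
qed

end

lemma of_real_vector_scalar: "complex_of_real r *s (v :: biquat) = r *\<^sub>R v"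
  by (simp add: vec_eq_iff) (simp add: scaleR_conv_of_real)

lemma integral_scaleR_right_all:
  fixes f :: "'a \<Rightarrow> 'b::{banach, second_countable_topology}"
  shows "(LINT x|M. c *\<^sub>R f x) = c *\<^sub>R (LINT x|M. f x)"
proof (cases "c = 0 \<or> integrable M f")
  case False
  then have "\<not> integrable M (\<lambda>x. c *\<^sub>R f x)"
    using integrable_scaleR_right[of "inverse c" M "\<lambda>x. c *\<^sub>R f x"] by auto
  with False show ?thesis by (simp add: not_integrable_integral_eq)
qed auto

context l2_source
begin

lemma solution_box_integrable:
  assumes \<psi>: "box_supported R T \<psi>"
  shows "integrable lborel (\<lambda>p. \<psi> p *\<^sub>R solution p)"
proof -
  let ?J = "\<lambda>p. indicat_real (cball 0 R \<times> {0<..<T}) p *\<^sub>R solution p"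
  obtain B where B: "0 \<le> B" "\<And>p. \<bar>\<psi> p\<bar> \<le> B" using box_supported_bounded[OF \<psi>] by blast
  have [measurable]: "\<psi> \<in> borel_measurable borel" using box_supported_measurable[OF \<psi>] by (simp add: borel_prod)
  have "cball (0::real^3) R \<times> {0<..<T} \<in> sets borel"
    unfolding borel_prod[symmetric] by (intro pair_measureI) auto
  then have "integrable lborel ?J"
    using nn_integral_solution_box[of R T] by (intro integrableI_bounded) auto
  then have "integrable lborel (\<lambda>p. B *\<^sub>R ?J p)"
    by (rule integrable_scaleR_right)
  then show ?thesis
  proof (rule Bochner_Integration.integrable_bound)
    have "norm (\<psi> (x, t) *\<^sub>R solution (x, t)) \<le> norm (B *\<^sub>R ?J (x, t))" for x t
    proof (cases "\<psi> (x, t) = 0")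
      case False
      then have "norm x \<le> R \<and> 0 < t \<and> t < T" using \<psi> unfolding box_supported_def by blast
      then show ?thesis using B by (simp add: mult_right_mono)
    qed simp
    then show "AE p in lborel. norm (\<psi> p *\<^sub>R solution p) \<le> norm (B *\<^sub>R ?J p)"
      by auto
  qed measurable
qed

lemma weighted_response_integrable:
  assumes \<psi>: "box_supported R T \<psi>"
  shows "integrable (lborel \<Otimes>\<^sub>M lborel) (\<lambda>(x, s). \<psi> (x, t) *\<^sub>R indicator {0<..<t} s *\<^sub>R response t s x)"
proof (rule integrableI_bounded)
  note [measurable] = box_supported_measurable[OF \<psi>]
  obtain M where M: "M < \<infinity>" "\<And>t. (\<integral>\<^sup>+x. ennreal ((\<psi> (x, t))\<^sup>2) \<partial>lborel) \<le> M"
    using space_hat_norm_le[OF \<psi>] by metis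
  let ?g = "\<lambda>(x, s). \<psi> (x, t) *\<^sub>R indicator {0<..<t} s *\<^sub>R response t s x"
  show g: "?g \<in> borel_measurable (lborel \<Otimes>\<^sub>M lborel)" by measurable
  have "(\<integral>\<^sup>+q. ennreal (norm (?g q)) \<partial>(lborel \<Otimes>\<^sub>M lborel))
      = (\<integral>\<^sup>+x. \<integral>\<^sup>+s. ennreal (norm (\<psi> (x, t) *\<^sub>R indicator {0<..<t} s *\<^sub>R response t s x)) \<partial>lborel \<partial>lborel)"
    using g by (subst lborel.nn_integral_fst[symmetric]) auto
  also have "\<dots> \<le> M * ennreal t + total_energy"
    by (rule nn_integral_response_weighted[OF _ M(2)]) measurable
  also have "\<dots> < \<infinity>" using M(1) energy_finite by (simp add: ennreal_mult_less_top)
  finally show "(\<integral>\<^sup>+q. ennreal (norm (?g q)) \<partial>(lborel \<Otimes>\<^sub>M lborel)) < \<infinity>" .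
qed

lemma weighted_solution_slice:
  assumes \<psi>: "box_supported R T \<psi>" and int: "integrable lborel (\<lambda>p. duhamel_integrand \<psi> (p, t))"
  shows "(LINT x|lborel. \<psi> (x, t) *\<^sub>R solution (x, t)) = (LINT p|lborel. duhamel_integrand \<psi> (p, t))"
proof -
  note [measurable] = box_supported_measurable[OF \<psi>]
  let ?g = "\<lambda>x s. \<psi> (x, t) *\<^sub>R indicat_real {0<..<t} s *\<^sub>R response t s x"
  note g = weighted_response_integrable[OF \<psi>, of t]
  have "duhamel_integrand \<psi> \<in> borel_measurable ((borel \<Otimes>\<^sub>M borel) \<Otimes>\<^sub>M borel)"
    using duhamel_integrand_measurable[OF \<psi>] by (simp add: borel_prod lborel_prod)
  then have [measurable]: "(\<lambda>(s, k). duhamel_integrand \<psi> ((k, s), t)) \<in> borel_measurable (borel \<Otimes>\<^sub>M borel)"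
    by measurable
  have "(LINT x|lborel. \<psi> (x, t) *\<^sub>R solution (x, t)) = (LINT x|lborel. LINT s|lborel. ?g x s)"
    by (simp only: solution_def integral_scaleR_right_all fst_conv snd_conv)
  also have "\<dots> = (LINT s|lborel. LINT x|lborel. ?g x s)"
    by (rule lborel_pair.Fubini_integral[OF g, symmetric])
  also have "\<dots> = (LINT s|lborel. LINT k|lborel. duhamel_integrand \<psi> ((k, s), t))"
  proof (rule integral_cong_AE)
    show "AE s in lborel. (LINT x|lborel. ?g x s) = (LINT k|lborel. duhamel_integrand \<psi> ((k, s), t))"
      using AE_energy_finite
    proof eventually_elim
      case (elim s)
      show ?case
      proof (cases "0 < s \<and> s < t")
        case True
        then have "(LINT x|lborel. ?g x s) = (LINT x|lborel. complex_of_real (\<psi> (x, t)) *s response t s x)"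
          by (simp add: of_real_vector_scalar)
        also have "\<dots> = (LINT k|lborel. space_hat \<psi> k t *s propagated k s t)"
          unfolding space_hat_def by (rule response_integral_mult[OF elim box_supported_slice(1,2)[OF \<psi>]])
        finally show ?thesis using True by (simp add: duhamel_integrand_def)
      next
        case False
        then have "indicat_real {0<..<t} s = 0" by auto
        moreover have "duhamel_integrand \<psi> ((k, s), t) = 0" for k
          using False by (auto simp: duhamel_integrand_def)
        ultimately show ?thesis by simp
      qed
    qed
  qed measurable
  also have "\<dots> = (LINT p|lborel. duhamel_integrand \<psi> (p, t))"
  proof -
    have "integrable (lborel \<Otimes>\<^sub>M lborel) (\<lambda>(k, s). duhamel_integrand \<psi> ((k, s), t))"
      using int by (simp add: lborel_prod split_beta')
    from lborel_pair.integral_snd[OF this] show ?thesis by (simp add: lborel_prod split_beta')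
  qed
  finally show ?thesis .
qed

text \<open>
  At a fixed time \<open>t\<close>, exchange the integrals over \<open>x\<close> and \<open>s\<close> and move the transform onto
  \<open>\<psi>\<close>; then integrate over \<open>t\<close>.
\<close>

lemma weighted_solution_integral:
  assumes \<psi>: "box_supported R T \<psi>"
  shows "(LINT p|lborel. \<psi> p *\<^sub>R solution p) = integral\<^sup>L (lborel \<Otimes>\<^sub>M lborel) (duhamel_integrand \<psi>)"
proof -
  have int: "integrable (lborel \<Otimes>\<^sub>M lborel) (\<lambda>(x, t). \<psi> (x, t) *\<^sub>R solution (x, t))"
    using solution_box_integrable[OF \<psi>] by (simp add: lborel_prod split_beta')
  have D: "integrable (lborel \<Otimes>\<^sub>M lborel) (\<lambda>(p, t). duhamel_integrand \<psi> (p, t))"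
    using duhamel_integrand_integrable[OF \<psi>] by simp
  note [measurable] = borel_measurable_integrable[OF int] borel_measurable_integrable[OF D]
  have "(LINT p|lborel. \<psi> p *\<^sub>R solution p) = (LINT t|lborel. LINT x|lborel. \<psi> (x, t) *\<^sub>R solution (x, t))"
    using lborel_pair.integral_snd[OF int] by (simp add: lborel_prod split_beta')
  also have "\<dots> = (LINT t|lborel. LINT p|lborel. duhamel_integrand \<psi> (p, t))"
  proof (rule integral_cong_AE)
    show "AE t in lborel. (LINT x|lborel. \<psi> (x, t) *\<^sub>R solution (x, t)) = (LINT p|lborel. duhamel_integrand \<psi> (p, t))"
      using lborel_pair.AE_integrable_snd[OF D] by eventually_elim (rule weighted_solution_slice[OF \<psi>])
    show "(\<lambda>t. LINT x|lborel. \<psi> (x, t) *\<^sub>R solution (x, t)) \<in> borel_measurable lborel"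
      by (rule borel_measurable_integrable[OF lborel_pair.integrable_snd[OF int]])
    show "(\<lambda>t. LINT p|lborel. duhamel_integrand \<psi> (p, t)) \<in> borel_measurable lborel"
      by (rule borel_measurable_integrable[OF lborel_pair.integrable_snd[OF D]])
  qed
  also have "\<dots> = integral\<^sup>L (lborel \<Otimes>\<^sub>M lborel) (duhamel_integrand \<psi>)"
    using lborel_pair.integral_snd[OF D] by simp
  finally show ?thesis .
qed

end


section \<open>Derivatives of test functions on the Fourier side\<close>

text \<open>
  \<open>G(x + b) - G(x)\<close> is the integral of \<open>G'(x + \<tau> b)\<close> over \<open>\<tau>\<close> in \<open>[0, 1]\<close>. Integrating over
  \<open>x\<close>, translation invariance makes the left-hand side vanish and the right-hand side the
  integral of \<open>G'\<close>.
\<close>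

lemma integral_directional_derivative_eq_0:
  fixes G G' :: "'a::euclidean_space \<Rightarrow> 'b::euclidean_space"
  assumes G: "integrable lborel G" and G': "integrable lborel G'" and cont: "continuous_on UNIV G'"
    and deriv: "\<And>x \<tau>. ((\<lambda>\<tau>. G (x + \<tau> *\<^sub>R b)) has_vector_derivative G' (x + \<tau> *\<^sub>R b)) (at \<tau>)"
  shows "(LINT x|lborel. G' x) = 0"
proof -
  let ?g = "\<lambda>\<tau> x. indicat_real {0..1} \<tau> *\<^sub>R G' (x + \<tau> *\<^sub>R b)"
  have [measurable]: "G \<in> borel_measurable borel" "G' \<in> borel_measurable borel" using G G' by auto
  have shift: "integrable lborel (\<lambda>x. H (x + v))" "(LINT x|lborel. H (x + v)) = (LINT x|lborel. H x)"
    if "integrable lborel H" for H :: "'a \<Rightarrow> 'c::{banach, second_countable_topology}" and v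
    using integrable_lborel_affine[OF that, of 1 v] lborel_integral_affine[of H 1 v] that
    by (simp_all add: add.commute)
  have ftc: "(LINT \<tau>|lborel. ?g \<tau> x) = G (x + b) - G x" for x
  proof -
    have "has_bochner_integral lborel (\<lambda>\<tau>. ?g \<tau> x) (G (x + 1 *\<^sub>R b) - G (x + 0 *\<^sub>R b))"
    proof (rule has_bochner_integral_FTC_Icc)
      show "((\<lambda>\<tau>. G (x + \<tau> *\<^sub>R b)) has_vector_derivative G' (x + \<tau> *\<^sub>R b)) (at \<tau> within {0..1})" for \<tau>
        by (rule has_vector_derivative_at_within[OF deriv])
      show "continuous_on {0..1} (\<lambda>\<tau>. G' (x + \<tau> *\<^sub>R b))"
        by (intro continuous_on_compose2[OF cont] continuous_intros) auto
    qed simp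
    then show ?thesis by (simp add: has_bochner_integral_integral_eq)
  qed
  have int: "integrable (lborel \<Otimes>\<^sub>M lborel) (\<lambda>(\<tau>, x). ?g \<tau> x)"
  proof (rule lborel_pair.Fubini_integrable)
    have "(LINT x|lborel. norm (G' (x + \<tau> *\<^sub>R b))) = (LINT x|lborel. norm (G' x))" for \<tau>
      by (rule shift(2)[OF integrable_norm[OF G']])
    then have "(\<lambda>\<tau>. LINT x|lborel. norm (case (\<tau>, x) of (\<tau>, x) \<Rightarrow> ?g \<tau> x))
        = (\<lambda>\<tau>. indicator {0..1} \<tau> * (LINT x|lborel. norm (G' x)))"
      by (auto simp: fun_eq_iff)
    then show "integrable lborel (\<lambda>\<tau>. LINT x|lborel. norm (case (\<tau>, x) of (\<tau>, x) \<Rightarrow> ?g \<tau> x))"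
      by simp
  qed (auto intro!: shift(1) G')
  have "0 = (LINT x|lborel. G (x + b)) - (LINT x|lborel. G x)"
    using shift(2)[OF G] by simp
  also have "\<dots> = (LINT x|lborel. G (x + b) - G x)"
    by (rule Bochner_Integration.integral_diff[OF shift(1)[OF G] G, symmetric])
  also have "\<dots> = (LINT x|lborel. LINT \<tau>|lborel. ?g \<tau> x)"
    by (simp add: ftc)
  also have "\<dots> = (LINT \<tau>|lborel. LINT x|lborel. ?g \<tau> x)"
    by (rule lborel_pair.Fubini_integral[OF int])
  also have "\<dots> = (LINT \<tau>|lborel. indicator {0..1::real} \<tau> *\<^sub>R (LINT x|lborel. G' x))"
    by (simp add: integral_scaleR_right_all shift(2)[OF G'])
  also have "\<dots> = (LINT x|lborel. G' x)"
    by (simp add: Bochner_Integration.integral_scaleR_left)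
  finally show ?thesis by simp
qed

lemma has_vector_derivative_along_line:
  fixes \<phi> :: "'a::real_normed_vector \<Rightarrow> 'b::real_normed_vector"
  assumes D: "(\<phi> has_derivative D) (at (a + \<tau> *\<^sub>R v))"
  shows "((\<lambda>\<tau>. \<phi> (a + \<tau> *\<^sub>R v)) has_vector_derivative D v) (at \<tau>)"
proof -
  have "((\<lambda>\<tau>. a + \<tau> *\<^sub>R v) has_derivative (\<lambda>h. h *\<^sub>R v)) (at \<tau>)"
    by (auto intro!: derivative_eq_intros)
  from has_derivative_compose[OF this D]
  have "((\<lambda>\<tau>. \<phi> (a + \<tau> *\<^sub>R v)) has_derivative (\<lambda>h. D (h *\<^sub>R v))) (at \<tau>)" .
  moreover have "(\<lambda>h. D (h *\<^sub>R v)) = (\<lambda>h. h *\<^sub>R D v)"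
    using has_derivative_linear[OF D] by (simp add: linear_scale)
  ultimately show ?thesis by (simp add: has_vector_derivative_def)
qed

lemma compact_half_space_box:
  fixes K :: "((real ^ 3) \<times> real) set"
  assumes K: "compact K" "K \<subseteq> UNIV \<times> {0<..}"
  obtains R T where "K \<subseteq> cball 0 R \<times> {0<..<T}"
proof -
  obtain B where B: "\<And>p. p \<in> K \<Longrightarrow> norm p \<le> B"
    using compact_imp_bounded[OF K(1)] by (auto simp: bounded_iff)
  have "norm x \<le> B \<and> 0 < t \<and> t < B + 1" if "(x, t) \<in> K" for x t
    using B[OF that] K(2) that norm_fst_le[of x t] norm_snd_le[of t x] by auto
  then have "K \<subseteq> cball 0 B \<times> {0<..<B + 1}" by auto
  then show thesis by (rule that)
qed

lemma test_function_box_smooth: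
  fixes \<phi> :: "(real ^ 3) \<times> real \<Rightarrow> real"
  assumes \<phi>: "test_function (UNIV \<times> {0<..}) \<phi>"
  obtains R T where "box_smooth R T \<phi>"
proof -
  define K where "K = closure {p. \<phi> p \<noteq> 0}"
  have K: "compact K" "K \<subseteq> UNIV \<times> {0<..}" and smooth: "\<And>n. cont_diff n \<phi>"
    using \<phi> by (auto simp: test_function_def K_def)
  have deriv: "(\<phi> has_derivative frechet_derivative \<phi> (at p)) (at p)" for p
    using smooth[of "Suc 0"] by (cases p) (simp add: frechet_derivative_works)
  obtain R T where "K \<subseteq> cball 0 R \<times> {0<..<T}" using compact_half_space_box[OF K] .
  then have box: "norm x \<le> R \<and> 0 < t \<and> t < T" if "(x, t) \<in> K" for x t
    using that by auto
  have outside: "\<phi> p = 0 \<and> frechet_derivative \<phi> (at p) = (\<lambda>_. 0)" if "p \<notin> K" for p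
  proof
    show "\<phi> p = 0" using that closure_subset[of "{p. \<phi> p \<noteq> 0}"] by (auto simp: K_def)
    have "((\<lambda>_. 0) has_derivative frechet_derivative \<phi> (at p)) (at p)"
    proof (rule has_derivative_transform_within_open[OF deriv])
      show "open (- K)" using K(1) by (simp add: compact_imp_closed open_Compl)
      show "p \<in> - K" using that by simp
      show "\<phi> q = 0" if "q \<in> - K" for q
        using that closure_subset[of "{p. \<phi> p \<noteq> 0}"] by (auto simp: K_def)
    qed
    then show "frechet_derivative \<phi> (at p) = (\<lambda>_. 0)"
      using has_derivative_unique has_derivative_const by metis
  qed
  have "box_supported R T \<phi>"
    using smooth[of 0] outside box by (auto simp: box_supported_def)
  moreover have "box_supported R T (dir_deriv \<phi> b)" if "b \<in> Basis" for b
  proof -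
    have "continuous_on UNIV (dir_deriv \<phi> b)"
      using smooth[of "Suc 0"] that by simp
    moreover have "(x, t) \<in> K" if "frechet_derivative \<phi> (at (x, t)) b \<noteq> 0" for x t
      using outside[of "(x, t)"] that by (cases "(x, t) \<in> K") auto
    ultimately show ?thesis using box by (auto simp: box_supported_def)
  qed
  ultimately show thesis
    using deriv that unfolding box_smooth_def by blast
qed

lemma wave_along_line: "wave k (x + \<tau> *\<^sub>R b) = wave k x * exp (\<tau> *\<^sub>R (2 * pi * \<i> * (k \<bullet> b)))"
  by (simp add: wave_add) (simp add: wave_def cis_conv_exp scaleR_conv_of_real[where 'a = complex] mult_ac)

text \<open>
  Integration by parts: the derivative of \<open>wave k x * \<phi> (x, t)\<close> in the direction \<open>b\<close> has integral
  zero.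
\<close>

lemma space_hat_space_derivative:
  assumes \<phi>: "box_supported R T \<phi>" and \<phi>': "box_supported R T (dir_deriv \<phi> (b, 0))"
    and deriv: "\<And>p. (\<phi> has_derivative frechet_derivative \<phi> (at p)) (at p)"
  shows "space_hat (dir_deriv \<phi> (b, 0)) k t = - (2 * pi * \<i> * (k \<bullet> b)) * space_hat \<phi> k t"
proof -
  let ?d = "dir_deriv \<phi> (b, 0)"
  let ?c = "2 * pi * \<i> * complex_of_real (k \<bullet> b)"
  define G where "G x = wave k x * complex_of_real (\<phi> (x, t))" for x
  define G' where "G' x = wave k x * complex_of_real (?d (x, t)) + ?c * (wave k x * complex_of_real (\<phi> (x, t)))" for x
  note I = integrable_wave_mult[OF box_supported_slice(1)[OF \<phi>]] integrable_wave_mult[OF box_supported_slice(1)[OF \<phi>']]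
  have "(LINT x|lborel. G' x) = 0"
  proof (rule integral_directional_derivative_eq_0[where G = G and b = b])
    show "integrable lborel G" unfolding G_def by (rule I)
    show "integrable lborel G'" unfolding G'_def
      by (intro Bochner_Integration.integrable_add integrable_mult_right I)
    show "continuous_on UNIV G'"
      unfolding G'_def by (intro continuous_intros box_supported_slice(3)[OF \<phi>] box_supported_slice(3)[OF \<phi>'])
    fix x \<tau>
    have 1: "((\<lambda>\<tau>. wave k (x + \<tau> *\<^sub>R b)) has_vector_derivative ?c * wave k (x + \<tau> *\<^sub>R b)) (at \<tau>)"
      unfolding wave_along_line
      using has_vector_derivative_mult_right[OF exp_scaleR_has_vector_derivative_right[of ?c \<tau> UNIV], of "wave k x"]
      by (simp add: mult_ac)
    have "((\<lambda>\<tau>. \<phi> ((x, t) + \<tau> *\<^sub>R (b, 0))) has_vector_derivative ?d ((x, t) + \<tau> *\<^sub>R (b, 0))) (at \<tau>)"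
      by (rule has_vector_derivative_along_line[OF deriv])
    then have 2: "((\<lambda>\<tau>. complex_of_real (\<phi> (x + \<tau> *\<^sub>R b, t))) has_vector_derivative complex_of_real (?d (x + \<tau> *\<^sub>R b, t))) (at \<tau>)"
      by (intro bounded_linear.has_vector_derivative[OF bounded_linear_of_real]) simp
    show "((\<lambda>\<tau>. G (x + \<tau> *\<^sub>R b)) has_vector_derivative G' (x + \<tau> *\<^sub>R b)) (at \<tau>)"
      unfolding G_def G'_def using has_vector_derivative_mult[OF 1 2] by (simp add: mult_ac)
  qed
  then have "space_hat ?d k t + ?c * space_hat \<phi> k t = 0"
    unfolding space_hat_eq[OF \<phi>] space_hat_eq[OF \<phi>'] G'_def
    by (subst (asm) Bochner_Integration.integral_add) (auto intro: I)
  then show ?thesis by (simp add: eq_neg_iff_add_eq_0)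
qed

lemma space_hat_eq_integral:
  assumes \<psi>: "box_supported R T \<psi>" and sub: "cball 0 R \<subseteq> cbox a b"
  shows "space_hat \<psi> k t = integral (cbox a b) (\<lambda>x. wave k x * complex_of_real (\<psi> (x, t)))"
proof -
  let ?F = "\<lambda>x. wave k x * complex_of_real (\<psi> (x, t))"
  have F: "integrable lborel ?F" by (rule integrable_wave_mult[OF box_supported_slice(1)[OF \<psi>]])
  have ind: "indicat_real (cbox a b) x *\<^sub>R ?F x = ?F x" for x
  proof (cases "\<psi> (x, t) = 0")
    case False
    then have "norm x \<le> R" using \<psi> unfolding box_supported_def by blast
    then have "x \<in> cbox a b" using sub by auto
    then show ?thesis by simp
  qed simp
  have "set_integrable lborel (cbox a b) ?F"
    unfolding set_integrable_def ind by (rule F)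
  from set_borel_integral_eq_integral(2)[OF this]
  show ?thesis unfolding space_hat_eq[OF \<psi>] set_lebesgue_integral_def ind .
qed

lemma space_hat_time_derivative:
  assumes smooth: "box_smooth R T \<phi>"
  shows "((\<lambda>t. space_hat \<phi> k t) has_vector_derivative
    space_hat (dir_deriv \<phi> (0, 1)) k t) (at t)"
proof -
  note \<phi> = box_smoothD(1)[OF smooth] and \<phi>' = box_smoothD(3)[OF smooth] and deriv = box_smoothD(4)[OF smooth]
  let ?d = "dir_deriv \<phi> (0, 1)"
  obtain a where a: "cball (0::real^3) R \<subseteq> cbox (- a) a"
    using bounded_subset_cbox_symmetric[OF bounded_cball] by blast
  have "((\<lambda>t. integral (cbox (- a) a) (\<lambda>x. wave k x * complex_of_real (\<phi> (x, t)))) has_vector_derivative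
      integral (cbox (- a) a) (\<lambda>x. wave k x * complex_of_real (?d (x, t)))) (at t within UNIV)"
  proof (rule leibniz_rule_vector_derivative)
    fix t x
    have "((\<lambda>\<tau>. \<phi> ((x, 0) + \<tau> *\<^sub>R (0, 1))) has_vector_derivative ?d ((x, 0) + t *\<^sub>R (0, 1))) (at t)"
      by (rule has_vector_derivative_along_line[OF deriv])
    then have "((\<lambda>\<tau>. \<phi> (x, \<tau>)) has_vector_derivative ?d (x, t)) (at t)" by simp
    from bounded_linear.has_vector_derivative[OF bounded_linear_of_real this]
    show "((\<lambda>t. wave k x * complex_of_real (\<phi> (x, t))) has_vector_derivative wave k x * complex_of_real (?d (x, t))) (at t within UNIV)"
      by (rule has_vector_derivative_mult_right)
  next
    fix t
    show "(\<lambda>x. wave k x * complex_of_real (\<phi> (x, t))) integrable_on cbox (- a) a"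
      by (intro integrable_continuous continuous_intros
          continuous_on_subset[OF box_supported_slice(3)[OF \<phi>]]) auto
  next
    have "continuous_on UNIV ?d" using \<phi>' by (simp add: box_supported_def)
    then have "continuous_on (UNIV \<times> cbox (- a) a) (\<lambda>p. wave k (snd p) * complex_of_real (?d (snd p, fst p)))"
      by (intro continuous_intros continuous_on_compose2[of UNIV ?d _ "\<lambda>p. (snd p, fst p)"]) auto
    then show "continuous_on (UNIV \<times> cbox (- a) a) (\<lambda>(t, x). wave k x * complex_of_real (?d (x, t)))"
      by (simp add: split_beta')
  qed auto
  then show ?thesis
    by (simp add: space_hat_eq_integral[OF \<phi> a] space_hat_eq_integral[OF \<phi>' a])
qed


section \<open>The distributional equation\<close>

lemma vecq_square: "vecq k \<odot> vecq k = - ((norm k)\<^sup>2 *\<^sub>R bq_one)"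
proof -
  have norm2: "(norm k)\<^sup>2 = (k $ 1)\<^sup>2 + (k $ 2)\<^sup>2 + (k $ 3)\<^sup>2"
    by (simp add: norm_vec_def L2_set_def sum_3)
  show ?thesis
    unfolding norm2
    by (simp add: biquat_eq_iff bq_mult_def vecq_def bq_one_def e1_def e2_def e3_def)
       (simp add: scaleR_conv_of_real power2_eq_square)
qed

text \<open>
  The differential equation of the quaternionic exponential, from \<open>k\<^sup>2 = - |k|\<^sup>2\<close>.
\<close>

lemma kexp_has_vector_derivative:
  assumes \<sigma>: "\<sigma> \<in> {1, -1 :: real}"
  shows "((\<lambda>t. kexp \<sigma> k (t - s)) has_vector_derivative (- (2 * pi * \<sigma>)) *\<^sub>R (vecq k \<odot> kexp \<sigma> k (t - s))) (at t)"
proof (cases "k = 0")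
  case True
  have "vecq 0 = 0" by (simp add: vecq_def)
  with True show ?thesis by (simp add: kexp_def bounded_bilinear.zero_left[OF bounded_bilinear_bq_mult])
next
  case False
  define n where "n = norm k"
  have n: "n \<noteq> 0" using False by (simp add: n_def)
  define S C where "S = sin (2 * pi * n * (t - s))" and "C = cos (2 * pi * n * (t - s))"
  have \<sigma>2: "\<sigma> * \<sigma> = 1" using \<sigma> by auto
  have eq: "kexp \<sigma> k \<tau> = cos (2 * pi * n * \<tau>) *\<^sub>R bq_one - (\<sigma> * (sin (2 * pi * n * \<tau>) / n)) *\<^sub>R vecq k" for \<tau>
    by (simp only: kexp_def of_real_vector_scalar n_def)
  have c: "((\<lambda>t. cos (2 * pi * n * (t - s))) has_field_derivative - (S * (2 * pi * n))) (at t)"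
    unfolding S_def by (auto intro!: derivative_eq_intros)
  have d: "((\<lambda>t. \<sigma> * (sin (2 * pi * n * (t - s)) / n)) has_field_derivative \<sigma> * (C * (2 * pi * n) / n)) (at t)"
    unfolding C_def using n by (auto intro!: derivative_eq_intros)
  have "((\<lambda>t. kexp \<sigma> k (t - s)) has_vector_derivative
      (- (S * (2 * pi * n))) *\<^sub>R bq_one - (\<sigma> * (C * (2 * pi * n) / n)) *\<^sub>R vecq k) (at t)"
    unfolding eq
    using has_vector_derivative_diff[OF has_vector_derivative_scaleR[OF c has_vector_derivative_const[of bq_one]]
        has_vector_derivative_scaleR[OF d has_vector_derivative_const[of "vecq k"]]] by simp
  also have "(- (S * (2 * pi * n))) *\<^sub>R bq_one - (\<sigma> * (C * (2 * pi * n) / n)) *\<^sub>R vecq k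
      = (- (2 * pi * \<sigma>)) *\<^sub>R (vecq k \<odot> kexp \<sigma> k (t - s))"
  proof -
    have "vecq k \<odot> kexp \<sigma> k (t - s) = C *\<^sub>R vecq k + (\<sigma> * (S / n) * n\<^sup>2) *\<^sub>R bq_one"
      unfolding eq S_def[symmetric] C_def[symmetric] bounded_bilinear.diff_right[OF bounded_bilinear_bq_mult]
        bounded_bilinear.scaleR_right[OF bounded_bilinear_bq_mult] vecq_square bq_mult_one
      by (simp add: n_def)
    moreover have "(2 * pi * \<sigma>) * (\<sigma> * (S / n) * n\<^sup>2) = S * (2 * pi * n)"
    proof -
      have "(2 * pi * \<sigma>) * (\<sigma> * (S / n) * n\<^sup>2) = (\<sigma> * \<sigma>) * (S * (2 * pi * n))"
        using n by (simp add: power2_eq_square)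
      then show ?thesis by (simp add: \<sigma>2)
    qed
    moreover have "\<sigma> * (C * (2 * pi * n) / n) = (2 * pi * \<sigma>) * C" using n by simp
    ultimately show ?thesis by (simp only: scaleR_add_right scaleR_scaleR) (simp add: mult.assoc)
  qed
  finally show ?thesis .
qed

context l2_source
begin

lemma propagated_has_vector_derivative:
  "((\<lambda>t. propagated k s t) has_vector_derivative (- (2 * pi * \<sigma>)) *\<^sub>R (vecq k \<odot> propagated k s t)) (at t)"
proof -
  have "bounded_linear (\<lambda>p. p \<odot> source_hat k s)"
    by (rule bounded_bilinear.bounded_linear_left[OF bounded_bilinear_bq_mult])
  from bounded_linear.has_vector_derivative[OF this kexp_has_vector_derivative[OF sign, of k s t]]
  show ?thesis
    by (simp only: propagated_def bounded_bilinear.scaleR_left[OF bounded_bilinear_bq_mult] bq_mult_assoc)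
qed

lemma propagated_initial: "propagated k s s = source_hat k s"
  by (simp add: propagated_def kexp_0)

text \<open>
  The derivatives of a distribution are moved onto \<open>\<phi>\<close> with a minus sign; this is the integrand of
  the resulting pairing with \<open>solution\<close>.
\<close>

definition dirac_integrand :: "((real ^ 3) \<times> real \<Rightarrow> real) \<Rightarrow> ((real ^ 3) \<times> real) \<times> real \<Rightarrow> biquat" where
  "dirac_integrand \<phi> q =
     - (e1 \<odot> duhamel_integrand (dir_deriv \<phi> (axis 1 1, 0)) q
      + e2 \<odot> duhamel_integrand (dir_deriv \<phi> (axis 2 1, 0)) q
      + e3 \<odot> duhamel_integrand (dir_deriv \<phi> (axis 3 1, 0)) q)
     - (complex_of_real \<sigma> * \<i>) *s duhamel_integrand (dir_deriv \<phi> (0, 1)) q"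

text \<open>
  The product rule for the derivative in \<open>t\<close> of \<open>space_hat \<phi> k t *s propagated k s t\<close>.
\<close>

definition paired_derivative :: "((real ^ 3) \<times> real \<Rightarrow> real) \<Rightarrow> real ^ 3 \<Rightarrow> real \<Rightarrow> real \<Rightarrow> biquat" where
  "paired_derivative \<phi> k s t =
     space_hat \<phi> k t *s ((- (2 * pi * \<sigma>)) *\<^sub>R (vecq k \<odot> propagated k s t))
     + space_hat (dir_deriv \<phi> (0, 1)) k t *s propagated k s t"

text \<open>
  The space derivatives of \<open>\<phi>\<close> contribute \<open>2 \<pi> i \<phi>^ k\<close>, which equals \<open>- \<sigma> i\<close> times the term
  \<open>- 2 \<pi> \<sigma> \<phi>^ k\<close> in which the exponential is differentiated, as \<open>\<sigma>\<^sup>2 = 1\<close>. So the whole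
  integrand is a derivative in \<open>t\<close>.
\<close>

lemma dirac_integrand_eq:
  assumes smooth: "box_smooth R T \<phi>"
  shows "dirac_integrand \<phi> ((k, s), t) =
    (if 0 < s \<and> s < t then (- (complex_of_real \<sigma> * \<i>)) *s paired_derivative \<phi> k s t else 0)"
proof (cases "0 < s \<and> s < t")
  case True
  have hat: "space_hat (dir_deriv \<phi> (axis j 1, 0)) k t = - (2 * pi * \<i> * (k $ j)) * space_hat \<phi> k t" for j
    using space_hat_space_derivative[OF box_smoothD(1,2,4)[OF smooth], of j k t] by (simp add: inner_axis)
  have \<sigma>: "\<sigma> = 1 \<or> \<sigma> = -1" using sign by auto
  show ?thesis
    using True unfolding dirac_integrand_def paired_derivative_def duhamel_integrand_def
    by (simp add: hat, use \<sigma> in \<open>elim disjE\<close>)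
       (simp_all add: biquat_eq_iff bq_mult_def vecq_def e1_def e2_def e3_def scaleR_conv_of_real[where 'a = complex] algebra_simps)
next
  case False
  then have "duhamel_integrand \<psi> ((k, s), t) = 0" for \<psi> by (auto simp: duhamel_integrand_def)
  with False show ?thesis
    by (auto simp: dirac_integrand_def bounded_bilinear.zero_right[OF bounded_bilinear_bq_mult])
qed

lemma dirac_integrand_integrable:
  assumes smooth: "box_smooth R T \<phi>"
  shows "integrable (lborel \<Otimes>\<^sub>M lborel) (dirac_integrand \<phi>)"
  unfolding dirac_integrand_def[abs_def]
  by (intro Bochner_Integration.integrable_diff Bochner_Integration.integrable_add Bochner_Integration.integrable_minus
      integrable_bounded_linear[OF bq_mult_linear_right] integrable_bounded_linear[OF vector_scalar_linear_right]
      duhamel_integrand_integrable[OF box_smoothD(2)[OF smooth]] duhamel_integrand_integrable[OF box_smoothD(3)[OF smooth]])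

text \<open>
  The fundamental theorem of calculus on \<open>{s..max s T}\<close>: the pairing vanishes from time \<open>T\<close>
  onwards, and at \<open>t = s\<close> the exponential is one.
\<close>

lemma dirac_integrand_time_integral:
  assumes smooth: "box_smooth R T \<phi>"
    and int: "integrable lborel (\<lambda>t. dirac_integrand \<phi> ((k, s), t))"
  shows "(LINT t|lborel. dirac_integrand \<phi> ((k, s), t)) = (complex_of_real \<sigma> * \<i> * space_hat \<phi> k s) *s source_hat k s"
proof (cases "0 < s")
  case False
  then have "dirac_integrand \<phi> ((k, s), t) = 0" for t by (simp add: dirac_integrand_eq[OF smooth])
  moreover have "space_hat \<phi> k s = 0" using False by (intro space_hat_eq_0[OF box_smoothD(1)[OF smooth]]) auto
  ultimately show ?thesis by (simp add: bounded_bilinear.zero_left[OF bounded_bilinear_vector_scalar])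
next
  case True
  note d0 = box_smoothD(3)[OF smooth]
  let ?c = "- (complex_of_real \<sigma> * \<i>)"
  define F where "F t = ?c *s (space_hat \<phi> k t *s propagated k s t)" for t
  define T1 where "T1 = max s T"
  have F': "(F has_vector_derivative ?c *s paired_derivative \<phi> k s t) (at t)" for t
    unfolding F_def paired_derivative_def
    by (intro bounded_linear.has_vector_derivative[OF vector_scalar_linear_right]
        bounded_bilinear.has_vector_derivative[OF bounded_bilinear_vector_scalar]
        space_hat_time_derivative[OF smooth] propagated_has_vector_derivative)
  have "((\<lambda>t. ?c *s paired_derivative \<phi> k s t) has_integral (F T1 - F s)) {s..T1}"
  proof (rule fundamental_theorem_of_calculus)
    show "s \<le> T1" by (simp add: T1_def)
    show "(F has_vector_derivative ?c *s paired_derivative \<phi> k s t) (at t within {s..T1})" for t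
      by (rule has_vector_derivative_at_within[OF F'])
  qed
  then have "((\<lambda>t. dirac_integrand \<phi> ((k, s), t)) has_integral (F T1 - F s)) {s..T1}"
    \<comment> \<open>At the single point \<open>t = s\<close> the integrand is zero by definition.\<close>
    by (rule has_integral_spike_finite[of "{s}", rotated 2]) (use True in \<open>auto simp: dirac_integrand_eq[OF smooth]\<close>)
  then have "((\<lambda>t. if t \<in> {s..T1} then dirac_integrand \<phi> ((k, s), t) else 0) has_integral (F T1 - F s)) UNIV"
    by (simp only: has_integral_restrict_UNIV)
  moreover have "(if t \<in> {s..T1} then dirac_integrand \<phi> ((k, s), t) else 0) = dirac_integrand \<phi> ((k, s), t)" for t
  proof (cases "t \<in> {s..T1}")
    case False
    then consider "t < s" | "T \<le> t" by (auto simp: T1_def)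
    then have "dirac_integrand \<phi> ((k, s), t) = 0"
    proof cases
      case 2
      then have "paired_derivative \<phi> k s t = 0"
        using space_hat_eq_0[OF box_smoothD(1)[OF smooth], of t k] space_hat_eq_0[OF d0, of t k] by (simp add: paired_derivative_def vec_eq_iff)
      then show ?thesis by (simp add: dirac_integrand_eq[OF smooth])
    qed (simp add: dirac_integrand_eq[OF smooth])
    with False show ?thesis by simp
  qed simp
  ultimately have "((\<lambda>t. dirac_integrand \<phi> ((k, s), t)) has_integral (F T1 - F s)) UNIV" by simp
  moreover have "((\<lambda>t. dirac_integrand \<phi> ((k, s), t)) has_integral (LINT t|lborel. dirac_integrand \<phi> ((k, s), t))) UNIV"
    by (rule has_integral_integral_lborel[OF int])
  ultimately have "(LINT t|lborel. dirac_integrand \<phi> ((k, s), t)) = F T1 - F s"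
    by (metis has_integral_unique)
  moreover have "F T1 = 0"
    using space_hat_eq_0[OF box_smoothD(1)[OF smooth], of T1 k] by (simp add: F_def T1_def vec_eq_iff)
  ultimately show ?thesis
    by (simp add: F_def propagated_initial vec_eq_iff mult.assoc)
qed

lemma dirac_integrand_integral:
  assumes smooth: "box_smooth R T \<phi>"
  shows "integral\<^sup>L (lborel \<Otimes>\<^sub>M lborel) (dirac_integrand \<phi>) = (LINT p|lborel. (complex_of_real \<sigma> * \<i> * \<phi> p) *s f0 p)"
proof -
  let ?c = "complex_of_real \<sigma> * \<i>"
  note \<phi> = box_smoothD(1)[OF smooth]
  note [measurable] = box_supported_measurable[OF \<phi>]
  have D: "integrable (lborel \<Otimes>\<^sub>M lborel) (\<lambda>(p, t). dirac_integrand \<phi> (p, t))"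
    using dirac_integrand_integrable[OF smooth] by simp
  define H where "H p = (?c * space_hat \<phi> (fst p) (snd p)) *s source_hat (fst p) (snd p)" for p
  have [measurable]: "(\<lambda>p. space_hat \<phi> (fst p) (snd p)) \<in> borel_measurable (borel \<Otimes>\<^sub>M borel)"
    by (rule space_hat_measurable[OF \<phi>]) measurable
  have "H \<in> borel_measurable (borel \<Otimes>\<^sub>M borel)" unfolding H_def by measurable
  then have Hm: "H \<in> borel_measurable lborel" by (simp add: borel_prod)
  have AE_H: "AE p in lborel. (LINT t|lborel. dirac_integrand \<phi> (p, t)) = H p"
    using lborel_pair.AE_integrable_fst[OF D]
  proof eventually_elim
    case (elim p)
    then show ?case
      using dirac_integrand_time_integral[OF smooth, of "fst p" "snd p"] by (simp add: H_def)
  qed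
  note D1 = lborel_pair.integrable_fst[OF D]
  have H: "integrable lborel H"
    by (rule integrable_cong_AE_imp[OF D1 Hm]) (use AE_H in \<open>auto elim!: eventually_mono\<close>)
  have "integral\<^sup>L (lborel \<Otimes>\<^sub>M lborel) (dirac_integrand \<phi>) = (LINT p|lborel. LINT t|lborel. dirac_integrand \<phi> (p, t))"
    using lborel_pair.integral_fst[OF D] by simp
  also have "\<dots> = (LINT p|lborel. H p)"
    by (rule integral_cong_AE[OF borel_measurable_integrable[OF D1] Hm AE_H])
  also have "\<dots> = (LINT s|lborel. LINT k|lborel. H (k, s))"
  proof -
    have "integrable (lborel \<Otimes>\<^sub>M lborel) (\<lambda>(k, s). H (k, s))" using H by (simp add: lborel_prod)
    from lborel_pair.integral_snd[OF this] show ?thesis by (simp add: lborel_prod)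
  qed
  also have "\<dots> = (LINT s|lborel. LINT x|lborel. (?c * \<phi> (x, s)) *s f0 (x, s))"
  proof (rule integral_cong_AE)
    have "(\<lambda>(s, k). H (k, s)) \<in> borel_measurable (borel \<Otimes>\<^sub>M borel)"
      unfolding H_def by measurable
    then show "(\<lambda>s. LINT k|lborel. H (k, s)) \<in> borel_measurable lborel" by measurable
    show "(\<lambda>s. LINT x|lborel. (?c * \<phi> (x, s)) *s f0 (x, s)) \<in> borel_measurable lborel" by measurable
    show "AE s in lborel. (LINT k|lborel. H (k, s)) = (LINT x|lborel. (?c * \<phi> (x, s)) *s f0 (x, s))"
      using AE_energy_finite
    proof eventually_elim
      case (elim s)
      obtain B where B: "\<And>p. \<bar>\<phi> p\<bar> \<le> B" using box_supported_bounded[OF \<phi>] by blast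
      note sl = box_supported_slice[OF \<phi>, of s]
      have vs: "(a * b) *s v = a *s (b *s v)" for a b and v :: biquat by (simp add: vec_eq_iff mult.assoc)
      note q = L2_slice[OF elim]
      have "(LINT k|lborel. H (k, s)) = (LINT k|lborel. ?c *s (space_hat \<phi> k s *s source_hat k s))"
        unfolding H_def fst_conv snd_conv by (simp only: vs)
      also have "\<dots> = ?c *s (LINT k|lborel. space_hat \<phi> k s *s source_hat k s)"
        unfolding space_hat_def source_hat_def
        by (rule integral_bounded_linear[OF vector_scalar_linear_right
              L2_biquat_scaled_integrable[OF square_integrable_reflected_fourier_L1[OF sl(1,2)] L2_biquat_fourier[OF q]]])
      also have "(LINT k|lborel. space_hat \<phi> k s *s source_hat k s) = (LINT x|lborel. complex_of_real (\<phi> (x, s)) *s f0 (x, s))"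
        unfolding space_hat_def source_hat_def
        by (rule fourier_L2_bq_parseval[OF q sl, of B]) (simp add: B)
      also have "?c *s (LINT x|lborel. complex_of_real (\<phi> (x, s)) *s f0 (x, s)) = (LINT x|lborel. ?c *s (complex_of_real (\<phi> (x, s)) *s f0 (x, s)))"
        by (rule integral_bounded_linear[OF vector_scalar_linear_right L2_biquat_scaled_integrable[OF sl(2) q], symmetric])
      finally show ?case by (simp only: vs)
    qed
  qed
  also have "\<dots> = (LINT p|lborel. (?c * \<phi> p) *s f0 p)"
  proof -
    from integrable_bounded_linear[OF vector_scalar_linear_right[of ?c] L2_biquat_scaled_integrable[OF box_supported_square_integrable[OF \<phi>] f0_L2]]
    have "integrable lborel (\<lambda>p. (?c * \<phi> p) *s f0 p)"
      by (simp add: vec.scale_scale)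
    then have "integrable (lborel \<Otimes>\<^sub>M lborel) (\<lambda>(x, s). (?c * \<phi> (x, s)) *s f0 (x, s))"
      by (simp add: lborel_prod split_beta')
    from lborel_pair.integral_snd[OF this] show ?thesis by (simp add: lborel_prod split_beta')
  qed
  finally show ?thesis .
qed

text \<open>
  \<open>S\<close> is left abstract so that the lemma applies to the regular distribution of every function
  equal to \<open>solution\<close> almost everywhere.
\<close>

lemma parabolic_dirac_solution:
  assumes \<phi>: "test_function (UNIV \<times> {0<..}) \<phi>"
    and S: "\<And>R T \<psi>. box_supported R T \<psi> \<Longrightarrow> S \<psi> = (LINT p|lborel. \<psi> p *\<^sub>R solution p)"
  shows "parabolic_dirac \<sigma> S \<phi> = (LINT p|lborel. (complex_of_real \<sigma> * \<i> * \<phi> p) *s f0 p)"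
proof -
  obtain R T where smooth: "box_smooth R T \<phi>"
    using test_function_box_smooth[OF \<phi>] .
  have dist: "distr_deriv b S \<phi> = - integral\<^sup>L (lborel \<Otimes>\<^sub>M lborel) (duhamel_integrand (dir_deriv \<phi> b))"
    if "box_supported R T (dir_deriv \<phi> b)" for b
    unfolding distr_deriv_def S[OF that] weighted_solution_integral[OF that] ..
  note ax = box_smoothD(2)[OF smooth] and tm = box_smoothD(3)[OF smooth]
  note I = duhamel_integrand_integrable[OF ax] and I0 = duhamel_integrand_integrable[OF tm]
  note J = integrable_bounded_linear[OF bq_mult_linear_right I] and J0 = integrable_bounded_linear[OF vector_scalar_linear_right I0]
  have "integral\<^sup>L (lborel \<Otimes>\<^sub>M lborel) (dirac_integrand \<phi>) = parabolic_dirac \<sigma> S \<phi>"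
    unfolding dirac_integrand_def[abs_def] parabolic_dirac_def dirac_def dist[OF ax] dist[OF tm]
    by (simp add: J J0 integral_bounded_linear[OF bq_mult_linear_right I] integral_bounded_linear[OF vector_scalar_linear_right I0]
        bounded_bilinear.minus_right[OF bounded_bilinear_bq_mult] bounded_bilinear.minus_right[OF bounded_bilinear_vector_scalar])
  then show ?thesis by (simp add: dirac_integrand_integral[OF smooth])
qed

end


section \<open>The right inverse\<close>

text \<open>
  The theorem concerns Lebesgue measurable data, whereas the construction starts from a Borel
  function.
\<close>

lemma zero_ext_L2_version:
  assumes "open \<Omega>" and w: "square_integrable_bq (lebesgue_on (cyl \<Omega>)) w"
  obtains g where "L2_biquat lborel g" "AE p in lborel. zero_ext \<Omega> w p = g p"
proof -
  have cyl: "cyl \<Omega> \<in> sets lebesgue"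
  proof -
    have "open (cyl \<Omega>)" using \<open>open \<Omega>\<close> unfolding cyl_def by (intro open_Times) auto
    then show ?thesis by auto
  qed
  have comp: "\<exists>g. square_integrable lborel g \<and> (AE p in lborel. zero_ext \<Omega> w p $ j = g p)" for j
  proof -
    have sq: "square_integrable (lebesgue_on (cyl \<Omega>)) (\<lambda>p. w p $ j)"
      using w by (simp add: square_integrable_bq_def)
    have z: "zero_ext \<Omega> w p $ j = (if p \<in> cyl \<Omega> then w p $ j else 0)" for p
      by (simp add: zero_ext_def)
    have "(\<lambda>p. zero_ext \<Omega> w p $ j) \<in> borel_measurable lebesgue"
      unfolding z using sq cyl
      by (subst measurable_restrict_space_iff[symmetric]) (auto simp: square_integrable_def)
    then obtain g where g: "g \<in> borel_measurable borel" "AE p in lborel. zero_ext \<Omega> w p $ j = g p"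
      by (rule lebesgue_borel_version)
    have "L2_mass lborel g = L2_mass lborel (\<lambda>p. zero_ext \<Omega> w p $ j)"
      by (rule nn_integral_cong_AE) (use g(2) in \<open>eventually_elim, simp\<close>)
    also have "\<dots> = (\<integral>\<^sup>+p. ennreal ((cmod (w p $ j))\<^sup>2) * indicator (cyl \<Omega>) p \<partial>lebesgue)"
      unfolding z by (subst nn_integral_completion) (auto intro!: nn_integral_cong split: split_indicator)
    also have "\<dots> = (\<integral>\<^sup>+p. ennreal ((cmod (w p $ j))\<^sup>2) \<partial>lebesgue_on (cyl \<Omega>))"
      using cyl by (subst nn_integral_restrict_space) auto
    also have "\<dots> < \<infinity>" using sq by (simp add: square_integrable_nn)
    finally show ?thesis using g by (auto simp: square_integrable_nn)
  qed
  then obtain g where g: "\<And>j. square_integrable lborel (g j)" "\<And>j. AE p in lborel. zero_ext \<Omega> w p $ j = g j p"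
    by metis
  have [measurable]: "g j \<in> borel_measurable borel" for j using g(1)[of j] by (simp add: square_integrable_def)
  let ?g = "\<lambda>p. (\<chi> j. g j p) :: biquat"
  show thesis
  proof
    have m: "?g \<in> borel_measurable lborel" by measurable
    show "L2_biquat lborel ?g"
      unfolding L2_biquat_def nn_integral_biquat_norm_power2[OF m]
      using m g(1) by (auto simp: square_integrable_nn)
    have "AE p in lborel. \<forall>j. zero_ext \<Omega> w p $ j = g j p"
      by (rule eventually_all_finite) (rule g(2))
    then show "AE p in lborel. zero_ext \<Omega> w p = ?g p"
      by eventually_elim (simp add: vec_eq_iff)
  qed
qed

lemma set_integrable_version:
  fixes u v :: "'a::euclidean_space \<Rightarrow> biquat"
  assumes K: "K \<in> sets borel" and eq: "AE p in lborel. p \<in> K \<longrightarrow> u p = v p"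
    and int: "integrable lborel (\<lambda>p. indicator K p *\<^sub>R v p)"
  shows "set_integrable lebesgue K u"
proof -
  have v: "integrable lebesgue (\<lambda>p. indicator K p *\<^sub>R v p)"
    using int by (subst integrable_completion) auto
  have ae: "AE p in lborel. indicator K p *\<^sub>R u p = indicator K p *\<^sub>R v p"
    using eq by eventually_elim (auto split: split_indicator)
  have "(\<lambda>p. indicator K p *\<^sub>R u p) \<in> borel_measurable lebesgue"
    by (rule lebesgue_measurable_cong_AE[OF borel_measurable_integrable[OF v] ae])
  then show ?thesis
    unfolding set_integrable_def
    by (rule integrable_cong_AE_imp[OF v]) (use AE_completion[OF ae] in \<open>auto elim!: eventually_mono\<close>)
qed

lemma locally_integrable_version:
  assumes eq: "AE p in lborel. p \<in> U \<longrightarrow> u p = v p"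
    and int: "\<And>K. compact K \<Longrightarrow> K \<subseteq> U \<Longrightarrow> integrable lborel (\<lambda>p. indicator K p *\<^sub>R v p)"
  shows "locally_integrable U u"
  unfolding locally_integrable_def
proof (intro allI impI)
  fix K assume K: "compact K \<and> K \<subseteq> U"
  show "set_integrable lebesgue K u"
  proof (rule set_integrable_version[OF _ _ int])
    show "AE p in lborel. p \<in> K \<longrightarrow> u p = v p"
      using eq by eventually_elim (use K in auto)
  qed (use K in \<open>auto simp: borel_closed compact_imp_closed\<close>)
qed

lemma regular_distr_version:
  fixes u v :: "'a::euclidean_space \<Rightarrow> biquat" and \<psi> :: "'a \<Rightarrow> real"
  assumes v: "v \<in> borel_measurable borel" and \<psi>: "\<psi> \<in> borel_measurable borel"
    and supp: "\<And>p. p \<notin> U \<Longrightarrow> \<psi> p = 0"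
    and eq: "AE p in lborel. p \<in> U \<longrightarrow> u p = v p"
  shows "regular_distr U u \<psi> = (LINT p|lborel. \<psi> p *\<^sub>R v p)"
proof -
  have ae: "AE p in lborel. indicator U p *\<^sub>R \<psi> p *\<^sub>R u p = \<psi> p *\<^sub>R v p"
    using eq by eventually_elim (use supp in \<open>auto split: split_indicator\<close>)
  have "(\<lambda>p. \<psi> p *\<^sub>R v p) \<in> borel_measurable lborel" using v \<psi> by simp
  note m = this measurable_completion[OF this]
  have "regular_distr U u \<psi> = (LINT p|lebesgue. \<psi> p *\<^sub>R v p)"
    unfolding regular_distr_def set_lebesgue_integral_def
    by (rule integral_cong_AE[OF lebesgue_measurable_cong_AE[OF m(2) ae] m(2) AE_completion[OF ae]])
  then show ?thesis by (simp add: integral_completion[OF m(1)])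
qed

lemma (in l2_source) solution_integrable_compact:
  assumes "compact K" "K \<subseteq> UNIV \<times> {0<..}"
  shows "integrable lborel (\<lambda>p. indicator K p *\<^sub>R solution p)"
proof -
  obtain R T where KB: "K \<subseteq> cball 0 R \<times> {0<..<T}" using compact_half_space_box[OF assms] .
  have [measurable]: "K \<in> sets borel" using assms(1) by (simp add: borel_closed compact_imp_closed)
  show ?thesis
  proof (rule integrableI_bounded)
    have "(\<integral>\<^sup>+p. ennreal (norm (indicator K p *\<^sub>R solution p)) \<partial>lborel)
        \<le> (\<integral>\<^sup>+p. ennreal (norm (indicator (cball 0 R \<times> {0<..<T}) p *\<^sub>R solution p)) \<partial>lborel)"
      using KB by (intro nn_integral_mono) (auto split: split_indicator)
    also have "\<dots> < \<infinity>" by (rule nn_integral_solution_box)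
    finally show "(\<integral>\<^sup>+p. ennreal (norm (indicator K p *\<^sub>R solution p)) \<partial>lborel) < \<infinity>" .
  qed measurable
qed

lemma L2_biquat_integrable_compact:
  fixes q :: "'a::euclidean_space \<Rightarrow> biquat"
  assumes q: "L2_biquat lborel q" and K: "compact K"
  shows "integrable lborel (\<lambda>p. indicator K p *\<^sub>R q p)"
proof -
  have m: "K \<in> sets borel" using K by (simp add: borel_closed compact_imp_closed)
  have ind: "(cmod (complex_of_real (indicator K x)))\<^sup>2 = (indicator K x :: real)" for x :: 'a
    by (simp split: split_indicator)
  have "square_integrable lborel (\<lambda>x. complex_of_real (indicator K x))"
    unfolding square_integrable_def ind
    using m emeasure_compact_finite[OF K] by (auto intro!: integrable_real_indicator)
  from L2_biquat_scaled_integrable[OF this q] show ?thesis by (simp only: of_real_vector_scalar)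
qed

theorem theorem10:
  fixes \<Omega> :: "(real ^ 3) set"
    and w :: "(real ^ 3) \<times> real \<Rightarrow> biquat"
    and \<sigma> :: real
  assumes "domain \<Omega>" and "bounded \<Omega>"
    and "square_integrable_bq (lebesgue_on (cyl \<Omega>)) w"
    and "\<sigma> \<in> {1, -1}"
  shows "is_teodorescu \<Omega> \<sigma> (\<lambda>p. (- complex_of_real \<sigma> * \<i>) *s w p)
      (teodorescu \<Omega> \<sigma> (\<lambda>p. (- complex_of_real \<sigma> * \<i>) *s w p)) \<and>
    parabolic_dirac_eq (UNIV \<times> {0<..}) \<sigma>
      (teodorescu \<Omega> \<sigma> (\<lambda>p. (- complex_of_real \<sigma> * \<i>) *s w p)) (zero_ext \<Omega> w)"
proof -
  let ?c = "- complex_of_real \<sigma> * \<i>"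
  let ?f = "\<lambda>p. ?c *s w p"
  let ?U = "(UNIV :: (real^3) set) \<times> {0<..}"
  define u where "u = teodorescu \<Omega> \<sigma> ?f"
  obtain g where g: "L2_biquat lborel g" "AE p in lborel. zero_ext \<Omega> w p = g p"
    using zero_ext_L2_version[OF _ assms(3)] assms(1) by (auto simp: domain_def)
  have gm [measurable]: "g \<in> borel_measurable borel" using g(1) by (simp add: L2_biquat_def)
  define f0 where "f0 p = ?c *s g p" for p
  have "cmod ?c = 1" using assms(4) by (auto simp: norm_mult)
  then have "L2_biquat lborel f0"
    using g(1) unfolding L2_biquat_def f0_def norm_vector_scalar by simp
  then interpret l2_source \<sigma> f0
    using assms(4) by unfold_locales
  have "AE p in lborel. zero_ext \<Omega> ?f p = f0 p"
    using g(2) by eventually_elim (auto simp: zero_ext_def f0_def vec_eq_iff)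
  then have sol: "is_teodorescu \<Omega> \<sigma> ?f solution" by (rule is_teodorescu_solution)
  then have u: "is_teodorescu \<Omega> \<sigma> ?f u"
    unfolding u_def teodorescu_def by (rule someI[of "is_teodorescu \<Omega> \<sigma> ?f"])
  have u_sol: "AE p in lborel. p \<in> ?U \<longrightarrow> u p = solution p"
    using is_teodorescu_unique[OF u sol] by (simp add: cyl_def)
  have w_g: "AE p in lborel. p \<in> ?U \<longrightarrow> zero_ext \<Omega> w p = g p"
    using g(2) by eventually_elim simp
  have "parabolic_dirac_eq ?U \<sigma> u (zero_ext \<Omega> w)"
    unfolding parabolic_dirac_eq_def
  proof (intro conjI allI impI)
    show "locally_integrable ?U u"
      by (rule locally_integrable_version[OF u_sol solution_integrable_compact])
    show "locally_integrable ?U (zero_ext \<Omega> w)"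
      by (rule locally_integrable_version[OF w_g L2_biquat_integrable_compact[OF g(1)]])
    fix \<phi> :: "(real^3) \<times> real \<Rightarrow> real" assume \<phi>: "test_function ?U \<phi>"
    have boxm: "\<psi> \<in> borel_measurable borel" "\<And>p. p \<notin> ?U \<Longrightarrow> \<psi> p = 0" if "box_supported R T \<psi>" for R T \<psi>
      using box_supported_measurable[OF that] that by (auto simp: borel_prod box_supported_def)
    have "parabolic_dirac \<sigma> (regular_distr ?U u) \<phi> = (LINT p|lborel. (complex_of_real \<sigma> * \<i> * \<phi> p) *s f0 p)"
    proof (rule parabolic_dirac_solution[OF \<phi>])
      show "regular_distr ?U u \<psi> = (LINT p|lborel. \<psi> p *\<^sub>R solution p)" if "box_supported R T \<psi>" for R T \<psi>
        by (rule regular_distr_version[OF solution_measurable boxm[OF that] u_sol])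
    qed
    also have "\<dots> = (LINT p|lborel. \<phi> p *\<^sub>R g p)"
    proof (intro Bochner_Integration.integral_cong refl)
      fix p
      have "complex_of_real \<sigma> * \<i> * \<phi> p * ?c = \<phi> p" using assms(4) by (auto simp: complex_eq_iff)
      then show "(complex_of_real \<sigma> * \<i> * \<phi> p) *s f0 p = \<phi> p *\<^sub>R g p"
        by (simp only: f0_def vec.scale_scale of_real_vector_scalar)
    qed
    also have "\<dots> = regular_distr ?U (zero_ext \<Omega> w) \<phi>"
    proof -
      obtain R T where box: "box_supported R T \<phi>"
        using test_function_box_smooth[OF \<phi>] box_smoothD(1) by metis
      from regular_distr_version[OF gm boxm[OF box] w_g] show ?thesis by simp
    qed
    finally show "parabolic_dirac \<sigma> (regular_distr ?U u) \<phi> = regular_distr ?U (zero_ext \<Omega> w) \<phi>" .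
  qed
  with u show ?thesis unfolding u_def by blast
qed

end
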